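(* Being residually solvable is not a profinite property; being residually nilpotent is not a profinite property; and, for every prime $p$, being residually-$p$ is not a profinite property. That is, for each of these properties $P$ there exist finitely generated residually finite groups $\Gamma_1$ and $\Gamma_2$ with $\hat\Gamma_1 \simeq \hat\Gamma_2$ such that $\Gamma_1$ has $P$ and $\Gamma_2$ does not have $P$.
   Context: A property $P$ of groups is called a profinite property if whenever $\Gamma_1$ and $\Gamma_2$ are finitely generated residually finite groups with $\hat\Gamma_1 \simeq \hat\Gamma_2$ and $\Gamma_1$ has $P$, so does $\Gamma_2$. Here $\hat\Gamma$ denotes the profinite completion of $\Gamma$ (the inverse limit of its finite quotients), and $\simeq$ is isomorphism of topological groups. A group is residually solvable (resp. residually nilpotent, residually-$p$ for a prime $p$) if its homomorphisms to finite solvable groups (resp. finite nilpotent groups, finite $p$-groups) separate the points of the group. *)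

theory Defs
  imports
    "HOL-Algebra.Product_Groups"
    "HOL-Algebra.Solvable_Groups"
    "HOL-Analysis.Function_Topology"
    "HOL-Computational_Algebra.Primes"
begin

definition finitely_generated :: "'a monoid \<Rightarrow> bool" where
  "finitely_generated G \<longleftrightarrow> (\<exists>S. finite S \<and> S \<subseteq> carrier G \<and> generate G S = carrier G)"

(* The target groups range over nat monoid; since they are finite, this loses no
   generality up to isomorphism. *)
definition residually :: "(nat monoid \<Rightarrow> bool) \<Rightarrow> 'a monoid \<Rightarrow> bool" where
  "residually C G \<longleftrightarrow>
     (\<forall>x \<in> carrier G. \<forall>y \<in> carrier G. x \<noteq> y \<longrightarrow>
        (\<exists>H h. Group.group H \<and> finite (carrier H) \<and> C H \<and> h \<in> hom G H \<and> h x \<noteq> h y))"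

primrec lower_central_series :: "'a monoid \<Rightarrow> nat \<Rightarrow> 'a set" where
  "lower_central_series G 0 = carrier G"
| "lower_central_series G (Suc n) =
     generate G (\<Union>x \<in> carrier G. \<Union>y \<in> lower_central_series G n.
       {x \<otimes>\<^bsub>G\<^esub> y \<otimes>\<^bsub>G\<^esub> inv\<^bsub>G\<^esub> x \<otimes>\<^bsub>G\<^esub> inv\<^bsub>G\<^esub> y})"

definition nilpotent :: "'a monoid \<Rightarrow> bool" where
  "nilpotent G \<longleftrightarrow> (\<exists>n. lower_central_series G n = {\<one>\<^bsub>G\<^esub>})"

definition residually_finite :: "'a monoid \<Rightarrow> bool" where
  "residually_finite = residually (\<lambda>H. True)"

definition residually_solvable :: "'a monoid \<Rightarrow> bool" where
  "residually_solvable = residually solvable"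

definition residually_nilpotent :: "'a monoid \<Rightarrow> bool" where
  "residually_nilpotent = residually nilpotent"

definition residually_p :: "nat \<Rightarrow> 'a monoid \<Rightarrow> bool" where
  "residually_p p = residually (\<lambda>H. \<exists>n. Coset.order H = p ^ n)"

definition finite_index_normals :: "'a monoid \<Rightarrow> 'a set set" where
  "finite_index_normals G = {N. N \<lhd> G \<and> finite (rcosets\<^bsub>G\<^esub> N)}"

(* The inverse limit of the finite quotients G Mod N, as a subgroup of their product.
   For N \<subseteq> M the transition map G Mod N \<rightarrow> G Mod M sends N #> x to
   M #> x = M <#> (N #> x). *)
definition profinite_completion :: "'a monoid \<Rightarrow> ('a set \<Rightarrow> 'a set) monoid" where
  "profinite_completion G =
     (product_group (finite_index_normals G) (\<lambda>N. G Mod N))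
       \<lparr>carrier := {f \<in> (\<Pi>\<^sub>E N \<in> finite_index_normals G. carrier (G Mod N)).
          \<forall>N \<in> finite_index_normals G. \<forall>M \<in> finite_index_normals G.
            N \<subseteq> M \<longrightarrow> f M = M <#>\<^bsub>G\<^esub> f N}\<rparr>"

definition profinite_topology :: "'a monoid \<Rightarrow> ('a set \<Rightarrow> 'a set) topology" where
  "profinite_topology G =
     subtopology
       (product_topology (\<lambda>N. discrete_topology (carrier (G Mod N))) (finite_index_normals G))
       (carrier (profinite_completion G))"

definition same_profinite_completion :: "'a monoid \<Rightarrow> 'b monoid \<Rightarrow> bool" where
  "same_profinite_completion G K \<longleftrightarrow>
     (\<exists>h. h \<in> iso (profinite_completion G) (profinite_completion K) \<and>
          homeomorphic_map (profinite_topology G) (profinite_topology K) h)"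

(* Finitely generated groups are countable, so up to isomorphism all of them have
   their carrier inside nat. *)
definition profinite_property :: "(nat monoid \<Rightarrow> bool) \<Rightarrow> bool" where
  "profinite_property P \<longleftrightarrow>
     (\<forall>G K. Group.group G \<and> finitely_generated G \<and> residually_finite G \<and>
            Group.group K \<and> finitely_generated K \<and> residually_finite K \<and>
            same_profinite_completion G K \<and> P G \<longrightarrow> P K)"

end

theory Submission
  imports Defs "HOL-Algebra.Sylow" "HOL-Algebra.Group_Action" "HOL-Algebra.Multiplicative_Group"
    "HOL-Library.Poly_Mapping" "HOL-Number_Theory.Cong" "HOL-Computational_Algebra.Polynomial"
begin

text \<open>Fix a prime \<open>p\<close>, put \<open>q = p + 1\<close>, and let \<open>A\<close> be the ring of integral combinations of monomials
  \<open>t^e\<close> with \<open>e \<ge> 0\<close> in \<open>Z[1/q]\<close>. Let \<open>G\<close> be the group generated by the elementary matrices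
  \<open>e_ij(\<plusminus>(1 - t))\<close> of size 3 and the substitution \<open>t \<mapsto> t^q\<close>. It acts on \<open>A\<^sup>3\<close>, on the submodule \<open>I\<^sup>3\<close>
  of vectors vanishing at \<open>t = 0\<close>, and on the quotient \<open>\<int>\<^sup>3\<close>, where the matrices become \<open>e_ij(\<plusminus>1)\<close>.
  The two groups are \<open>\<Gamma>\<^sub>1 = A\<^sup>3 \<rtimes> G\<close> and \<open>\<Gamma>\<^sub>2 = (I\<^sup>3 \<times> \<int>\<^sup>3) \<rtimes> G\<close>.

  On a finite \<open>G\<close>-equivariant quotient of \<open>I\<^sup>3\<close> some power of the substitution is trivial, so
  \<open>t^(q^n) = t\<close> there, and \<open>t^(q^n - 1)\<close> behaves like the missing constant \<open>1\<close>. Hence the inclusion of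
  \<open>I\<^sup>3\<close> into \<open>A\<^sup>3\<close> splits after completion, and \<open>\<Gamma>\<^sub>1\<close>, \<open>\<Gamma>\<^sub>2\<close> have the same profinite completion.
  Evaluation at points \<open>t \<equiv> 1\<close> modulo powers of \<open>p\<close>, where the matrices are congruent to \<open>1\<close>, shows
  that \<open>\<Gamma>\<^sub>1\<close> is residually-\<open>p\<close>. But elementary 3 by 3 matrices are commutators of each other, so
  \<open>\<int>\<^sup>3 \<subseteq> \<Gamma>\<^sub>2\<close> dies in every finite solvable quotient.\<close>

section \<open>Finite p-groups and residual properties\<close>

text \<open>The entry 1 - t has two faces. At a point t = s with s = 1 modulo p it is divisible by
  p, so the matrices are unipotent for the p-adic filtration of values; at t = 0 it is a unit, and
  the matrices generate a perfect group. The integral vectors, on which they act through t = 0, are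
  a quotient of the module of \<open>\<Gamma>\<^sub>1\<close> but a submodule of that of
  \<open>\<Gamma>\<^sub>2\<close>, and a residual property only notices subgroups. Fractional
  exponents make t \<mapsto> t^q invertible; conjugation by it turns 1 - t into 1 - t^(1/q^n), which
  is how finitely many elements generate modules with infinitely many monomials. The choice q = p +
  1 makes q prime to p, so that exponents have residues modulo p^m, and congruent to 1 modulo p, so
  that the substitution acts on these residues with p-power order. Both modules are placed, as
  \<open>submod 1\<close> and \<open>submod 0\<close> of one family, in A^3 x Z^3. A retraction onto
  \<open>submod c\<close> that is equivariant only modulo a given finite-index subgroup extends that
  subgroup to the common overgroup.\<close>

lemma p_group_card_fixed_points:
  fixes G (structure)
  assumes act: "group_action G X \<phi>" and EX: "E \<subseteq> X" and fin: "finite E"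
    and p: "Factorial_Ring.prime p" and ord: "Coset.order G = p ^ n"
    and inv: "\<And>g x. g \<in> carrier G \<Longrightarrow> x \<in> E \<Longrightarrow> \<phi> g x \<in> E"
    and dvd: "p dvd card E"
  shows "p dvd card {x \<in> E. \<forall>g \<in> carrier G. \<phi> g x = x}"
proof -
  interpret group_action G X \<phi> by (rule act)
  interpret group G using group_hom group_hom.axioms(1) by auto
  define F where "F = {x \<in> E. \<forall>g \<in> carrier G. \<phi> g x = x}"
  have orb_sub: "orbit G \<phi> x \<subseteq> E - F" if x: "x \<in> E - F" for x
  proof
    fix y assume "y \<in> orbit G \<phi> x"
    then obtain g where g: "g \<in> carrier G" "y = \<phi> g x" by (auto simp: orbit_def)
    have "y \<in> E" using inv g x by auto
    moreover have "y \<notin> F"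
    proof
      assume "y \<in> F"
      then have "\<phi> (inv g) y = y" using g by (auto simp: F_def)
      moreover have "\<phi> (inv g) y = x"
        using g x EX orbit_sym_aux by blast
      ultimately show False using \<open>y \<in> F\<close> x by auto
    qed
    ultimately show "y \<in> E - F" by auto
  qed
  have orb_dvd: "p dvd card (orbit G \<phi> x)" if x: "x \<in> E - F" for x
  proof -
    have xX: "x \<in> X" using x EX by auto
    have xo: "x \<in> orbit G \<phi> x" using xX orbit_refl by auto
    have "card (orbit G \<phi> x) dvd p ^ n"
      using orbit_stabilizer_theorem[OF xX] ord by (metis dvd_triv_left)
    then obtain k where k: "card (orbit G \<phi> x) = p ^ k"
      using p divides_primepow_nat by blast
    have "k \<noteq> 0"
    proof
      assume "k = 0"
      then obtain y where y: "orbit G \<phi> x = {y}" using k card_1_singletonE by auto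
      then have "orbit G \<phi> x = {x}" using xo by auto
      then have "x \<in> F" using x by (auto simp: F_def orbit_def)
      then show False using x by auto
    qed
    then show ?thesis using k by auto
  qed
  \<comment> \<open>The points of \<open>E\<close> that are not fixed fill whole orbits, each of
    size a positive power of p.\<close>
  have "p dvd card (\<Union> ((\<lambda>x. orbit G \<phi> x) ` (E - F)))"
  proof (rule dvd_partition)
    show "finite (\<Union> (orbit G \<phi> ` (E - F)))"
      using orb_sub fin by (meson UN_least finite_Diff finite_subset)
    show "\<forall>c\<in>orbit G \<phi> ` (E - F). p dvd card c" using orb_dvd by auto
    show "\<forall>c1\<in>orbit G \<phi> ` (E - F). \<forall>c2\<in>orbit G \<phi> ` (E - F). c1 \<noteq> c2 \<longrightarrow> c1 \<inter> c2 = {}"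
      using disjoint_union EX unfolding orbits_def by blast
  qed
  also have "\<Union> ((\<lambda>x. orbit G \<phi> x) ` (E - F)) = E - F"
    using orb_sub orbit_refl EX by blast
  finally have "p dvd card (E - F)" .
  moreover have "card E = card F + card (E - F)"
    using fin card_Un_disjoint[of F "E - F"] by (auto simp: F_def finite_subset Un_absorb1)
  ultimately show ?thesis using dvd unfolding F_def[symmetric]
    by (metis dvd_add_left_iff)
qed

lemma (in normal) conj_r_coset:
  assumes "g \<in> carrier G" "x \<in> carrier G"
  shows "g <# (H #> x) #> inv g = H #> (g \<otimes> x \<otimes> inv g)"
proof -
  have "g <# (H #> x) = (g <# H) #> x"
    using assms by (simp add: rcos_assoc_lcos subset lcos_m_assoc l_coset_def r_coset_def m_assoc)
  also have "\<dots> = (H #> g) #> x" using assms coset_eq by auto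
  also have "\<dots> = H #> (g \<otimes> x)" using assms by (simp add: coset_mult_assoc subset)
  finally show ?thesis using assms by (simp add: coset_mult_assoc subset)
qed

lemma (in group) p_group_central_step:
  assumes p: "Factorial_Ring.prime p" and ord: "Coset.order G = p ^ n"
    and N: "N \<lhd> G" and nt: "N \<noteq> {\<one>}"
  obtains M where "M \<lhd> G" "M \<subset> N"
    "\<And>g x. g \<in> carrier G \<Longrightarrow> x \<in> N \<Longrightarrow> g \<otimes> x \<otimes> inv g \<otimes> inv x \<in> M"
proof -
  have "Coset.order G > 0" using ord p by (simp add: prime_gt_0_nat)
  then have fin: "finite (carrier G)" using order_gt_0_iff_finite by blast
  have Nsub: "subgroup N G" using N normal_imp_subgroup by blast
  have NG: "N \<subseteq> carrier G" using Nsub subgroup.subset by blast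
  have finN: "finite N" using NG fin finite_subset by blast
  \<comment> \<open>For \<open>M\<close> maximal below \<open>N\<close>, the cosets in \<open>N / M\<close> fixed by conjugation form a nontrivial subgroup, hence all.\<close>
  define \<M> where "\<M> = {M. M \<lhd> G \<and> M \<subset> N}"
  have "finite \<M>" unfolding \<M>_def using finN
    by (rule_tac finite_subset[of _ "Pow N"]) auto
  moreover have "{\<one>} \<in> \<M>" unfolding \<M>_def
    using nt one_is_normal subgroup.one_closed[OF Nsub] by auto
  ultimately obtain M where M: "M \<in> \<M>" and Mmax: "\<And>M'. M' \<in> \<M> \<Longrightarrow> \<not> M \<subset> M'"
    using finite_has_maximal[of \<M>] by (metis empty_iff psubset_eq)
  interpret M: normal M G using M by (simp add: \<M>_def)
  have MN: "M \<subset> N" using M by (simp add: \<M>_def)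
  define E where "E = (\<lambda>x. M #> x) ` N"
  have card_dvd: "\<exists>k. card K = p ^ k" if "subgroup K G" for K
  proof -
    have "card K dvd p ^ n" using lagrange[OF that] ord by (metis dvd_triv_right)
    then show ?thesis using p divides_primepow_nat by blast
  qed
  obtain a where a: "card N = p ^ a" using card_dvd Nsub by blast
  obtain b where b: "card M = p ^ b" using card_dvd M.subgroup_axioms by blast
  have "p ^ b < p ^ a" using psubset_card_mono[OF finN MN] a b by simp
  then have ab: "b < a" using p by (meson power_less_imp_less_exp prime_gt_1_nat)
  interpret NG: group "G\<lparr>carrier := N\<rparr>" using subgroup.subgroup_is_group[OF Nsub is_group] .
  have "subgroup M (G\<lparr>carrier := N\<rparr>)"
    using MN M.subgroup_axioms Nsub subgroup_incl by blast
  then have "card (rcosets\<^bsub>G\<lparr>carrier := N\<rparr>\<^esub> M) * card M = Coset.order (G\<lparr>carrier := N\<rparr>)"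
    using NG.lagrange by blast
  moreover have "rcosets\<^bsub>G\<lparr>carrier := N\<rparr>\<^esub> M = E"
    by (auto simp: E_def RCOSETS_def r_coset_def)
  ultimately have "card E * p ^ b = p ^ a" using a b by (simp add: Coset.order_def)
  also have "p ^ a = p ^ (a - b) * p ^ b" using ab by (simp flip: power_add)
  finally have "card E = p ^ (a - b)" using p by (simp add: prime_gt_0_nat)
  then have pE: "p dvd card E" using ab by simp
  define \<phi> where "\<phi> = (\<lambda>g. \<lambda>H \<in> {H. H \<subseteq> carrier G}. g <# H #> inv g)"
  have EX: "E \<subseteq> {H. H \<subseteq> carrier G}"
    unfolding E_def using NG M.subset r_coset_subset_G by blast
  have \<phi>: "\<phi> g (M #> x) = M #> (g \<otimes> x \<otimes> inv g)" if "g \<in> carrier G" "x \<in> carrier G" for g x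
    using that M.conj_r_coset M.subset r_coset_subset_G by (auto simp: \<phi>_def)
  have conjN: "g \<otimes> x \<otimes> inv g \<in> N" if "g \<in> carrier G" "x \<in> N" for g x
    using that N normal.inv_op_closed2 by metis
  have "p dvd card {C \<in> E. \<forall>g \<in> carrier G. \<phi> g C = C}"
  proof (rule p_group_card_fixed_points[OF _ EX _ p ord _ pE])
    show "group_action G {H. H \<subseteq> carrier G} \<phi>"
      unfolding \<phi>_def by (rule action_by_conjugation_on_power_set)
    show "finite E" unfolding E_def using finN by simp
    show "\<phi> g C \<in> E" if "g \<in> carrier G" "C \<in> E" for g C
      using that \<phi> conjN NG unfolding E_def by auto
  qed
  \<comment> \<open>The coset \<open>M\<close> is itself fixed, so the number of fixed cosets is a
    positive multiple of p and some fixed coset differs from \<open>M\<close>.\<close>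
  moreover have "M \<in> {C \<in> E. \<forall>g \<in> carrier G. \<phi> g C = C}"
  proof -
    have 1: "M = M #> \<one>" using M.subset by simp
    have "\<one> \<in> N" using subgroup.one_closed[OF Nsub] .
    then have "M \<in> E" unfolding E_def using 1 by blast
    moreover have "\<phi> g M = M" if "g \<in> carrier G" for g
      using \<phi>[OF that one_closed] 1 that by simp
    ultimately show ?thesis by auto
  qed
  moreover have "finite {C \<in> E. \<forall>g \<in> carrier G. \<phi> g C = C}" unfolding E_def using finN by simp
  ultimately have "p \<le> card {C \<in> E. \<forall>g \<in> carrier G. \<phi> g C = C}"
    by (intro dvd_imp_le) (auto simp: card_gt_0_iff)
  then have "\<not> {C \<in> E. \<forall>g \<in> carrier G. \<phi> g C = C} \<subseteq> {M}"
    using card_mono[of "{M}" "{C \<in> E. \<forall>g \<in> carrier G. \<phi> g C = C}"] prime_ge_2_nat[OF p] by auto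
  then obtain C where C: "C \<in> E" "\<And>g. g \<in> carrier G \<Longrightarrow> \<phi> g C = C" "C \<noteq> M" by blast
  then obtain z where z: "z \<in> N" "C = M #> z" unfolding E_def by blast
  then have zfix: "M #> (g \<otimes> z \<otimes> inv g) = M #> z" if "g \<in> carrier G" for g
    using that C(2) \<phi>[of g z] NG by (simp add: subset_iff)
  define M' where "M' = {x \<in> N. \<forall>g \<in> carrier G. M #> (g \<otimes> x \<otimes> inv g) = M #> x}"
  have M'G: "x \<in> carrier G" if "x \<in> M'" for x using that NG M'_def by auto
  have "M' \<lhd> G"
  proof (rule normal_invI)
    show "subgroup M' G"
    proof (rule subgroupI)
      show "M' \<subseteq> carrier G" using M'G by blast
      show "M' \<noteq> {}" using z zfix unfolding M'_def by blast
    next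
      fix x assume x: "x \<in> M'"
      have "M #> (g \<otimes> inv x \<otimes> inv g) = M #> inv x" if g: "g \<in> carrier G" for g
      proof -
        have "M #> (g \<otimes> inv x \<otimes> inv g) = set_inv (M #> (g \<otimes> x \<otimes> inv g))"
          using x g M'G M.rcos_inv by (simp add: inv_mult_group m_assoc)
        also have "\<dots> = set_inv (M #> x)" using x g by (simp add: M'_def)
        finally show ?thesis using x M'G M.rcos_inv by simp
      qed
      then show "inv x \<in> M'" using x subgroup.m_inv_closed[OF Nsub] by (auto simp: M'_def)
    next
      fix x y assume xy: "x \<in> M'" "y \<in> M'"
      have "M #> (g \<otimes> (x \<otimes> y) \<otimes> inv g) = M #> (x \<otimes> y)" if g: "g \<in> carrier G" for g
      proof -
        have "g \<otimes> (x \<otimes> y) \<otimes> inv g = (g \<otimes> x \<otimes> inv g) \<otimes> (g \<otimes> y \<otimes> inv g)"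
          using g xy M'G by (simp add: m_assoc inv_solve_left)
        then have "M #> (g \<otimes> (x \<otimes> y) \<otimes> inv g) = (M #> (g \<otimes> x \<otimes> inv g)) <#> (M #> (g \<otimes> y \<otimes> inv g))"
          using M.rcos_sum g xy M'G by simp
        also have "\<dots> = (M #> x) <#> (M #> y)" using xy g by (simp add: M'_def)
        finally show ?thesis using M.rcos_sum xy M'G by simp
      qed
      then show "x \<otimes> y \<in> M'" using xy subgroup.m_closed[OF Nsub] by (auto simp: M'_def)
    qed
  next
    fix x h assume h: "h \<in> carrier G" and x: "x \<in> M'"
    have "M #> (g \<otimes> (h \<otimes> x \<otimes> inv h) \<otimes> inv g) = M #> (h \<otimes> x \<otimes> inv h)" if g: "g \<in> carrier G" for g
    proof -
      have "g \<otimes> (h \<otimes> x \<otimes> inv h) \<otimes> inv g = (g \<otimes> h) \<otimes> x \<otimes> inv (g \<otimes> h)"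
        using g h x M'G by (simp add: m_assoc inv_mult_group)
      then show ?thesis using g h x by (simp add: M'_def)
    qed
    then show "h \<otimes> x \<otimes> inv h \<in> M'" using x h conjN by (auto simp: M'_def)
  qed
  moreover have "M \<subseteq> M'"
  proof
    fix x assume x: "x \<in> M"
    then have "g \<otimes> x \<otimes> inv g \<in> M" if "g \<in> carrier G" for g using that M.inv_op_closed2 by blast
    then show "x \<in> M'" using x MN M.rcos_const[OF is_group] by (auto simp: M'_def M.rcos_const)
  qed
  moreover have "z \<in> M'" "z \<notin> M"
    using z zfix C(3) M.rcos_const[OF is_group] by (auto simp: M'_def)
  ultimately have "M' = N" using Mmax[of M'] unfolding \<M>_def M'_def by blast
  then have "g \<otimes> x \<otimes> inv g \<otimes> inv x \<in> M" if g: "g \<in> carrier G" and x: "x \<in> N" for g x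
  proof -
    have "M #> (g \<otimes> x \<otimes> inv g) = M #> x" using \<open>M' = N\<close> g x M'_def by auto
    then have "g \<otimes> x \<otimes> inv g \<in> M #> x"
      using rcos_self[OF _ M.subgroup_axioms, of "g \<otimes> x \<otimes> inv g"] g x NG by auto
    then show ?thesis using M.rcos_module_imp[OF is_group, of x "g \<otimes> x \<otimes> inv g"] x NG by blast
  qed
  then show thesis using that[of M] M.normal_axioms MN by blast
qed

lemma lower_central_series_normal:
  fixes G :: "'a monoid" (structure)
  assumes G: "group G"
  shows "lower_central_series G n \<lhd> G"
proof (induction n)
  case 0
  then show ?case using G group.normal_self by auto
next
  case (Suc n)
  interpret group G by (rule G)
  interpret L: normal "lower_central_series G n" G by (rule Suc)
  show ?case unfolding lower_central_series.simps
  proof (rule normal_generateI)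
    show "(\<Union>x\<in>carrier G. \<Union>y\<in>lower_central_series G n. {x \<otimes> y \<otimes> inv x \<otimes> inv y}) \<subseteq> carrier G"
      using L.mem_carrier by auto
  next
    fix h g assume "h \<in> (\<Union>x\<in>carrier G. \<Union>y\<in>lower_central_series G n. {x \<otimes> y \<otimes> inv x \<otimes> inv y})"
      and g: "g \<in> carrier G"
    then obtain x y where xy: "x \<in> carrier G" "y \<in> lower_central_series G n" and h: "h = x \<otimes> y \<otimes> inv x \<otimes> inv y"
      by auto
    have yG: "y \<in> carrier G" using xy L.mem_carrier by blast
    define x' y' where "x' = g \<otimes> x \<otimes> inv g" and "y' = g \<otimes> y \<otimes> inv g"
    have "inv g \<otimes> (g \<otimes> z) = z" if "z \<in> carrier G" for z
      using g that by (simp flip: m_assoc)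
    then have "g \<otimes> h \<otimes> inv g = x' \<otimes> y' \<otimes> inv x' \<otimes> inv y'"
      using g xy yG unfolding h x'_def y'_def by (simp add: m_assoc inv_mult_group inv_solve_left)
    moreover have "y' \<in> lower_central_series G n" using xy g L.inv_op_closed2 unfolding y'_def by blast
    moreover have "x' \<in> carrier G" using g xy unfolding x'_def by blast
    ultimately show "g \<otimes> h \<otimes> inv g \<in> (\<Union>x\<in>carrier G. \<Union>y\<in>lower_central_series G n. {x \<otimes> y \<otimes> inv x \<otimes> inv y})"
      by auto
  qed
qed

text \<open>By \<open>p_group_central_step\<close> each nontrivial term of the lower central series
  has its successor inside a proper subgroup, and a finite group admits no infinite strict
  descent.\<close>

lemma p_group_nilpotent:
  fixes G :: "'a monoid" (structure)
  assumes G: "group G" and p: "Factorial_Ring.prime p" and ord: "Coset.order G = p ^ n"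
  shows "nilpotent G"
proof (rule ccontr)
  interpret group G by (rule G)
  note lower_central_series_normal = lower_central_series_normal[OF G]
  assume "\<not> nilpotent G"
  then have nt: "lower_central_series G k \<noteq> {\<one>}" for k by (auto simp: nilpotent_def)
  have "Coset.order G > 0" using ord p by (simp add: prime_gt_0_nat)
  then have fin: "finite (carrier G)" using order_gt_0_iff_finite by blast
  have less: "lower_central_series G (Suc k) \<subset> lower_central_series G k" for k
  proof -
    obtain M where M: "M \<lhd> G" "M \<subset> lower_central_series G k"
      "\<And>g x. g \<in> carrier G \<Longrightarrow> x \<in> lower_central_series G k \<Longrightarrow> g \<otimes> x \<otimes> inv g \<otimes> inv x \<in> M"
      using p_group_central_step[OF p ord lower_central_series_normal nt] by metis
    have "lower_central_series G (Suc k) \<subseteq> M"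
      unfolding lower_central_series.simps
      by (rule generate_subgroup_incl) (use M in \<open>auto simp: normal_imp_subgroup\<close>)
    then show ?thesis using M by blast
  qed
  have "card (lower_central_series G k) + k \<le> card (carrier G)" for k
  proof (induction k)
    case (Suc k)
    have "finite (lower_central_series G k)"
      using lower_central_series_normal fin by (meson finite_subset normal_imp_subgroup subgroup.subset)
    then have "card (lower_central_series G (Suc k)) < card (lower_central_series G k)"
      using less psubset_card_mono by blast
    then show ?case using Suc by linarith
  qed simp
  from this[of "Suc (card (carrier G))"] show False by simp
qed

text \<open>The derived series lies termwise below the lower central series, where only one entry of
  each commutator is restricted.\<close>

lemma nilpotent_imp_solvable:
  fixes G :: "'a monoid" (structure)
  assumes G: "group G" and "nilpotent G"
  shows "solvable G"
proof -
  interpret group G by (rule G)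
  have sub: "(derived G ^^ n) (carrier G) \<subseteq> lower_central_series G n" for n
  proof (induction n)
    case (Suc n)
    have "(derived G ^^ n) (carrier G) \<subseteq> carrier G"
      by (simp add: exp_of_derived_in_carrier)
    then have "derived_set G ((derived G ^^ n) (carrier G)) \<subseteq>
       (\<Union>x\<in>carrier G. \<Union>y\<in>lower_central_series G n. {x \<otimes> y \<otimes> inv x \<otimes> inv y})"
      using Suc by (intro UN_mono) auto
    then have "derived G ((derived G ^^ n) (carrier G)) \<subseteq> lower_central_series G (Suc n)"
      unfolding derived_def lower_central_series.simps by (rule mono_generate)
    then show ?case by simp
  qed simp
  obtain n where "lower_central_series G n = {\<one>}" using assms by (auto simp: nilpotent_def)
  then have "(derived G ^^ n) (carrier G) \<subseteq> {\<one>}" using sub[of n] by simp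
  moreover have "\<one> \<in> (derived G ^^ n) (carrier G)"
    using exp_of_derived_is_subgroup subgroup.one_closed subgroup_self by blast
  ultimately show ?thesis unfolding solvable_iff_trivial_derived_seq by blast
qed

text \<open>This is Cauchy's theorem: if a prime r other than p divided the order, the Sylow
  theorem, used with exponent 1, would give a subgroup of order r, and a nontrivial element of it
  has no p-power equal to the unit.\<close>

lemma (in group) order_prime_power_if_pow_prime_power:
  assumes p: "Factorial_Ring.prime p" and fin: "finite (carrier G)"
    and pow: "\<And>x. x \<in> carrier G \<Longrightarrow> \<exists>k. x [^] (p ^ k :: nat) = \<one>"
  shows "\<exists>n. Coset.order G = p ^ n"
proof -
  have pos: "Coset.order G > 0" using fin order_gt_0_iff_finite by blast
  have "Coset.order G = p ^ multiplicity p (Coset.order G)"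
  proof (rule ccontr)
    assume neq: "\<not> ?thesis"
    define m where "m = Coset.order G div p ^ multiplicity p (Coset.order G)"
    have m: "Coset.order G = p ^ multiplicity p (Coset.order G) * m"
      unfolding m_def by (simp add: multiplicity_dvd)
    have "m \<noteq> 1" using neq m by auto
    then obtain r where r: "Factorial_Ring.prime r" "r dvd m" using prime_factor_nat by blast
    have "\<not> p dvd m" using pos p unfolding m_def
      by (metis bot_nat_0.not_eq_extremum multiplicity_decompose not_prime_unit)
    then have rp: "r \<noteq> p" using r by auto
    obtain l where l: "Coset.order G = r ^ 1 * l" using r m by (metis dvd_def mult.left_commute power_one_right)
    obtain H where H: "subgroup H G" "card H = r"
      using sylow_thm[OF r(1) is_group l fin] by auto
    have "\<exists>x \<in> H. x \<noteq> \<one>"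
      using H r by (metis is_singletonI' is_singleton_altdef not_prime_1 subgroup.one_closed empty_iff)
    then obtain x where x: "x \<in> H" "x \<noteq> \<one>" by blast
    have xG: "x \<in> carrier G" using x H subgroup.mem_carrier by metis
    interpret H: group "G\<lparr>carrier := H\<rparr>" using subgroup.subgroup_is_group[OF H(1) is_group] .
    have "x [^]\<^bsub>G\<lparr>carrier := H\<rparr>\<^esub> Coset.order (G\<lparr>carrier := H\<rparr>) = \<one>"
      using H.pow_order_eq_1 x by simp
    then have "x [^] r = \<one>" using H(2) nat_pow_consistent[of x "card H" H]
      by (simp add: Coset.order_def)
    then have 1: "ord x dvd r" using pow_eq_id xG by blast
    obtain k where "x [^] (p ^ k :: nat) = \<one>" using pow xG by blast
    then have 2: "ord x dvd p ^ k" using pow_eq_id xG by blast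
    have "coprime r (p ^ k)" using r p rp by (simp add: primes_coprime)
    then have "ord x = 1" using 1 2 by (meson coprime_common_divisor nat_dvd_1_iff_1)
    then show False using x xG ord_eq_1 by blast
  qed
  then show ?thesis ..
qed

section \<open>Copies on the naturals and criteria for residual properties\<close>

definition transport_group :: "('a \<Rightarrow> 'b) \<Rightarrow> ('a, 'c) monoid_scheme \<Rightarrow> 'b monoid" where
  "transport_group f G = \<lparr>carrier = f ` carrier G,
     monoid.mult = (\<lambda>x y. f (inv_into (carrier G) f x \<otimes>\<^bsub>G\<^esub> inv_into (carrier G) f y)), one = f \<one>\<^bsub>G\<^esub>\<rparr>"

lemma (in group)
  assumes "inj_on f (carrier G)"
  shows transport_group_iso: "f \<in> iso G (transport_group f G)"
    and group_transport_group: "group (transport_group f G)"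
proof -
  show iso: "f \<in> iso G (transport_group f G)"
    using assms by (auto simp: iso_def hom_def transport_group_def bij_betw_def)
  have "f \<in> hom G (transport_group f G)" using iso by (simp add: iso_def)
  then have "group (transport_group f G\<lparr>carrier := f ` carrier G, one := f \<one>\<rparr>)"
    by (rule hom_imp_img_group)
  then show "group (transport_group f G)" by (simp add: transport_group_def)
qed

lemma residually_mono:
  assumes "residually C G"
    and "\<And>H. group H \<Longrightarrow> finite (carrier H) \<Longrightarrow> C H \<Longrightarrow> D H"
  shows "residually D G"
  using assms unfolding residually_def by meson

text \<open>\<open>C\<close> speaks of groups on the naturals while \<open>G Mod N\<close> consists
  of cosets, so the hypothesis asks for \<open>C\<close> on every isomorphic copy of the
  quotient.\<close>

lemma residuallyI:
  assumes G: "group G"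
    and sep: "\<And>x. x \<in> carrier G \<Longrightarrow> x \<noteq> \<one>\<^bsub>G\<^esub> \<Longrightarrow> \<exists>N \<in> finite_index_normals G. x \<notin> N \<and>
           (\<forall>H. group H \<longrightarrow> G Mod N \<cong> H \<longrightarrow> C H)"
  shows "residually C G"
  unfolding residually_def
proof (intro ballI impI)
  interpret group G by (rule G)
  fix x y assume xy: "x \<in> carrier G" "y \<in> carrier G" "x \<noteq> y"
  then have "x \<otimes>\<^bsub>G\<^esub> inv\<^bsub>G\<^esub> y \<noteq> \<one>\<^bsub>G\<^esub>" using inv_equality by fastforce
  then obtain N where N: "N \<in> finite_index_normals G" "x \<otimes>\<^bsub>G\<^esub> inv\<^bsub>G\<^esub> y \<notin> N"
    "\<And>H. group H \<Longrightarrow> G Mod N \<cong> H \<Longrightarrow> C H" using sep xy by blast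
  interpret N: normal N G using N by (simp add: finite_index_normals_def)
  have fin: "finite (carrier (G Mod N))" using N by (simp add: finite_index_normals_def FactGroup_def)
  then obtain f :: "'a set \<Rightarrow> nat" where f: "inj_on f (carrier (G Mod N))"
    using finite_imp_inj_to_nat_seg by metis
  interpret Q: group "G Mod N" by (rule N.factorgroup_is_group)
  define H where "H = transport_group f (G Mod N)"
  have fi: "f \<in> iso (G Mod N) H" and gH: "group H" unfolding H_def
    using Q.transport_group_iso[OF f] Q.group_transport_group[OF f] by auto
  have "finite (carrier H)" using fin by (simp add: H_def transport_group_def)
  moreover have "C H" using N(3) gH fi by (auto simp: is_iso_def)
  moreover have "(\<lambda>a. f (N #>\<^bsub>G\<^esub> a)) \<in> hom G H"
    using hom_compose[OF N.r_coset_hom_Mod, of f H] fi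
    by (auto simp: iso_def hom_def Pi_def compose_def)
  moreover have "f (N #>\<^bsub>G\<^esub> x) \<noteq> f (N #>\<^bsub>G\<^esub> y)"
  proof
    assume "f (N #>\<^bsub>G\<^esub> x) = f (N #>\<^bsub>G\<^esub> y)"
    then have "N #>\<^bsub>G\<^esub> x = N #>\<^bsub>G\<^esub> y" using f xy by (auto simp: inj_on_def carrier_FactGroup)
    then have "x \<in> N #>\<^bsub>G\<^esub> y" using rcos_self[OF _ N.subgroup_axioms] xy by metis
    then show False using N(2) N.rcos_module_imp[OF G] xy by blast
  qed
  ultimately show "\<exists>H h. group H \<and> finite (carrier H) \<and> C H \<and> h \<in> hom G H \<and> h x \<noteq> h y"
    using gH by blast
qed

text \<open>Being a p-group is turned into a condition on single elements, which can later be
  checked by iterating one affine map.\<close>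

lemma residually_pI:
  assumes p: "Factorial_Ring.prime p" and G: "group G"
    and sep: "\<And>x. x \<in> carrier G \<Longrightarrow> x \<noteq> \<one>\<^bsub>G\<^esub> \<Longrightarrow> \<exists>N \<in> finite_index_normals G. x \<notin> N \<and>
           (\<forall>y \<in> carrier G. \<exists>k. y [^]\<^bsub>G\<^esub> (p ^ k :: nat) \<in> N)"
  shows "residually_p p G"
  unfolding residually_p_def
proof (rule residuallyI[OF G])
  fix x assume x: "x \<in> carrier G" "x \<noteq> \<one>\<^bsub>G\<^esub>"
  obtain N where N: "N \<in> finite_index_normals G" "x \<notin> N"
    and pow: "\<And>y. y \<in> carrier G \<Longrightarrow> \<exists>k. y [^]\<^bsub>G\<^esub> (p ^ k :: nat) \<in> N" using sep[OF x] by blast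
  interpret group G by (rule G)
  interpret N: normal N G using N by (simp add: finite_index_normals_def)
  interpret Q: group "G Mod N" by (rule N.factorgroup_is_group)
  have "\<exists>n. Coset.order (G Mod N) = p ^ n"
  proof (rule Q.order_prime_power_if_pow_prime_power[OF p])
    show "finite (carrier (G Mod N))" using N by (simp add: finite_index_normals_def FactGroup_def)
    fix C assume "C \<in> carrier (G Mod N)"
    then obtain y where y: "y \<in> carrier G" "C = N #>\<^bsub>G\<^esub> y" by (auto simp: carrier_FactGroup)
    obtain k where k: "y [^]\<^bsub>G\<^esub> (p ^ k :: nat) \<in> N" using pow y by blast
    have "C [^]\<^bsub>G Mod N\<^esub> (p ^ k :: nat) = N #>\<^bsub>G\<^esub> (y [^]\<^bsub>G\<^esub> (p ^ k :: nat))"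
      using y N.FactGroup_pow by simp
    also have "\<dots> = N" using k N.rcos_const[OF G] by blast
    finally show "\<exists>k. C [^]\<^bsub>G Mod N\<^esub> (p ^ k :: nat) = \<one>\<^bsub>G Mod N\<^esub>" by auto
  qed
  then have "\<forall>H. group H \<longrightarrow> G Mod N \<cong> H \<longrightarrow> (\<exists>n. Coset.order H = p ^ n)"
    by (metis ex_in_conv is_iso_def iso_same_order)
  then show "\<exists>N \<in> finite_index_normals G. x \<notin> N \<and> (\<forall>H. group H \<longrightarrow> G Mod N \<cong> H \<longrightarrow> (\<exists>n. Coset.order H = p ^ n))"
    using N by blast
qed

section \<open>Dense subgroups with the same profinite completion\<close>

lemma kernel_finite_index:
  assumes "group_hom G H h" and "finite (h ` carrier G)"
  shows "kernel G H h \<in> finite_index_normals G"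
proof -
  interpret group_hom G H h by fact
  have "the_elem (h ` X) \<in> h ` carrier G" if X: "X \<in> carrier (G Mod kernel G H h)" for X
  proof -
    obtain g where g: "g \<in> carrier G" "X = kernel G H h #>\<^bsub>G\<^esub> g"
      using X unfolding carrier_FactGroup by blast
    have "h ` X = {h g}"
      using g by (force simp: r_coset_def kernel_def image_iff)
    then show ?thesis using g by simp
  qed
  then have "finite ((\<lambda>X. the_elem (h ` X)) ` carrier (G Mod kernel G H h))"
    using assms(2) by (meson finite_subset image_subsetI)
  then have "finite (carrier (G Mod kernel G H h))"
    using FactGroup_inj_on finite_imageD by blast
  then show ?thesis by (simp add: finite_index_normals_def normal_kernel FactGroup_def)
qed

lemma vimage_finite_index:
  assumes G: "group G" and B: "group B" and j: "j \<in> hom G B" and N: "N \<in> finite_index_normals B"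
  shows "{x \<in> carrier G. j x \<in> N} \<in> finite_index_normals G"
proof -
  interpret group G by fact
  interpret B: group B by fact
  interpret j: group_hom G B j using G B j by (simp add: group_hom_def group_hom_axioms_def)
  interpret N: normal N B using N by (simp add: finite_index_normals_def)
  interpret Q: group "B Mod N" by (rule N.factorgroup_is_group)
  have hom: "(\<lambda>x. N #>\<^bsub>B\<^esub> j x) \<in> hom G (B Mod N)"
    using hom_compose[OF j N.r_coset_hom_Mod] by (auto simp: hom_def Pi_def compose_def)
  have "kernel G (B Mod N) (\<lambda>x. N #>\<^bsub>B\<^esub> j x) \<in> finite_index_normals G"
  proof (rule kernel_finite_index)
    show "group_hom G (B Mod N) (\<lambda>x. N #>\<^bsub>B\<^esub> j x)"
      using hom by (simp add: group_hom_def group_hom_axioms_def G Q.is_group)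
    have "(\<lambda>x. N #>\<^bsub>B\<^esub> j x) ` carrier G \<subseteq> carrier (B Mod N)" using hom by (auto simp: hom_def)
    moreover have "finite (carrier (B Mod N))" using N by (simp add: finite_index_normals_def FactGroup_def)
    ultimately show "finite ((\<lambda>x. N #>\<^bsub>B\<^esub> j x) ` carrier G)" by (rule finite_subset)
  qed
  moreover have "kernel G (B Mod N) (\<lambda>x. N #>\<^bsub>B\<^esub> j x) = {x \<in> carrier G. j x \<in> N}"
    using B.coset_join1[OF _ _ N.subgroup_axioms] B.coset_join2[OF _ N.subgroup_axioms] j.hom_closed
    by (auto simp: kernel_def)
  ultimately show ?thesis by simp
qed

lemma carrier_profinite_completion:
  "carrier (profinite_completion G) = {f \<in> (\<Pi>\<^sub>E N \<in> finite_index_normals G. carrier (G Mod N)).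
     \<forall>N \<in> finite_index_normals G. \<forall>M \<in> finite_index_normals G. N \<subseteq> M \<longrightarrow> f M = M <#>\<^bsub>G\<^esub> f N}"
  by (simp add: profinite_completion_def)

lemma
  assumes "f \<in> carrier (profinite_completion G)"
  shows profinite_completion_component: "N \<in> finite_index_normals G \<Longrightarrow> f N \<in> carrier (G Mod N)"
    and profinite_completion_compatible:
      "N \<in> finite_index_normals G \<Longrightarrow> M \<in> finite_index_normals G \<Longrightarrow> N \<subseteq> M \<Longrightarrow> f M = M <#>\<^bsub>G\<^esub> f N"
    and profinite_completion_extensional: "f \<in> extensional (finite_index_normals G)"
  using assms unfolding carrier_profinite_completion PiE_def by blast+

lemma profinite_completion_mult:
  assumes "N \<in> finite_index_normals G"
  shows "(f \<otimes>\<^bsub>profinite_completion G\<^esub> g) N = f N <#>\<^bsub>G\<^esub> g N"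
  using assms by (simp add: profinite_completion_def product_group_def)

lemma topspace_profinite_topology: "topspace (profinite_topology G) = carrier (profinite_completion G)"
  unfolding profinite_topology_def carrier_profinite_completion topspace_subtopology
    topspace_product_topology comp_def topspace_discrete_topology by blast

text \<open>The composite of the map from G / j^-1(N) to B / N with the inverse of the map from K /
  k^-1(N) to B / N; the latter is bijective once \<open>K\<close> is dense. Written without
  representatives, it makes sense before density is known.\<close>

definition coset_transfer ::
  "'b monoid \<Rightarrow> 'c monoid \<Rightarrow> ('a \<Rightarrow> 'c) \<Rightarrow> ('b \<Rightarrow> 'c) \<Rightarrow> 'c set \<Rightarrow> 'a set \<Rightarrow> 'b set" where
  "coset_transfer K B j k N C = {y \<in> carrier K. \<exists>x \<in> C. N #>\<^bsub>B\<^esub> k y = N #>\<^bsub>B\<^esub> j x}"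

text \<open>The choice of \<open>N\<close> is harmless: members of \<open>F\<close> are determined
  by their preimages in \<open>K\<close>, see \<open>pullK_subset_iff\<close>.\<close>

definition completion_transfer ::
  "'a monoid \<Rightarrow> 'b monoid \<Rightarrow> 'c monoid \<Rightarrow> ('a \<Rightarrow> 'c) \<Rightarrow> ('b \<Rightarrow> 'c) \<Rightarrow> 'c set set \<Rightarrow>
    ('a set \<Rightarrow> 'a set) \<Rightarrow> 'b set \<Rightarrow> 'b set" where
  "completion_transfer G K B j k F f = (\<lambda>M \<in> finite_index_normals K.
     let N = (SOME N. N \<in> F \<and> {y \<in> carrier K. k y \<in> N} = M)
     in coset_transfer K B j k N (f {x \<in> carrier G. j x \<in> N}))"

text \<open>Both completions are the inverse limit of the groups B / N over \<open>F\<close>: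
  density identifies B / N with a quotient of \<open>G\<close> and with one of \<open>K\<close>, and
  the onto conditions say that no finite quotient is missed. In the application \<open>F\<close> is
  a proper part of \<open>finite_index_normals B\<close>, because density fails for the other
  subgroups.\<close>

locale dense_homs =
  fixes G :: "'a monoid" and K :: "'b monoid" and B :: "'c monoid"
    and j :: "'a \<Rightarrow> 'c" and k :: "'b \<Rightarrow> 'c" and F :: "'c set set"
  assumes G: "group G" and K: "group K" and B: "group B"
    and j: "j \<in> hom G B" and k: "k \<in> hom K B"
    and F_normal: "F \<subseteq> finite_index_normals B"
    and F_Int: "\<And>N N'. N \<in> F \<Longrightarrow> N' \<in> F \<Longrightarrow> N \<inter> N' \<in> F"
    and G_dense: "\<And>N b. N \<in> F \<Longrightarrow> b \<in> carrier B \<Longrightarrow> \<exists>x \<in> carrier G. N #>\<^bsub>B\<^esub> j x = N #>\<^bsub>B\<^esub> b"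
    and K_dense: "\<And>N b. N \<in> F \<Longrightarrow> b \<in> carrier B \<Longrightarrow> \<exists>x \<in> carrier K. N #>\<^bsub>B\<^esub> k x = N #>\<^bsub>B\<^esub> b"
    and G_onto: "\<And>M. M \<in> finite_index_normals G \<Longrightarrow> \<exists>N \<in> F. {x \<in> carrier G. j x \<in> N} = M"
    and K_onto: "\<And>M. M \<in> finite_index_normals K \<Longrightarrow> \<exists>N \<in> F. {x \<in> carrier K. k x \<in> N} = M"
begin

definition pullG where "pullG N = {x \<in> carrier G. j x \<in> N}"
definition pullK where "pullK N = {x \<in> carrier K. k x \<in> N}"

lemma F_D: "N \<in> F \<Longrightarrow> N \<lhd> B" using F_normal by (auto simp: finite_index_normals_def)
lemma jB: "x \<in> carrier G \<Longrightarrow> j x \<in> carrier B" using j by (auto simp: hom_def)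
lemma kB: "x \<in> carrier K \<Longrightarrow> k x \<in> carrier B" using k by (auto simp: hom_def)

lemma pullG_fin: "N \<in> F \<Longrightarrow> pullG N \<in> finite_index_normals G"
  unfolding pullG_def using vimage_finite_index[OF G B j] F_normal by blast
lemma pullK_fin: "N \<in> F \<Longrightarrow> pullK N \<in> finite_index_normals K"
  unfolding pullK_def using vimage_finite_index[OF K B k] F_normal by blast

lemma coset_eq_iff:
  assumes "N \<in> F" "a \<in> carrier B" "b \<in> carrier B"
  shows "N #>\<^bsub>B\<^esub> a = N #>\<^bsub>B\<^esub> b \<longleftrightarrow> a \<otimes>\<^bsub>B\<^esub> inv\<^bsub>B\<^esub> b \<in> N"
proof -
  interpret B: group B by (rule B)
  interpret N: normal N B using F_D assms by blast
  show ?thesis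
    using assms N.rcos_module[OF B] B.rcos_self[OF _ N.subgroup_axioms] B.repr_independence[OF _ _ N.subgroup_axioms]
    by metis
qed

text \<open>Density modulo the member \<open>N \<inter> N'\<close> of \<open>F\<close> replaces an
  element of \<open>N\<close> by one coming from \<open>K\<close> that has the same memberships in
  \<open>N\<close> and \<open>N'\<close>. Hence \<open>F\<close> is ordered as its preimages
  are.\<close>

lemma pullK_subset_iff:
  assumes N: "N \<in> F" "N' \<in> F" and sub: "pullK N \<subseteq> pullK N'"
  shows "N \<subseteq> N'"
proof
  interpret B: group B by (rule B)
  interpret N: normal N B using F_D N by blast
  interpret N': normal N' B using F_D N by blast
  fix b assume b: "b \<in> N"
  obtain x where x: "x \<in> carrier K" "(N \<inter> N') #>\<^bsub>B\<^esub> k x = (N \<inter> N') #>\<^bsub>B\<^esub> b"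
    using K_dense[OF F_Int[OF N] N.mem_carrier[OF b]] by auto
  then have *: "k x \<otimes>\<^bsub>B\<^esub> inv\<^bsub>B\<^esub> b \<in> N \<inter> N'"
    using coset_eq_iff[OF F_Int[OF N] kB[OF x(1)] N.mem_carrier[OF b]] by simp
  then have "k x \<otimes>\<^bsub>B\<^esub> inv\<^bsub>B\<^esub> b \<otimes>\<^bsub>B\<^esub> b \<in> N" using b by blast
  then have "k x \<in> N" using b x kB by (simp add: B.m_assoc)
  then have "k x \<in> N'" using sub x by (auto simp: pullK_def)
  then have "inv\<^bsub>B\<^esub> (k x) \<otimes>\<^bsub>B\<^esub> (k x \<otimes>\<^bsub>B\<^esub> inv\<^bsub>B\<^esub> b) \<in> N'" using * by blast
  then have "inv\<^bsub>B\<^esub> b \<in> N'" using b x kB by (simp add: B.m_assoc[symmetric])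
  then have "inv\<^bsub>B\<^esub> (inv\<^bsub>B\<^esub> b) \<in> N'" by blast
  then show "b \<in> N'" using b by simp
qed

text \<open>Cosets of a preimage are exactly the fibres over cosets of \<open>N\<close>, on both
  sides.\<close>

lemma transfer_coset:
  assumes N: "N \<in> F" and x: "x \<in> carrier G" and y: "y \<in> carrier K"
    and eq: "N #>\<^bsub>B\<^esub> k y = N #>\<^bsub>B\<^esub> j x"
  shows "coset_transfer K B j k N (pullG N #>\<^bsub>G\<^esub> x) = pullK N #>\<^bsub>K\<^esub> y"
proof -
  interpret B: group B by (rule B)
  interpret G: group G by (rule G)
  interpret K: group K by (rule K)
  interpret N: normal N B using F_D N by blast
  interpret j: group_hom G B j using G B j by (simp add: group_hom_def group_hom_axioms_def)
  interpret k: group_hom K B k using K B k by (simp add: group_hom_def group_hom_axioms_def)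
  interpret PG: normal "pullG N" G using pullG_fin[OF N] by (simp add: finite_index_normals_def)
  interpret PK: normal "pullK N" K using pullK_fin[OF N] by (simp add: finite_index_normals_def)
  have 1: "z \<in> pullG N #>\<^bsub>G\<^esub> x \<longleftrightarrow> z \<in> carrier G \<and> N #>\<^bsub>B\<^esub> j z = N #>\<^bsub>B\<^esub> j x" for z
  proof -
    have "z \<in> pullG N #>\<^bsub>G\<^esub> x \<longleftrightarrow> z \<in> carrier G \<and> z \<otimes>\<^bsub>G\<^esub> inv\<^bsub>G\<^esub> x \<in> pullG N"
      using PG.rcos_module[OF G x, of z] PG.elemrcos_carrier[OF G x, of z] by auto
    moreover have "z \<otimes>\<^bsub>G\<^esub> inv\<^bsub>G\<^esub> x \<in> pullG N \<longleftrightarrow> N #>\<^bsub>B\<^esub> j z = N #>\<^bsub>B\<^esub> j x" if z: "z \<in> carrier G"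
      unfolding coset_eq_iff[OF N jB[OF z] jB[OF x]] pullG_def using z x by simp
    ultimately show ?thesis by blast
  qed
  have 2: "z \<in> pullK N #>\<^bsub>K\<^esub> y \<longleftrightarrow> z \<in> carrier K \<and> N #>\<^bsub>B\<^esub> k z = N #>\<^bsub>B\<^esub> k y" for z
  proof -
    have "z \<in> pullK N #>\<^bsub>K\<^esub> y \<longleftrightarrow> z \<in> carrier K \<and> z \<otimes>\<^bsub>K\<^esub> inv\<^bsub>K\<^esub> y \<in> pullK N"
      using PK.rcos_module[OF K y, of z] PK.elemrcos_carrier[OF K y, of z] by auto
    moreover have "z \<otimes>\<^bsub>K\<^esub> inv\<^bsub>K\<^esub> y \<in> pullK N \<longleftrightarrow> N #>\<^bsub>B\<^esub> k z = N #>\<^bsub>B\<^esub> k y" if z: "z \<in> carrier K"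
      unfolding coset_eq_iff[OF N kB[OF z] kB[OF y]] pullK_def using z y by simp
    ultimately show ?thesis by blast
  qed
  show ?thesis
    using 1 2 x eq unfolding coset_transfer_def by auto
qed

definition model where "model M = (SOME N. N \<in> F \<and> {y \<in> carrier K. k y \<in> N} = M)"

lemma model: "M \<in> finite_index_normals K \<Longrightarrow> model M \<in> F \<and> pullK (model M) = M"
  unfolding model_def pullK_def by (rule someI_ex) (use K_onto in blast)

lemma model_mono:
  "M \<in> finite_index_normals K \<Longrightarrow> M' \<in> finite_index_normals K \<Longrightarrow> M \<subseteq> M' \<Longrightarrow> model M \<subseteq> model M'"
  using model pullK_subset_iff by metis

abbreviation T where "T \<equiv> completion_transfer G K B j k F"

lemma T_eq:
  "M \<in> finite_index_normals K \<Longrightarrow> T f M = coset_transfer K B j k (model M) (f (pullG (model M)))"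
  by (simp add: completion_transfer_def model_def pullG_def Let_def)

lemma T_rep:
  assumes f: "f \<in> carrier (profinite_completion G)" and M: "M \<in> finite_index_normals K"
  obtains x y where "x \<in> carrier G" "y \<in> carrier K" "f (pullG (model M)) = pullG (model M) #>\<^bsub>G\<^esub> x"
    "model M #>\<^bsub>B\<^esub> k y = model M #>\<^bsub>B\<^esub> j x" "T f M = M #>\<^bsub>K\<^esub> y"
proof -
  have N: "model M \<in> F" "pullK (model M) = M" using model[OF M] by auto
  have "f (pullG (model M)) \<in> carrier (G Mod pullG (model M))"
    using profinite_completion_component[OF f] pullG_fin[OF N(1)] by blast
  then obtain x where x: "x \<in> carrier G" "f (pullG (model M)) = pullG (model M) #>\<^bsub>G\<^esub> x"
    by (auto simp: carrier_FactGroup)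
  obtain y where y: "y \<in> carrier K" "model M #>\<^bsub>B\<^esub> k y = model M #>\<^bsub>B\<^esub> j x"
    using K_dense[OF N(1) jB[OF x(1)]] by blast
  show thesis using that[OF x(1) y(1) x(2) y(2)] transfer_coset[OF N(1) x(1) y] x(2) N(2) T_eq[OF M]
    by simp
qed

lemma T_unique:
  assumes f: "f \<in> carrier (profinite_completion G)" and M: "M \<in> finite_index_normals K"
    and "x \<in> carrier G" "y \<in> carrier K" "f (pullG (model M)) = pullG (model M) #>\<^bsub>G\<^esub> x"
    "model M #>\<^bsub>B\<^esub> k y = model M #>\<^bsub>B\<^esub> j x"
  shows "T f M = M #>\<^bsub>K\<^esub> y"
  using assms transfer_coset model[OF M] T_eq[OF M] by simp

lemma r_coset_set_mult:
  assumes "N \<lhd> H" "M \<lhd> H" "N \<subseteq> M" "x \<in> carrier H"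
  shows "M <#>\<^bsub>H\<^esub> (N #>\<^bsub>H\<^esub> x) = M #>\<^bsub>H\<^esub> x"
proof -
  interpret H: group H using assms(1) by (rule normal.axioms(2))
  interpret N: normal N H by fact
  interpret M: normal M H by fact
  have "M <#>\<^bsub>H\<^esub> (N #>\<^bsub>H\<^esub> x) = (M <#>\<^bsub>H\<^esub> N) #>\<^bsub>H\<^esub> x"
    using assms H.setmult_rcos_assoc[of M N x] N.subset M.subset by simp
  also have "M <#>\<^bsub>H\<^esub> N = M"
  proof
    show "M <#>\<^bsub>H\<^esub> N \<subseteq> M" using assms(3) by (auto simp: set_mult_def)
    show "M \<subseteq> M <#>\<^bsub>H\<^esub> N"
    proof
      fix m assume m: "m \<in> M"
      then have "m = m \<otimes>\<^bsub>H\<^esub> \<one>\<^bsub>H\<^esub>" by simp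
      then show "m \<in> M <#>\<^bsub>H\<^esub> N" using m N.one_closed unfolding set_mult_def by blast
    qed
  qed
  finally show ?thesis .
qed

text \<open>Since \<open>model\<close> is monotone, elements x and y that represent a component at
  \<open>M\<close> represent it at every larger index as well, which gives compatibility.\<close>

lemma T_closed:
  assumes f: "f \<in> carrier (profinite_completion G)"
  shows "T f \<in> carrier (profinite_completion K)"
proof -
  have "T f \<in> (\<Pi>\<^sub>E N \<in> finite_index_normals K. carrier (K Mod N))"
  proof (rule PiE_I)
    fix M assume M: "M \<in> finite_index_normals K"
    obtain y where "y \<in> carrier K" "T f M = M #>\<^bsub>K\<^esub> y" using T_rep[OF f M] by metis
    then show "T f M \<in> carrier (K Mod M)" by (auto simp: carrier_FactGroup)
  qed (simp add: completion_transfer_def)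
  moreover have "T f M' = M' <#>\<^bsub>K\<^esub> T f M"
    if M: "M \<in> finite_index_normals K" and M': "M' \<in> finite_index_normals K" and sub: "M \<subseteq> M'" for M M'
  proof -
    have N: "model M \<in> F" "model M' \<in> F" "model M \<subseteq> model M'"
      using model model_mono M M' sub by auto
    have MK: "M \<lhd> K" "M' \<lhd> K" using M M' by (auto simp: finite_index_normals_def)
    obtain x y where xy: "x \<in> carrier G" "y \<in> carrier K" "f (pullG (model M)) = pullG (model M) #>\<^bsub>G\<^esub> x"
      "model M #>\<^bsub>B\<^esub> k y = model M #>\<^bsub>B\<^esub> j x" "T f M = M #>\<^bsub>K\<^esub> y" using T_rep[OF f M] by metis
    have pG: "pullG (model M) \<in> finite_index_normals G" "pullG (model M') \<in> finite_index_normals G"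
      using pullG_fin N by auto
    have "pullG (model M) \<subseteq> pullG (model M')" using N(3) by (auto simp: pullG_def)
    then have "f (pullG (model M')) = pullG (model M') <#>\<^bsub>G\<^esub> f (pullG (model M))"
      using profinite_completion_compatible[OF f pG] by blast
    also have "\<dots> = pullG (model M') #>\<^bsub>G\<^esub> x"
      unfolding xy(3) using pG \<open>pullG (model M) \<subseteq> pullG (model M')\<close> xy(1)
      by (intro r_coset_set_mult) (auto simp: finite_index_normals_def)
    finally have 1: "f (pullG (model M')) = pullG (model M') #>\<^bsub>G\<^esub> x" .
    have "model M' #>\<^bsub>B\<^esub> k y = model M' #>\<^bsub>B\<^esub> j x"
      using xy(4) N(3) unfolding coset_eq_iff[OF N(1) kB[OF xy(2)] jB[OF xy(1)]]
        coset_eq_iff[OF N(2) kB[OF xy(2)] jB[OF xy(1)]] by blast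
    then have "T f M' = M' #>\<^bsub>K\<^esub> y" using T_unique[OF f M' xy(1,2) 1] by blast
    also have "\<dots> = M' <#>\<^bsub>K\<^esub> T f M"
      unfolding xy(5) using r_coset_set_mult[OF MK sub xy(2)] by simp
    finally show ?thesis .
  qed
  ultimately show ?thesis unfolding carrier_profinite_completion by blast
qed

lemma T_hom: "T \<in> hom (profinite_completion G) (profinite_completion K)"
proof (rule homI)
  fix f g assume f: "f \<in> carrier (profinite_completion G)" and g: "g \<in> carrier (profinite_completion G)"
  interpret G: group G by (rule G)
  interpret K: group K by (rule K)
  interpret j: group_hom G B j using G B j by (simp add: group_hom_def group_hom_axioms_def)
  interpret k: group_hom K B k using K B k by (simp add: group_hom_def group_hom_axioms_def)
  show "T (f \<otimes>\<^bsub>profinite_completion G\<^esub> g) = T f \<otimes>\<^bsub>profinite_completion K\<^esub> T g"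
  proof
    fix M
    show "T (f \<otimes>\<^bsub>profinite_completion G\<^esub> g) M = (T f \<otimes>\<^bsub>profinite_completion K\<^esub> T g) M"
    proof (cases "M \<in> finite_index_normals K")
      case False
      then show ?thesis by (simp add: completion_transfer_def profinite_completion_def product_group_def)
    next
      case M: True
      have N: "model M \<in> F" "pullK (model M) = M" using model[OF M] by auto
      interpret N: normal "model M" B using F_D N by blast
      interpret PG: normal "pullG (model M)" G using pullG_fin[OF N(1)] by (simp add: finite_index_normals_def)
      interpret M: normal M K using M by (simp add: finite_index_normals_def)
      obtain x y where xy: "x \<in> carrier G" "y \<in> carrier K" "f (pullG (model M)) = pullG (model M) #>\<^bsub>G\<^esub> x"
        "model M #>\<^bsub>B\<^esub> k y = model M #>\<^bsub>B\<^esub> j x" "T f M = M #>\<^bsub>K\<^esub> y" using T_rep[OF f M] by metis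
      obtain u v where uv: "u \<in> carrier G" "v \<in> carrier K" "g (pullG (model M)) = pullG (model M) #>\<^bsub>G\<^esub> u"
        "model M #>\<^bsub>B\<^esub> k v = model M #>\<^bsub>B\<^esub> j u" "T g M = M #>\<^bsub>K\<^esub> v" using T_rep[OF g M] by metis
      let ?fg = "f \<otimes>\<^bsub>profinite_completion G\<^esub> g"
      have "?fg (pullG (model M)) = pullG (model M) #>\<^bsub>G\<^esub> (x \<otimes>\<^bsub>G\<^esub> u)"
        using xy uv by (simp add: profinite_completion_mult[OF pullG_fin[OF N(1)]] PG.rcos_sum)
      moreover have "model M #>\<^bsub>B\<^esub> k (y \<otimes>\<^bsub>K\<^esub> v) = model M #>\<^bsub>B\<^esub> j (x \<otimes>\<^bsub>G\<^esub> u)"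
        using xy uv by (simp flip: N.rcos_sum)
      ultimately have "coset_transfer K B j k (model M) (?fg (pullG (model M))) = M #>\<^bsub>K\<^esub> (y \<otimes>\<^bsub>K\<^esub> v)"
        using transfer_coset[OF N(1), of "x \<otimes>\<^bsub>G\<^esub> u" "y \<otimes>\<^bsub>K\<^esub> v"] xy uv N(2) by simp
      then show ?thesis
        using xy uv T_eq[OF M] by (simp add: profinite_completion_mult[OF M] M.rcos_sum)
    qed
  qed
qed (rule T_closed)

text \<open>Each coordinate of the image depends on a single coordinate of the argument, and that
  one ranges over a discrete space.\<close>

lemma T_continuous: "continuous_map (profinite_topology G) (profinite_topology K) T"
proof -
  have "continuous_map (profinite_topology G)
     (product_topology (\<lambda>N. discrete_topology (carrier (K Mod N))) (finite_index_normals K)) T"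
    unfolding continuous_map_componentwise
  proof (intro conjI ballI)
    show "T ` topspace (profinite_topology G) \<subseteq> extensional (finite_index_normals K)"
      by (auto simp: completion_transfer_def)
  next
    fix M assume M: "M \<in> finite_index_normals K"
    have N: "model M \<in> F" using model[OF M] by auto
    let ?P = "pullG (model M)"
    let ?c = "coset_transfer K B j k (model M)"
    have P: "?P \<in> finite_index_normals G" using pullG_fin[OF N] .
    have 1: "continuous_map (profinite_topology G) (discrete_topology (carrier (G Mod ?P))) (\<lambda>f. f ?P)"
      unfolding profinite_topology_def using P
      by (intro continuous_map_from_subtopology continuous_map_product_projection)
    have "?c \<in> carrier (G Mod ?P) \<rightarrow> carrier (K Mod M)"
    proof
      fix C assume "C \<in> carrier (G Mod ?P)"
      then obtain x where x: "x \<in> carrier G" "C = ?P #>\<^bsub>G\<^esub> x" by (auto simp: carrier_FactGroup)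
      obtain y where "y \<in> carrier K" "model M #>\<^bsub>B\<^esub> k y = model M #>\<^bsub>B\<^esub> j x"
        using K_dense[OF N jB[OF x(1)]] by blast
      then show "?c C \<in> carrier (K Mod M)"
        using transfer_coset[OF N x(1)] x(2) model[OF M] by (auto simp: carrier_FactGroup)
    qed
    then have 2: "continuous_map (discrete_topology (carrier (G Mod ?P))) (discrete_topology (carrier (K Mod M))) ?c"
      by (auto simp: continuous_map_def)
    show "continuous_map (profinite_topology G) (discrete_topology (carrier (K Mod M))) (\<lambda>f. T f M)"
      using continuous_map_compose[OF 1 2] by (simp add: comp_def T_eq[OF M])
  qed
  then show ?thesis
    unfolding profinite_topology_def[of K]
    by (simp add: continuous_map_in_subtopology topspace_profinite_topology T_closed image_subset_iff Pi_iff)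
qed

lemma dense_homs_sym: "dense_homs K G B k j F"
  by (rule dense_homs.intro) (fact G K B j k F_normal F_Int G_dense K_dense G_onto K_onto)+

text \<open>Either preimage determines the member of \<open>F\<close>, so the transfers in the two
  directions go through the same quotient of \<open>B\<close> and undo each other on
  representatives.\<close>

lemma T_inverse:
  assumes f: "f \<in> carrier (profinite_completion G)"
  shows "completion_transfer K G B k j F (T f) = f"
proof
  interpret S: dense_homs K G B k j F by (rule dense_homs_sym)
  have S_pull: "S.pullG = pullK" "S.pullK = pullG"
    by (simp_all add: fun_eq_iff S.pullG_def S.pullK_def pullG_def pullK_def)
  fix P
  show "S.T (T f) P = f P"
  proof (cases "P \<in> finite_index_normals G")
    case False
    then have "S.T g P = undefined" for g by (simp add: completion_transfer_def)
    moreover have "f P = undefined"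
      using profinite_completion_extensional[OF f] False by (rule extensional_arb)
    ultimately show ?thesis by simp
  next
    case P: True
    have N: "S.model P \<in> F" "pullG (S.model P) = P" using S.model[OF P] S_pull by auto
    define M where "M = pullK (S.model P)"
    have M: "M \<in> finite_index_normals K" unfolding M_def using pullK_fin N by blast
    have "pullK (model M) = pullK (S.model P)" using model[OF M] by (simp add: M_def)
    then have mod: "model M = S.model P"
      using pullK_subset_iff N(1) model[OF M] by (metis order_refl subset_antisym)
    obtain x y where xy: "x \<in> carrier G" "y \<in> carrier K" "f (pullG (model M)) = pullG (model M) #>\<^bsub>G\<^esub> x"
      "model M #>\<^bsub>B\<^esub> k y = model M #>\<^bsub>B\<^esub> j x" "T f M = M #>\<^bsub>K\<^esub> y" using T_rep[OF f M] by metis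
    have "S.T (T f) P = P #>\<^bsub>G\<^esub> x"
      by (rule S.T_unique[OF T_closed[OF f] P xy(2,1)])
        (use xy mod S_pull M_def in auto)
    also have "\<dots> = f P" using xy(3) mod N(2) by simp
    finally show ?thesis .
  qed
qed

theorem same_profinite_completion: "same_profinite_completion G K"
proof -
  interpret S: dense_homs K G B k j F by (rule dense_homs_sym)
  have inv: "S.T (T f) = f" if "f \<in> carrier (profinite_completion G)" for f using T_inverse that .
  have inv': "T (S.T f) = f" if "f \<in> carrier (profinite_completion K)" for f using S.T_inverse that .
  have "bij_betw T (carrier (profinite_completion G)) (carrier (profinite_completion K))"
    by (rule bij_betwI[where g = S.T]) (auto simp: inv inv' T_closed S.T_closed)
  then have "T \<in> iso (profinite_completion G) (profinite_completion K)"
    using T_hom by (simp add: iso_def)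
  moreover have "homeomorphic_maps (profinite_topology G) (profinite_topology K) T S.T"
    unfolding homeomorphic_maps_def topspace_profinite_topology
    using T_continuous S.T_continuous inv inv' by blast
  ultimately show ?thesis
    unfolding same_profinite_completion_def homeomorphic_map_maps by blast
qed

end

section \<open>Semidirect products of an abelian group and a group of automorphisms\<close>

text \<open>A colouring with finitely many colours whose colour classes lie inside cosets bounds the
  number of cosets; the colours carry no group structure.\<close>

lemma finite_index_normalsI:
  fixes G :: "'a monoid" (structure)
  assumes "group G" and N: "N \<lhd> G" and fin: "finite (t ` carrier G)"
    and t: "\<And>x y. x \<in> carrier G \<Longrightarrow> y \<in> carrier G \<Longrightarrow> t x = t y \<Longrightarrow> x \<otimes> inv y \<in> N"
  shows "N \<in> finite_index_normals G"
proof -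
  interpret group G by fact
  interpret N: normal N G by (rule N)
  let ?s = "\<lambda>z. SOME x. x \<in> carrier G \<and> t x = z"
  have "N #> x = N #> ?s (t x)" if x: "x \<in> carrier G" for x
  proof -
    have s: "?s (t x) \<in> carrier G \<and> t (?s (t x)) = t x" by (rule someI) (use x in auto)
    then have "x \<otimes> inv (?s (t x)) \<in> N" using t x by metis
    then have "x \<in> N #> ?s (t x)" using N.rcos_module_rev[OF is_group] s x by blast
    then show ?thesis using repr_independence[OF _ _ N.subgroup_axioms] s by simp
  qed
  then have "rcosets N \<subseteq> (\<lambda>z. N #> ?s z) ` t ` carrier G" by (auto simp: RCOSETS_def)
  then have "finite (rcosets N)" by (rule finite_subset) (use fin in simp)
  then show ?thesis using N by (simp add: finite_index_normals_def)
qed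

lemma residually_inj_hom:
  assumes "residually C G" "h \<in> hom K G" "inj_on h (carrier K)"
  shows "residually C K"
  unfolding residually_def
proof (intro ballI impI)
  fix x y assume xy: "x \<in> carrier K" "y \<in> carrier K" "x \<noteq> y"
  then have "h x \<in> carrier G" "h y \<in> carrier G" "h x \<noteq> h y"
    using assms by (auto simp: hom_def inj_on_def)
  then obtain H f where H: "group H" "finite (carrier H)" "C H" "f \<in> hom G H" "f (h x) \<noteq> f (h y)"
    using assms(1) unfolding residually_def by meson
  then have "f \<circ> h \<in> hom K H" "(f \<circ> h) x \<noteq> (f \<circ> h) y"
    using assms(2) by (auto simp: hom_def)
  then show "\<exists>H h. group H \<and> finite (carrier H) \<and> C H \<and> h \<in> hom K H \<and> h x \<noteq> h y"
    using H by blast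
qed

lemma (in group) countable_generate:
  assumes "countable S" shows "countable (generate G S)"
proof -
  \<comment> \<open>Layer n contains the products of up to 2^n generators and inverses of
    generators.\<close>
  define T where "T = rec_nat ({\<one>} \<union> S \<union> m_inv G ` S) (\<lambda>_ X. X \<union> (\<lambda>(x, y). x \<otimes> y) ` (X \<times> X))"
  have T0: "T 0 = {\<one>} \<union> S \<union> m_inv G ` S" and TS: "T (Suc n) = T n \<union> (\<lambda>(x, y). x \<otimes> y) ` (T n \<times> T n)" for n
    by (simp_all add: T_def)
  have "countable (T n)" for n by (induction n) (simp_all add: T0 TS assms)
  then have "countable (\<Union>n. T n)" by simp
  moreover have mono: "T m \<subseteq> T n" if "m \<le> n" for m n
    using that by (induction rule: dec_induct) (auto simp: TS)
  have "x \<in> (\<Union>n. T n)" if "x \<in> generate G S" for x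
    using that
  proof induction
    case (eng a b)
    then obtain m n where "a \<in> T m" "b \<in> T n" by blast
    then have "a \<in> T (max m n)" "b \<in> T (max m n)" using mono[of m "max m n"] mono[of n "max m n"] by auto
    then have "a \<otimes> b \<in> T (Suc (max m n))" by (auto simp: TS)
    then show ?case by blast
  qed (auto simp: T0 intro!: exI[of _ 0])
  ultimately show ?thesis using countable_subset by (metis subsetI)
qed

lemma finitely_generated_image:
  assumes "finitely_generated G" "group G" "group K" "h \<in> hom G K" "h ` carrier G = carrier K"
  shows "finitely_generated K"
proof -
  interpret group_hom G K h using assms by (simp add: group_hom_def group_hom_axioms_def)
  obtain S where S: "finite S" "S \<subseteq> carrier G" "generate G S = carrier G"
    using assms(1) by (auto simp: finitely_generated_def)
  have "generate K (h ` S) = carrier K" using generate_img[OF S(2)] S(3) assms(5) by simp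
  then show ?thesis using S by (auto simp: finitely_generated_def intro!: exI[of _ "h ` S"])
qed

text \<open>With this, completions are compared directly for copies of the groups on the naturals,
  as \<open>profinite_property\<close> demands, instead of being transported along group
  isomorphisms.\<close>

lemma dense_homs_iso:
  assumes "dense_homs G K B j k F" and G': "group G'" and i: "i \<in> iso G' G"
  shows "dense_homs G' K B (j \<circ> i) k F"
proof -
  interpret dense_homs G K B j k F by fact
  have ihom: "i \<in> hom G' G" and ibij: "bij_betw i (carrier G') (carrier G)"
    using i by (auto simp: iso_def)
  define i' where "i' = inv_into (carrier G') i"
  have i': "i' \<in> hom G G'" "\<And>x. x \<in> carrier G' \<Longrightarrow> i' (i x) = x" "\<And>x. x \<in> carrier G \<Longrightarrow> i (i' x) = x"
    using group.iso_set_sym[OF G' i] bij_betw_inv_into_left[OF ibij] bij_betw_inv_into_right[OF ibij]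
    by (auto simp: iso_def i'_def)
  show ?thesis
  proof (rule dense_homs.intro)
    show "j \<circ> i \<in> hom G' B" using ihom j by (auto simp: hom_def Pi_iff)
  next
    fix N b assume "N \<in> F" "b \<in> carrier B"
    then obtain x where "x \<in> carrier G" "N #>\<^bsub>B\<^esub> j x = N #>\<^bsub>B\<^esub> b" using G_dense by blast
    then show "\<exists>x \<in> carrier G'. N #>\<^bsub>B\<^esub> (j \<circ> i) x = N #>\<^bsub>B\<^esub> b"
      using i' by (intro bexI[of _ "i' x"]) (auto simp: hom_def)
  next
    fix M assume M: "M \<in> finite_index_normals G'"
    have MG: "M \<subseteq> carrier G'"
      using M by (auto simp: finite_index_normals_def dest: normal_imp_subgroup subgroup.subset)
    obtain N where N: "N \<in> F" "{x \<in> carrier G. j x \<in> N} = {x \<in> carrier G. i' x \<in> M}"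
      using G_onto[OF vimage_finite_index[OF G G' i'(1) M]] by blast
    have "{x \<in> carrier G'. (j \<circ> i) x \<in> N} = {x \<in> carrier G'. i' (i x) \<in> M}"
      using N(2) ihom by (auto simp: hom_def set_eq_iff)
    also have "\<dots> = M" using i'(2) MG by auto
    finally show "\<exists>N \<in> F. {x \<in> carrier G'. (j \<circ> i) x \<in> N} = M" using N(1) by blast
  qed (fact G' K B k F_normal F_Int K_dense K_onto)+
qed

lemma not_profinite_property_residually:
  assumes dh: "dense_homs G K B j k F"
    and fg: "finitely_generated G" "finitely_generated K"
    and rf: "residually_finite G" "residually_finite K"
    and "residually C G" "\<not> residually C K"
  shows "\<not> profinite_property (residually C)"
proof
  assume prof: "profinite_property (residually C)"
  interpret dense_homs G K B j k F by (rule dh)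
  have "countable (carrier G)" "countable (carrier K)"
    using fg group.countable_generate[OF G] group.countable_generate[OF K] countable_finite
    unfolding finitely_generated_def by metis+
  then obtain f :: "'a \<Rightarrow> nat" and g :: "'b \<Rightarrow> nat" where f: "inj_on f (carrier G)" and g: "inj_on g (carrier K)"
    by (auto simp: countable_def)
  define G' where "G' = transport_group f G"
  define K' where "K' = transport_group g K"
  have G': "group G'" "f \<in> iso G G'" and K': "group K'" "g \<in> iso K K'"
    using group.transport_group_iso[OF G f] group.group_transport_group[OF G f]
      group.transport_group_iso[OF K g] group.group_transport_group[OF K g] by (auto simp: G'_def K'_def)
  have i: "inv_into (carrier G) f \<in> iso G' G" and i': "inv_into (carrier K) g \<in> iso K' K"
    using group.iso_set_sym[OF G G'(2)] group.iso_set_sym[OF K K'(2)] by auto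
  have "dense_homs G' K B (j \<circ> inv_into (carrier G) f) k F" using dense_homs_iso[OF dh G'(1) i] .
  then have "dense_homs K G' B k (j \<circ> inv_into (carrier G) f) F" by (rule dense_homs.dense_homs_sym)
  then have "dense_homs K' G' B (k \<circ> inv_into (carrier K) g) (j \<circ> inv_into (carrier G) f) F"
    using dense_homs_iso[OF _ K'(1) i'] by blast
  then have same: "same_profinite_completion G' K'"
    using dense_homs.dense_homs_sym dense_homs.same_profinite_completion by blast
  have fg': "finitely_generated G'" "finitely_generated K'"
    using finitely_generated_image[OF fg(1) G G'(1), of f] finitely_generated_image[OF fg(2) K K'(1), of g]
      G'(2) K'(2) by (auto simp: iso_iff)
  have inv_f: "inv_into (carrier G) f \<in> hom G' G" "inj_on (inv_into (carrier G) f) (carrier G')"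
    and inv_g: "inv_into (carrier K) g \<in> hom K' K" "inj_on (inv_into (carrier K) g) (carrier K')"
    and gK: "g \<in> hom K K'" "inj_on g (carrier K)"
    using i i' K'(2) by (simp_all add: iso_def bij_betw_def)
  have "residually C G'" "residually_finite G'" "residually_finite K'"
    using residually_inj_hom[OF _ inv_f] residually_inj_hom[OF _ inv_g] assms unfolding residually_finite_def by auto
  moreover have "\<not> residually C K'" using residually_inj_hom[OF _ gK] assms by blast
  ultimately show False
    using prof G'(1) K'(1) fg' same unfolding profinite_property_def by blast
qed

text \<open>The members of \<open>A\<close> are functions on the whole type, so that literally the
  same \<open>A\<close>, with the same equality, acts on every stable subset; nested modules then
  give nested groups.\<close>

definition affine_group :: "'v::ab_group_add set \<Rightarrow> ('v \<Rightarrow> 'v) set \<Rightarrow> ('v \<times> ('v \<Rightarrow> 'v)) monoid" where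
  "affine_group V A = \<lparr>carrier = V \<times> A,
     monoid.mult = (\<lambda>x y. (fst x + snd x (fst y), snd x \<circ> snd y)), one = (0, id)\<rparr>"

lemma affine_group_simps [simp]:
  "carrier (affine_group V A) = V \<times> A"
  "(v, g) \<otimes>\<^bsub>affine_group V A\<^esub> (w, h) = (v + g w, g \<circ> h)"
  "\<one>\<^bsub>affine_group V A\<^esub> = (0, id)"
  by (simp_all add: affine_group_def)

locale affine_action =
  fixes V :: "'v::ab_group_add set" and A :: "('v \<Rightarrow> 'v) set"
  assumes zero: "0 \<in> V" and diff: "\<And>v w. v \<in> V \<Longrightarrow> w \<in> V \<Longrightarrow> v - w \<in> V"
    and id: "id \<in> A" and comp: "\<And>g h. g \<in> A \<Longrightarrow> h \<in> A \<Longrightarrow> g \<circ> h \<in> A"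
    and inverse: "\<And>g. g \<in> A \<Longrightarrow> \<exists>h \<in> A. g \<circ> h = id \<and> h \<circ> g = id"
    and additive: "\<And>g v w. g \<in> A \<Longrightarrow> g (v - w) = g v - g w"
    and stable: "\<And>g v. g \<in> A \<Longrightarrow> v \<in> V \<Longrightarrow> g v \<in> V"
begin

lemma uminus: "v \<in> V \<Longrightarrow> - v \<in> V" using diff[OF zero] by fastforce
lemma add: "v \<in> V \<Longrightarrow> w \<in> V \<Longrightarrow> v + w \<in> V" using diff[of v "- w"] uminus by simp
lemma map_zero: "g \<in> A \<Longrightarrow> g 0 = 0" using additive[of g 0 0] by simp
lemma map_uminus: "g \<in> A \<Longrightarrow> g (- v) = - g v" using additive[of g 0 v] map_zero by simp
lemma map_add: "g \<in> A \<Longrightarrow> g (v + w) = g v + g w" using additive[of g v "- w"] map_uminus by simp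

lemma inv_map: "g \<in> A \<Longrightarrow> inv_into UNIV g \<in> A \<and> g (inv_into UNIV g v) = v \<and> inv_into UNIV g (g v) = v"
proof -
  assume "g \<in> A"
  then obtain h where h: "h \<in> A" "g \<circ> h = id" "h \<circ> g = id" using inverse by blast
  then have "inv_into UNIV g = h" by (rule_tac inv_unique_comp)
  then show ?thesis using h by (metis comp_apply id_apply)
qed

lemma group: "group (affine_group V A)"
proof (rule groupI)
  fix x assume "x \<in> carrier (affine_group V A)"
  then obtain v g where x: "x = (v, g)" "v \<in> V" "g \<in> A" by auto
  show "\<exists>y \<in> carrier (affine_group V A). y \<otimes>\<^bsub>affine_group V A\<^esub> x = \<one>\<^bsub>affine_group V A\<^esub>"
    using x inv_map[of g] stable uminus
    by (intro bexI[of _ "(- (inv_into UNIV g v), inv_into UNIV g)"]) (auto simp: fun_eq_iff)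
qed (auto simp: add zero stable comp id map_add map_zero add.assoc fun_eq_iff)

lemma inv_affine:
  "v \<in> V \<Longrightarrow> g \<in> A \<Longrightarrow> inv\<^bsub>affine_group V A\<^esub> (v, g) = (- inv_into UNIV g v, inv_into UNIV g)"
  using inv_map[of g] stable uminus by (intro group.inv_equality[OF group]) (auto simp: fun_eq_iff)

lemma conj_translation:
  "v \<in> V \<Longrightarrow> g \<in> A \<Longrightarrow>
    (0, g) \<otimes>\<^bsub>affine_group V A\<^esub> (v, id) \<otimes>\<^bsub>affine_group V A\<^esub> inv\<^bsub>affine_group V A\<^esub> (0, g) = (g v, id)"
  using inv_map[of g] zero by (simp add: inv_affine map_zero fun_eq_iff)

lemma commutator_translation:
  "v \<in> V \<Longrightarrow> g \<in> A \<Longrightarrow>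
    (0, g) \<otimes>\<^bsub>affine_group V A\<^esub> (v, id) \<otimes>\<^bsub>affine_group V A\<^esub> inv\<^bsub>affine_group V A\<^esub> (0, g)
      \<otimes>\<^bsub>affine_group V A\<^esub> inv\<^bsub>affine_group V A\<^esub> (v, id) = (g v - v, id)"
  by (subst conj_translation) (simp_all add: inv_affine id)

lemma funpow_closed: "g \<in> A \<Longrightarrow> g ^^ n \<in> A"
  by (induction n) (simp_all add: id comp)

lemma pow_linear: "g \<in> A \<Longrightarrow> (0, g) [^]\<^bsub>affine_group V A\<^esub> (n::nat) = (0, g ^^ n)"
proof (induction n)
  case (Suc n)
  then show ?case using map_zero[OF funpow_closed[of g n]]
    by (simp add: fun_eq_iff funpow_swap1)
qed simp

text \<open>Powers in the semidirect product become iterates of this affine map, which is the form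
  in which p-powers are estimated.\<close>

definition act where "act x u = fst x + snd x u"

lemma act_mult:
  "x \<in> V \<times> A \<Longrightarrow> y \<in> V \<times> A \<Longrightarrow> act (x \<otimes>\<^bsub>affine_group V A\<^esub> y) u = act x (act y u)"
  by (auto simp: act_def map_add add.assoc)

lemma act_pow:
  assumes x: "x \<in> V \<times> A"
  shows "act (x [^]\<^bsub>affine_group V A\<^esub> (n::nat)) u = (act x ^^ n) u"
proof -
  interpret G: group "affine_group V A" by (rule group)
  show ?thesis
  proof (induction n arbitrary: u)
    case 0
    then show ?case by (simp add: act_def)
  next
    case (Suc n)
    have "x [^]\<^bsub>affine_group V A\<^esub> n \<in> V \<times> A" using G.nat_pow_closed[of x n] x by simp
    then show ?case using x Suc by (simp add: act_mult funpow_swap1)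
  qed
qed

text \<open>The kernel of the action by affine maps on V / (V \<inter> J), when \<open>J\<close> is
  a stable subgroup.\<close>

definition congruence_kernel where
  "congruence_kernel J = {(v, g). v \<in> V \<and> g \<in> A \<and> v \<in> J \<and> (\<forall>w \<in> V. g w - w \<in> J)}"

lemma congruence_kernel:
  assumes J0: "0 \<in> J" and J: "\<And>v w. v \<in> J \<Longrightarrow> w \<in> J \<Longrightarrow> v - w \<in> J"
    and JA: "\<And>g v. g \<in> A \<Longrightarrow> v \<in> V \<Longrightarrow> v \<in> J \<Longrightarrow> g v \<in> J"
    and fin: "finite (c ` V)" and c: "\<And>v w. v \<in> V \<Longrightarrow> w \<in> V \<Longrightarrow> c v = c w \<Longrightarrow> v - w \<in> J"
  shows "congruence_kernel J \<in> finite_index_normals (affine_group V A)"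
proof -
  interpret G: group "affine_group V A" by (rule group)
  have Jm: "- v \<in> J" if "v \<in> J" for v using J[OF J0 that] by simp
  have Ja: "v + w \<in> J" if "v \<in> J" "w \<in> J" for v w using J[OF that(1) Jm[OF that(2)]] by simp
  have N: "congruence_kernel J \<lhd> affine_group V A"
  proof (rule G.normal_invI)
    show "subgroup (congruence_kernel J) (affine_group V A)"
    proof (rule G.subgroupI)
      show "congruence_kernel J \<subseteq> carrier (affine_group V A)" by (auto simp: congruence_kernel_def)
      have "(0, id) \<in> congruence_kernel J" using zero id J0 by (auto simp: congruence_kernel_def)
      then show "congruence_kernel J \<noteq> {}" by blast
    next
      fix x assume "x \<in> congruence_kernel J"
      then obtain v g where x: "x = (v, g)" "v \<in> V" "g \<in> A" "v \<in> J" "\<And>w. w \<in> V \<Longrightarrow> g w - w \<in> J"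
        by (auto simp: congruence_kernel_def)
      have ig: "inv_into UNIV g \<in> A" using inv_map x by blast
      have "inv_into UNIV g w - w \<in> J" if w: "w \<in> V" for w
        using Jm[OF x(5)[OF stable[OF ig w]]] inv_map[OF x(3)] by simp
      moreover have "- inv_into UNIV g v \<in> J" using Jm JA ig x by blast
      moreover have "- inv_into UNIV g v \<in> V" using uminus stable ig x by blast
      ultimately show "inv\<^bsub>affine_group V A\<^esub> x \<in> congruence_kernel J"
        using x ig by (simp add: inv_affine congruence_kernel_def)
    next
      fix x y assume "x \<in> congruence_kernel J" "y \<in> congruence_kernel J"
      then obtain v g w h where x: "x = (v, g)" "v \<in> V" "g \<in> A" "v \<in> J" "\<And>u. u \<in> V \<Longrightarrow> g u - u \<in> J"
        and y: "y = (w, h)" "w \<in> V" "h \<in> A" "w \<in> J" "\<And>u. u \<in> V \<Longrightarrow> h u - u \<in> J"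
        by (auto simp: congruence_kernel_def)
      have "g (h u) - u \<in> J" if u: "u \<in> V" for u
        using Ja[OF x(5)[OF stable[OF y(3) u]] y(5)[OF u]] by simp
      moreover have "v + g w \<in> V" using add stable x y by blast
      moreover have "v + g w \<in> J" using Ja JA x y by blast
      ultimately show "x \<otimes>\<^bsub>affine_group V A\<^esub> y \<in> congruence_kernel J"
        using x y comp by (simp add: congruence_kernel_def)
    qed
  next
    fix x h assume "x \<in> carrier (affine_group V A)" "h \<in> congruence_kernel J"
    then obtain v g w h' where x: "x = (v, g)" "v \<in> V" "g \<in> A"
      and y: "h = (w, h')" "w \<in> V" "h' \<in> A" "w \<in> J" "\<And>u. u \<in> V \<Longrightarrow> h' u - u \<in> J"
      by (auto simp: congruence_kernel_def)
    have ig: "inv_into UNIV g \<in> A" using inv_map x by blast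
    have conj: "g (h' (inv_into UNIV g u)) - u \<in> J" if u: "u \<in> V" for u
    proof -
      have "g (h' (inv_into UNIV g u) - inv_into UNIV g u) \<in> J"
        using JA[OF x(3) diff[OF stable[OF y(3)] ] y(5)] stable[OF ig u] by simp
      then show ?thesis using additive[OF x(3)] inv_map[OF x(3)] by simp
    qed
    have "v + g w - g (h' (inv_into UNIV g v)) \<in> J"
      using J[OF JA[OF x(3) y(2,4)] conj[OF x(2)]] by (simp add: algebra_simps)
    moreover have "v + g w - g (h' (inv_into UNIV g v)) \<in> V" using x y ig by (simp add: diff add stable)
    ultimately show "x \<otimes>\<^bsub>affine_group V A\<^esub> h \<otimes>\<^bsub>affine_group V A\<^esub> inv\<^bsub>affine_group V A\<^esub> x \<in> congruence_kernel J"
      using x y ig conj comp stable by (simp add: inv_affine congruence_kernel_def map_uminus)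
  qed
  \<comment> \<open>\<open>c\<close> may be finer than congruence modulo \<open>J\<close>, so a
    linear map need not act on colours; its effect is recorded as a relation between them.\<close>
  define t where "t x = (c (fst x), (\<lambda>u. (c u, c (snd x u))) ` V)" for x
  have "t ` carrier (affine_group V A) \<subseteq> c ` V \<times> Pow (c ` V \<times> c ` V)"
    using stable by (auto simp: t_def)
  then have fint: "finite (t ` carrier (affine_group V A))"
    by (rule finite_subset) (simp add: fin)
  show ?thesis
  proof (rule finite_index_normalsI[OF group N fint])
    fix x y assume "x \<in> carrier (affine_group V A)" "y \<in> carrier (affine_group V A)" and t: "t x = t y"
    then obtain v g w h where x: "x = (v, g)" "v \<in> V" "g \<in> A" and y: "y = (w, h)" "w \<in> V" "h \<in> A"
      by auto
    have vw: "v - w \<in> J" using t c x y by (simp add: t_def)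
    have gh: "g u - h u \<in> J" if u: "u \<in> V" for u
    proof -
      have "(c u, c (g u)) \<in> (\<lambda>u. (c u, c (h u))) ` V" using t x y u by (auto simp: t_def)
      then obtain u' where u': "u' \<in> V" "c u = c u'" "c (g u) = c (h u')" by auto
      have "h (u - u') \<in> J" using JA[OF y(3) diff[OF u u'(1)] c[OF u u'(1,2)]] .
      then have "h u - h u' \<in> J" using additive[OF y(3)] by simp
      moreover have "g u - h u' \<in> J" using c[OF stable[OF x(3) u] stable[OF y(3) u'(1)] u'(3)] .
      ultimately show ?thesis using J[of "g u - h u'" "h u - h u'"] by simp
    qed
    have ih: "inv_into UNIV h \<in> A" using inv_map y by blast
    have 1: "g (inv_into UNIV h u) - u \<in> J" if u: "u \<in> V" for u
      using gh[OF stable[OF ih u]] inv_map[OF y(3)] by simp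
    have "v - g (inv_into UNIV h w) \<in> J" using J[OF vw 1[OF y(2)]] by simp
    moreover have "v - g (inv_into UNIV h w) \<in> V" using x y ih by (simp add: diff stable)
    ultimately show "x \<otimes>\<^bsub>affine_group V A\<^esub> inv\<^bsub>affine_group V A\<^esub> y \<in> congruence_kernel J"
      using x y ih 1 comp by (simp add: inv_affine congruence_kernel_def map_uminus)
  qed
qed

lemma congruence_kernelI:
  assumes x: "x \<in> V \<times> A" and J: "\<And>v w. v \<in> J \<Longrightarrow> w \<in> J \<Longrightarrow> v - w \<in> J" and act: "\<And>u. u \<in> V \<Longrightarrow> act x u - u \<in> J"
  shows "x \<in> congruence_kernel J"
proof -
  obtain v g where vg: "x = (v, g)" "v \<in> V" "g \<in> A" using x by auto
  have v: "v \<in> J" using act[OF zero] vg map_zero[OF vg(3)] by (simp add: act_def)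
  have "g u - u \<in> J" if "u \<in> V" for u
    using J[OF act[OF that] v] vg by (simp add: act_def algebra_simps)
  then show ?thesis using vg v by (simp add: congruence_kernel_def)
qed

text \<open>Separation in the semidirect product is reduced to separating one vector from 0: the
  translation if it is nonzero, otherwise g w - w for a vector w that is moved. The vector does not
  depend on \<open>J\<close>.\<close>

lemma separated:
  assumes x: "x \<in> V \<times> A" "x \<noteq> (0, id)"
    and faithful: "\<And>g. g \<in> A \<Longrightarrow> g \<noteq> id \<Longrightarrow> \<exists>v \<in> V. g v \<noteq> v"
  obtains u where "u \<in> V" "u \<noteq> 0" "\<And>J. x \<in> congruence_kernel J \<Longrightarrow> u \<in> J"
proof -
  obtain v g where vg: "x = (v, g)" "v \<in> V" "g \<in> A" using x by auto
  show thesis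
  proof (cases "v = 0")
    case False
    then show ?thesis using that[of v] vg by (auto simp: congruence_kernel_def)
  next
    case True
    then obtain w where "w \<in> V" "g w \<noteq> w" using faithful vg x by auto
    then show ?thesis using that[of "g w - w"] vg diff stable by (auto simp: congruence_kernel_def)
  qed
qed

definition translation_part where "translation_part M = {v \<in> V. (v, id) \<in> M}"

lemma
  assumes M: "M \<lhd> affine_group V A"
  shows translation_part_zero: "0 \<in> translation_part M"
    and translation_part_diff: "v \<in> translation_part M \<Longrightarrow> w \<in> translation_part M \<Longrightarrow> v - w \<in> translation_part M"
    and translation_part_stable: "g \<in> A \<Longrightarrow> v \<in> translation_part M \<Longrightarrow> g v \<in> translation_part M"
    and translation_part_commutator: "(0, g) \<in> M \<Longrightarrow> v \<in> V \<Longrightarrow> g v - v \<in> translation_part M"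
proof -
  interpret G: group "affine_group V A" by (rule group)
  interpret M: normal M "affine_group V A" by (rule M)
  show "0 \<in> translation_part M" using M.one_closed zero by (simp add: translation_part_def)
  show "v - w \<in> translation_part M" if "v \<in> translation_part M" "w \<in> translation_part M"
  proof -
    have "(v, id) \<otimes>\<^bsub>affine_group V A\<^esub> inv\<^bsub>affine_group V A\<^esub> (w, id) \<in> M"
      using that by (simp add: translation_part_def)
    then show ?thesis using that diff by (simp add: translation_part_def inv_affine id)
  qed
  show "g v \<in> translation_part M" if "g \<in> A" "v \<in> translation_part M"
  proof -
    have "(0, g) \<otimes>\<^bsub>affine_group V A\<^esub> (v, id) \<otimes>\<^bsub>affine_group V A\<^esub> inv\<^bsub>affine_group V A\<^esub> (0, g) \<in> M"
      using that zero by (intro M.inv_op_closed2) (simp_all add: translation_part_def)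
    then show ?thesis using that stable unfolding translation_part_def by (subst (asm) conj_translation) auto
  qed
  show "g v - v \<in> translation_part M" if g: "(0, g) \<in> M" and v: "v \<in> V"
  proof -
    have gA: "g \<in> A" using M.mem_carrier[OF g] by simp
    have "(v, id) \<otimes>\<^bsub>affine_group V A\<^esub> inv\<^bsub>affine_group V A\<^esub> (0, g) \<otimes>\<^bsub>affine_group V A\<^esub> inv\<^bsub>affine_group V A\<^esub> (v, id) \<in> M"
      using g v id by (intro M.inv_op_closed2) simp_all
    then have "(0, g) \<otimes>\<^bsub>affine_group V A\<^esub> ((v, id) \<otimes>\<^bsub>affine_group V A\<^esub> inv\<^bsub>affine_group V A\<^esub> (0, g) \<otimes>\<^bsub>affine_group V A\<^esub> inv\<^bsub>affine_group V A\<^esub> (v, id)) \<in> M"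
      using g by blast
    moreover have "(0, g) \<otimes>\<^bsub>affine_group V A\<^esub> ((v, id) \<otimes>\<^bsub>affine_group V A\<^esub> inv\<^bsub>affine_group V A\<^esub> (0, g) \<otimes>\<^bsub>affine_group V A\<^esub> inv\<^bsub>affine_group V A\<^esub> (v, id)) = (g v - v, id)"
    proof -
      have "(0, g) \<in> carrier (affine_group V A)" "(v, id) \<in> carrier (affine_group V A)"
        using v gA id zero by simp_all
      then show ?thesis using commutator_translation[OF v gA] by (simp add: G.m_assoc del: affine_group_simps)
    qed
    ultimately show ?thesis using v gA stable diff by (simp add: translation_part_def)
  qed
qed

text \<open>By Lagrange the order of the quotient serves as n. For the substitution this is the
  period that yields t^(q^n) = t in the quotient.\<close>

lemma pow_mem_finite_index:
  assumes M: "M \<in> finite_index_normals (affine_group V A)" and g: "g \<in> A"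
  obtains n where "n > 0" "\<And>m. n dvd m \<Longrightarrow> (0, g ^^ m) \<in> M"
proof -
  interpret G: group "affine_group V A" by (rule group)
  interpret M: normal M "affine_group V A" using M by (simp add: finite_index_normals_def)
  interpret Q: group "affine_group V A Mod M" by (rule M.factorgroup_is_group)
  define n where "n = Coset.order (affine_group V A Mod M)"
  have x: "(0, g) \<in> carrier (affine_group V A)" using g zero by simp
  have "finite (carrier (affine_group V A Mod M))" using M by (simp add: finite_index_normals_def FactGroup_def)
  then have n: "n > 0" unfolding n_def using Q.order_gt_0_iff_finite by blast
  have "(0, g ^^ m) \<in> M" if "n dvd m" for m
  proof -
    obtain l where l: "m = n * l" using \<open>n dvd m\<close> by blast
    have C: "M #>\<^bsub>affine_group V A\<^esub> (0, g) \<in> carrier (affine_group V A Mod M)"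
      using x by (auto simp: carrier_FactGroup)
    have "(M #>\<^bsub>affine_group V A\<^esub> (0, g)) [^]\<^bsub>affine_group V A Mod M\<^esub> m = M"
      using Q.pow_order_eq_1[OF C] Q.nat_pow_pow[OF C, of n l] by (simp add: l n_def Q.nat_pow_one[simplified])
    then have "M #>\<^bsub>affine_group V A\<^esub> ((0, g) [^]\<^bsub>affine_group V A\<^esub> m) = M"
      using M.FactGroup_pow[OF x] by simp
    then show ?thesis
      using G.coset_join1[OF _ _ M.subgroup_axioms] G.nat_pow_closed[OF x] M.subset pow_linear[OF g] by metis
  qed
  then show thesis using that n by blast
qed

lemma generate_affine:
  assumes S: "S \<subseteq> V \<times> A"
    and lin: "\<And>H. subgroup H (affine_group V A) \<Longrightarrow> S \<subseteq> H \<Longrightarrow> {0} \<times> A \<subseteq> H"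
    and tr: "\<And>W. W \<subseteq> V \<Longrightarrow> {v. (v, id) \<in> S} \<subseteq> W \<Longrightarrow> 0 \<in> W \<Longrightarrow> (\<And>v w. v \<in> W \<Longrightarrow> w \<in> W \<Longrightarrow> v - w \<in> W)
       \<Longrightarrow> (\<And>g v. g \<in> A \<Longrightarrow> v \<in> W \<Longrightarrow> g v \<in> W) \<Longrightarrow> V \<subseteq> W"
  shows "generate (affine_group V A) S = V \<times> A"
proof -
  interpret G: group "affine_group V A" by (rule group)
  define H where "H = generate (affine_group V A) S"
  have H: "subgroup H (affine_group V A)" unfolding H_def using S by (intro G.generate_is_subgroup) simp
  have SH: "S \<subseteq> H" unfolding H_def using generate.incl by fast
  have linH: "(0, g) \<in> H" if "g \<in> A" for g using lin[OF H SH] that by blast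
  have HVA: "H \<subseteq> V \<times> A" using subgroup.subset[OF H] by simp
  have "V \<subseteq> {v. (v, id) \<in> H}"
  proof (rule tr)
    show "{v. (v, id) \<in> H} \<subseteq> V" using HVA by blast
    show "{v. (v, id) \<in> S} \<subseteq> {v. (v, id) \<in> H}" using SH by blast
    show "0 \<in> {v. (v, id) \<in> H}" using linH id by simp
  next
    fix v w assume vw: "v \<in> {v. (v, id) \<in> H}" "w \<in> {v. (v, id) \<in> H}"
    then have "(v, id) \<otimes>\<^bsub>affine_group V A\<^esub> inv\<^bsub>affine_group V A\<^esub> (w, id) \<in> H"
      by (intro subgroup.m_closed[OF H] subgroup.m_inv_closed[OF H]) simp_all
    moreover have "w \<in> V" using vw HVA by blast
    ultimately show "v - w \<in> {v. (v, id) \<in> H}" by (simp add: inv_affine id)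
  next
    fix g v assume g: "g \<in> A" and v: "v \<in> {v. (v, id) \<in> H}"
    then have "(0, g) \<otimes>\<^bsub>affine_group V A\<^esub> (v, id) \<otimes>\<^bsub>affine_group V A\<^esub> inv\<^bsub>affine_group V A\<^esub> (0, g) \<in> H"
      using linH by (intro subgroup.m_closed[OF H] subgroup.m_inv_closed[OF H]) simp_all
    moreover have "v \<in> V" using v HVA by blast
    ultimately show "g v \<in> {v. (v, id) \<in> H}" using g by (subst (asm) conj_translation) auto
  qed
  then have "(v, g) \<in> H" if "v \<in> V" "g \<in> A" for v g
    using subgroup.m_closed[OF H, of "(v, id)" "(0, g)"] linH that by auto
  then show ?thesis using HVA by (auto simp: H_def)
qed

end

text \<open>Equivariance modulo \<open>M\<close> is enough to make (w, g) \<mapsto> (r w, g) a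
  homomorphism to the quotient by \<open>M\<close>; the subgroup in the conclusion is its kernel. If
  r is the identity on \<open>V\<close>, it restricts to \<open>M\<close>.\<close>

lemma retraction_finite_index:
  assumes VW: "affine_action V A" "affine_action W A" "V \<subseteq> W"
    and M: "M \<in> finite_index_normals (affine_group V A)"
    and r: "\<And>w. w \<in> W \<Longrightarrow> r w \<in> V" and r_diff: "\<And>v w. r (v - w) = r v - r w"
    and equivariant: "\<And>g w. g \<in> A \<Longrightarrow> w \<in> W \<Longrightarrow> (r (g w) - g (r w), id) \<in> M"
  shows "{(w, g). w \<in> W \<and> g \<in> A \<and> (r w, g) \<in> M} \<in> finite_index_normals (affine_group W A)"
proof -
  interpret V: affine_action V A by fact
  interpret W: affine_action W A by fact
  interpret G: group "affine_group V A" by (rule V.group)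
  interpret B: group "affine_group W A" by (rule W.group)
  interpret M: normal M "affine_group V A" using M by (simp add: finite_index_normals_def)
  interpret Q: group "affine_group V A Mod M" by (rule M.factorgroup_is_group)
  have r0: "r 0 = 0" using r_diff[of 0 0] by simp
  have r_add: "r (v + w) = r v + r w" for v w using r_diff[of v "0 - w"] r_diff[of 0 w] r0 by simp
  define h where "h x = M #>\<^bsub>affine_group V A\<^esub> (r (fst x), snd x)" for x
  have hcar: "h x \<in> carrier (affine_group V A Mod M)" if "x \<in> W \<times> A" for x
    using that r by (auto simp: h_def carrier_FactGroup)
  have hhom: "h \<in> hom (affine_group W A) (affine_group V A Mod M)"
  proof (rule homI)
    show "h x \<in> carrier (affine_group V A Mod M)" if "x \<in> carrier (affine_group W A)" for x
      using hcar that by simp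
    fix x y assume "x \<in> carrier (affine_group W A)" "y \<in> carrier (affine_group W A)"
    then obtain v g w g' where x: "x = (v, g)" "v \<in> W" "g \<in> A" and y: "y = (w, g')" "w \<in> W" "g' \<in> A"
      by auto
    have "h x \<otimes>\<^bsub>affine_group V A Mod M\<^esub> h y = M #>\<^bsub>affine_group V A\<^esub> (r v + g (r w), g \<circ> g')"
      using x y r by (simp add: h_def M.rcos_sum)
    moreover have "(r (v + g w), g \<circ> g') \<in> M #>\<^bsub>affine_group V A\<^esub> (r v + g (r w), g \<circ> g')"
    proof -
      have "(r (v + g w), g \<circ> g') = (r (g w) - g (r w), id) \<otimes>\<^bsub>affine_group V A\<^esub> (r v + g (r w), g \<circ> g')"
        by (simp add: r_add)
      then show ?thesis using equivariant[OF x(3) y(2)] unfolding r_coset_def by blast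
    qed
    then have "M #>\<^bsub>affine_group V A\<^esub> (r (v + g w), g \<circ> g') = M #>\<^bsub>affine_group V A\<^esub> (r v + g (r w), g \<circ> g')"
      using x y r V.add V.stable V.comp by (intro G.repr_independence[OF _ _ M.subgroup_axioms, symmetric]) auto
    ultimately show "h (x \<otimes>\<^bsub>affine_group W A\<^esub> y) = h x \<otimes>\<^bsub>affine_group V A Mod M\<^esub> h y"
      using x y by (simp add: h_def)
  qed
  have "kernel (affine_group W A) (affine_group V A Mod M) h \<in> finite_index_normals (affine_group W A)"
  proof (rule kernel_finite_index)
    show "group_hom (affine_group W A) (affine_group V A Mod M) h"
      using hhom by (simp add: group_hom_def group_hom_axioms_def W.group Q.is_group)
    have "h ` carrier (affine_group W A) \<subseteq> carrier (affine_group V A Mod M)" using hcar by auto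
    moreover have "finite (carrier (affine_group V A Mod M))" using M by (simp add: finite_index_normals_def FactGroup_def)
    ultimately show "finite (h ` carrier (affine_group W A))" by (rule finite_subset)
  qed
  moreover have "kernel (affine_group W A) (affine_group V A Mod M) h = {(w, g). w \<in> W \<and> g \<in> A \<and> (r w, g) \<in> M}"
    using G.coset_join1[OF _ _ M.subgroup_axioms] G.coset_join2[OF _ M.subgroup_axioms] r M.subset
    by (auto simp: kernel_def h_def)
  ultimately show ?thesis by simp
qed

section \<open>The modules and the group acting on them\<close>

lemma frag_extend_frag_extend:
  "frag_extend f (frag_extend g v) = frag_extend (\<lambda>k. frag_extend f (g k)) v"
  by (rule frag_induction[of v UNIV]) (simp_all add: frag_extend_diff)

lemma additive_map_eqI:
  assumes "\<And>v w. f (v - w) = f v - f w" "\<And>v w. g (v - w) = g v - g w"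
    and "Poly_Mapping.keys v \<subseteq> S" "\<And>k. k \<in> S \<Longrightarrow> f (frag_of k) = g (frag_of k)"
  shows "f v = (g v :: 'b::ab_group_add)"
  using assms(3)
proof (rule frag_induction)
  show "f 0 = g 0" using assms(1)[of 0 0] assms(2)[of 0 0] by simp
qed (use assms in simp_all)

lemma frag_cmul_diff: "frag_cmul c (v - w) = frag_cmul c v - frag_cmul c w"
  by (rule poly_mapping_eqI) (simp add: lookup_minus right_diff_distrib)

lemma additive_frag_cmul:
  assumes "\<And>v w. f (v - w) = f v - f w"
  shows "f (frag_cmul c v) = frag_cmul c (f v)"
proof -
  have 0: "f 0 = 0" using assms[of 0 0] by simp
  have m: "f (- w) = - f w" for w using assms[of 0 w] 0 by simp
  have a: "f (v + w) = f v + f w" for v w using assms[of v "- w"] m by simp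
  have "f (frag_cmul (int n) v) = frag_cmul (int n) (f v)" for n
    by (induction n) (simp_all add: 0 a frag_cmul_distrib)
  then show ?thesis by (cases c rule: int_cases2) (simp_all add: m flip: minus_frag_cmul)
qed

lemma cmul_closed:
  assumes "0 \<in> W" "\<And>v w. v \<in> W \<Longrightarrow> w \<in> W \<Longrightarrow> v - w \<in> W" "v \<in> W"
  shows "frag_cmul c v \<in> W"
  by (rule frag_closure_minus_cmul[where P = "\<lambda>v. v \<in> W"]) (use assms in auto)

lemma diff_closed_sum:
  fixes f :: "'i \<Rightarrow> 'v::ab_group_add"
  assumes "0 \<in> W" "\<And>v w. v \<in> W \<Longrightarrow> w \<in> W \<Longrightarrow> v - w \<in> W" "\<And>i. i \<in> I \<Longrightarrow> f i \<in> W"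
  shows "sum f I \<in> W"
proof -
  have add: "v + w \<in> W" if "v \<in> W" "w \<in> W" for v w
    using assms(2)[OF that(1) assms(2)[OF assms(1) that(2)]] by simp
  show ?thesis using assms(3) by (induction I rule: infinite_finite_induct) (auto simp: assms(1) add)
qed

type_synonym key = "Enum.finite_3 \<times> rat option"

type_synonym vect = "key \<Rightarrow>\<^sub>0 int"

lemma third_index: "\<exists>k::Enum.finite_3. k \<noteq> i \<and> k \<noteq> j"
  by (cases i; cases j) (metis finite_3.distinct)+

lemma commutator_hom_derived:
  assumes "group_hom G H h" "x \<in> carrier G" "y \<in> carrier G" "h x \<in> K" "h y \<in> K"
  shows "h (x \<otimes>\<^bsub>G\<^esub> y \<otimes>\<^bsub>G\<^esub> inv\<^bsub>G\<^esub> x \<otimes>\<^bsub>G\<^esub> inv\<^bsub>G\<^esub> y) \<in> derived H K"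
proof -
  interpret group_hom G H h by fact
  have "h (x \<otimes>\<^bsub>G\<^esub> y \<otimes>\<^bsub>G\<^esub> inv\<^bsub>G\<^esub> x \<otimes>\<^bsub>G\<^esub> inv\<^bsub>G\<^esub> y)
      = h x \<otimes>\<^bsub>H\<^esub> h y \<otimes>\<^bsub>H\<^esub> inv\<^bsub>H\<^esub> (h x) \<otimes>\<^bsub>H\<^esub> inv\<^bsub>H\<^esub> (h y)"
    using assms by simp
  then show ?thesis unfolding derived_def using assms by (intro generate.incl) auto
qed

lemma additive_sum:
  fixes f :: "'v::ab_group_add \<Rightarrow> 'w::ab_group_add"
  assumes "\<And>v w. f (v - w) = f v - f w"
  shows "f (sum g I) = (\<Sum>i\<in>I. f (g i))"
proof -
  have 0: "f 0 = 0" using assms[of 0 0] by simp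
  have m: "f (- w) = - f w" for w using assms[of 0 w] 0 by simp
  have a: "f (v + w) = f v + f w" for v w using assms[of v "- w"] m by simp
  show ?thesis by (induction I rule: infinite_finite_induct) (simp_all add: 0 a)
qed

lemma finite_index_normals_Int:
  assumes G: "group G" and N: "N \<in> finite_index_normals G" "N' \<in> finite_index_normals G"
  shows "N \<inter> N' \<in> finite_index_normals G"
proof -
  interpret group G by (rule G)
  interpret N: normal N G using N by (simp add: finite_index_normals_def)
  interpret N': normal N' G using N by (simp add: finite_index_normals_def)
  have "(\<lambda>x. (N #>\<^bsub>G\<^esub> x, N' #>\<^bsub>G\<^esub> x)) ` carrier G \<subseteq> (rcosets\<^bsub>G\<^esub> N) \<times> (rcosets\<^bsub>G\<^esub> N')"
    by (auto simp: RCOSETS_def)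
  moreover have "finite ((rcosets\<^bsub>G\<^esub> N) \<times> (rcosets\<^bsub>G\<^esub> N'))" using N by (simp add: finite_index_normals_def)
  ultimately have fin: "finite ((\<lambda>x. (N #>\<^bsub>G\<^esub> x, N' #>\<^bsub>G\<^esub> x)) ` carrier G)" by (rule finite_subset)
  show ?thesis
  proof (rule finite_index_normalsI[OF G _ fin])
    show "N \<inter> N' \<lhd> G" using normal_subgroup_intersect[OF N.normal_axioms N'.normal_axioms] .
    fix x y assume xy: "x \<in> carrier G" "y \<in> carrier G" "(N #>\<^bsub>G\<^esub> x, N' #>\<^bsub>G\<^esub> x) = (N #>\<^bsub>G\<^esub> y, N' #>\<^bsub>G\<^esub> y)"
    have "x \<in> N #>\<^bsub>G\<^esub> y" "x \<in> N' #>\<^bsub>G\<^esub> y"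
      using rcos_self[OF xy(1) N.subgroup_axioms] rcos_self[OF xy(1) N'.subgroup_axioms] xy(3) by auto
    then show "x \<otimes>\<^bsub>G\<^esub> inv\<^bsub>G\<^esub> y \<in> N \<inter> N'"
      using N.rcos_module_imp[OF G xy(2)] N'.rcos_module_imp[OF G xy(2)] by blast
  qed
qed

text \<open>Every p-th power gains a factor p: in y^p - 1 = (y - 1)(1 + y + ... + y^(p-1)) the
  second factor is a sum of p terms congruent to 1.\<close>

lemma cong_one_pow_prime_power:
  fixes x :: int and p :: nat
  assumes "[x = 1] (mod int p)"
  shows "[x ^ (p ^ m) = 1] (mod int p ^ m)"
proof -
  have "int p ^ Suc m dvd x ^ (p ^ m) - 1"
  proof (induction m)
    case 0
    then show ?case using assms by (simp add: cong_iff_dvd_diff)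
  next
    case (Suc m)
    let ?y = "x ^ (p ^ m)"
    have "[?y = 1 ^ (p ^ m)] (mod int p)" using assms by (rule cong_pow)
    then have "[(\<Sum>i<p. ?y ^ i) = (\<Sum>i<p. 1)] (mod int p)"
      by (intro cong_sum) (use cong_pow in fastforce)
    then have "int p dvd (\<Sum>i<p. ?y ^ i)" by (simp add: cong_dvd_iff)
    then have "int p ^ Suc m * int p dvd (?y - 1) * (\<Sum>i<p. ?y ^ i)" using Suc by (intro mult_dvd_mono)
    also have "\<dots> = ?y ^ p - 1" by (simp add: power_diff_1_eq)
    finally have "int p ^ Suc (Suc m) dvd ?y ^ p - 1" by (simp add: mult.commute)
    moreover have "x ^ (p ^ Suc m) = ?y ^ p" by (simp add: mult.commute flip: power_mult)
    ultimately show ?case by (simp only:)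
  qed
  then have "int p ^ m dvd x ^ (p ^ m) - 1" by (metis dvd_mult_right power_Suc)
  then show ?thesis by (simp add: cong_iff_dvd_diff)
qed

definition lin :: "('k \<Rightarrow> int) \<Rightarrow> ('k \<Rightarrow>\<^sub>0 int) \<Rightarrow> int" where
  "lin w v = (\<Sum>k \<in> Poly_Mapping.keys v. Poly_Mapping.lookup v k * w k)"

lemma lin_diff: "lin w (u - v) = lin w u - lin w v"
proof -
  \<comment> \<open>Viewed as the extension of a map into the free group on one generator, the
    functional inherits additivity from \<open>frag_extend\<close>.\<close>
  have "lin w v = Poly_Mapping.lookup (frag_extend (\<lambda>k. frag_cmul (w k) (frag_of ())) v) ()" for v
    by (simp add: lin_def frag_extend_def lookup_sum)
  then show ?thesis by (simp add: frag_extend_diff lookup_minus)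
qed

lemma lin_0 [simp]: "lin w 0 = 0" by (simp add: lin_def)

lemma lin_add: "lin w (u + v) = lin w u + lin w v"
  using lin_diff[of w u "0 - v"] lin_diff[of w 0 v] by simp

lemma lin_frag_of [simp]: "lin w (frag_of k) = w k" by (simp add: lin_def)

lemma lin_frag_cmul: "lin w (frag_cmul c v) = c * lin w v"
  unfolding lin_def sum_distrib_left
  by (intro sum.mono_neutral_cong_left) (auto simp: in_keys_iff mult.assoc)

section \<open>Monomials with exponents in Z[1/q], transvections and scalings\<close>

locale construction =
  fixes p q :: nat
  assumes p: "Factorial_Ring.prime p" and q: "q = Suc p"
begin

lemma q_ge: "q \<ge> 3" using prime_ge_2_nat[OF p] q by simp

text \<open>The nonnegative elements of Z[1/q]; the sign condition is hidden in the natural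
  numerator.\<close>

definition valid :: "rat \<Rightarrow> bool" where "valid e \<longleftrightarrow> (\<exists>b n. e * of_nat q ^ b = of_nat n)"

lemma valid_of_nat [simp]: "valid (of_nat n)"
  unfolding valid_def by (rule exI[of _ 0]) simp

lemma valid_0 [simp]: "valid 0" and valid_1 [simp]: "valid 1"
  using valid_of_nat[of 0] valid_of_nat[of 1] by simp_all

lemma valid_common:
  assumes "valid e" "valid f"
  obtains b m n where "e * of_nat q ^ b = of_nat m" "f * of_nat q ^ b = of_nat n"
proof -
  obtain b m where b: "e * of_nat q ^ b = of_nat m" using assms by (auto simp: valid_def)
  obtain c n where c: "f * of_nat q ^ c = of_nat n" using assms by (auto simp: valid_def)
  have "e * of_nat q ^ (b + c) = of_nat (m * q ^ c)" using b by (simp add: power_add flip: mult.assoc)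
  moreover have "f * of_nat q ^ (b + c) = of_nat (n * q ^ b)" using c by (simp add: power_add mult.left_commute mult.commute)
  ultimately show thesis using that by blast
qed

lemma valid_add [simp]: assumes "valid e" "valid f" shows "valid (e + f)"
proof -
  obtain b m n where "e * of_nat q ^ b = of_nat m" "f * of_nat q ^ b = of_nat n"
    using valid_common[OF assms] .
  then have "(e + f) * of_nat q ^ b = of_nat (m + n)" by (simp add: algebra_simps)
  then show ?thesis unfolding valid_def by blast
qed

lemma valid_nonneg: assumes "valid e" shows "e \<ge> 0"
proof -
  obtain b n where "e * of_nat q ^ b = of_nat n" using assms by (auto simp: valid_def)
  then have "e * of_nat q ^ b \<ge> 0" by simp
  moreover have "(of_nat q :: rat) ^ b > 0" using q_ge by simp
  ultimately show ?thesis using mult_neg_pos by (metis not_le)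
qed

lemma valid_mult_q: "valid e \<Longrightarrow> valid (e * of_nat q)"
  unfolding valid_def by (metis mult.assoc mult.commute of_nat_mult)

lemma valid_div_q: assumes "valid e" shows "valid (e / of_nat q)"
proof -
  obtain b n where "e * of_nat q ^ b = of_nat n" using assms by (auto simp: valid_def)
  then have "e / of_nat q * of_nat q ^ Suc b = of_nat n" using q by simp
  then show ?thesis unfolding valid_def by blast
qed

definition scales :: "rat set" where "scales = {of_nat q, 1 / of_nat q}"

lemma valid_scale: "c \<in> scales \<Longrightarrow> valid e \<Longrightarrow> valid (e * c)"
  using valid_mult_q valid_div_q by (auto simp: scales_def)

lemma scale_nonzero: "c \<in> scales \<Longrightarrow> c \<noteq> 0" using q_ge by (auto simp: scales_def)

text \<open>A key \<open>(i, Some e)\<close> stands for the monomial \<open>t^e\<close> in coordinate \<open>i\<close>, and \<open>(i, None)\<close> for a basis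
  vector of the quotient \<open>t = 0\<close>. Keys with an exponent outside \<open>Z[1/q]\<close> or negative belong to the type
  but are fixed by all the maps below.\<close>

fun valid_key :: "key \<Rightarrow> bool" where
  "valid_key (i, None) = True"
| "valid_key (i, Some e) = valid e"

text \<open>The matrix unit E_ij times 1 - t on monomials, and times 1, the value of 1 - t at t = 0,
  on the integral part.\<close>

fun nilp :: "Enum.finite_3 \<Rightarrow> Enum.finite_3 \<Rightarrow> key \<Rightarrow> vect" where
  "nilp i j (l, None) = (if l = j then frag_of (i, None) else 0)"
| "nilp i j (l, Some e) = (if l = j \<and> valid e then frag_of (i, Some e) - frag_of (i, Some (e + 1)) else 0)"

definition transv :: "int \<Rightarrow> Enum.finite_3 \<Rightarrow> Enum.finite_3 \<Rightarrow> vect \<Rightarrow> vect" where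
  "transv c i j v = v + frag_cmul c (frag_extend (nilp i j) v)"

fun scale_key :: "rat \<Rightarrow> key \<Rightarrow> key" where
  "scale_key c (l, None) = (l, None)"
| "scale_key c (l, Some e) = (l, Some (if valid e then e * c else e))"

definition scale :: "rat \<Rightarrow> vect \<Rightarrow> vect" where
  "scale c v = frag_extend (\<lambda>k. frag_of (scale_key c k)) v"

lemma transv_diff: "transv c i j (v - w) = transv c i j v - transv c i j w"
  by (simp add: transv_def frag_extend_diff frag_cmul_diff)

lemma scale_diff: "scale c (v - w) = scale c v - scale c w"
  by (simp add: scale_def frag_extend_diff)

lemma nilp_square: "i \<noteq> j \<Longrightarrow> frag_extend (nilp i j) (nilp i j k) = 0"
  by (cases k rule: valid_key.cases) (auto simp: frag_extend_diff)

lemma transv_inverse: "i \<noteq> j \<Longrightarrow> transv c i j (transv (- c) i j v) = v"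
  by (simp add: transv_def frag_extend_add frag_extend_cmul frag_extend_frag_extend nilp_square
      frag_extend_eq_0 frag_extend_diff frag_cmul_diff flip: frag_cmul_distrib)

lemma scale_inverse:
  assumes "c \<in> scales" shows "scale (1 / c) (scale c v) = v"
proof (rule additive_map_eqI[where S = UNIV and g = "\<lambda>v. v"])
  fix k
  show "scale (1 / c) (scale c (frag_of k)) = frag_of k"
    using assms valid_scale scale_nonzero by (cases k rule: valid_key.cases) (auto simp: scale_def)
qed (simp_all add: scale_diff)

section \<open>The acting group and its invariant submodules\<close>

inductive_set gens where
  transv: "i \<noteq> j \<Longrightarrow> c \<in> {1, -1} \<Longrightarrow> transv c i j \<in> gens"
| scale: "c \<in> scales \<Longrightarrow> scale c \<in> gens"

text \<open>A monoid of words is already a group here, because \<open>gens\<close> is closed under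
  inverses.\<close>

inductive_set acting where
  id: "id \<in> acting"
| gen: "s \<in> gens \<Longrightarrow> g \<in> acting \<Longrightarrow> s \<circ> g \<in> acting"

lemma finite_gens: "finite gens"
proof -
  have "s \<in> (\<lambda>(c, i, j). transv c i j) ` ({1, -1} \<times> UNIV \<times> UNIV) \<union> scale ` scales" if "s \<in> gens" for s
    using that
  proof cases
    case (transv i j c)
    then have "(c, i, j) \<in> {1, -1} \<times> UNIV \<times> UNIV" by simp
    then show ?thesis using transv by (intro UnI1 image_eqI[of _ _ "(c, i, j)"]) auto
  qed simp
  then have "gens \<subseteq> (\<lambda>(c, i, j). transv c i j) ` ({1, -1} \<times> UNIV \<times> UNIV) \<union> scale ` scales" by blast
  then show ?thesis by (rule finite_subset) (simp add: scales_def)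
qed

lemma gens_acting: "s \<in> gens \<Longrightarrow> s \<in> acting" using acting.gen[OF _ acting.id] by simp

lemma acting_comp: "g \<in> acting \<Longrightarrow> h \<in> acting \<Longrightarrow> g \<circ> h \<in> acting"
  by (induction rule: acting.induct) (simp_all add: acting.gen comp_assoc)

lemma gens_diff: "s \<in> gens \<Longrightarrow> s (v - w) = s v - s w"
  by (auto elim!: gens.cases simp: transv_diff scale_diff)

lemma acting_diff: "g \<in> acting \<Longrightarrow> g (v - w) = g v - g w"
  by (induction rule: acting.induct) (simp_all add: gens_diff)

lemma gens_inverse: "s \<in> gens \<Longrightarrow> \<exists>t \<in> gens. s \<circ> t = id \<and> t \<circ> s = id"
proof (induction rule: gens.induct)
  case (transv i j c)
  then have "transv (- c) i j \<in> gens" by (auto intro: gens.transv)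
  then show ?case using transv_inverse[OF transv(1), of c] transv_inverse[OF transv(1), of "- c"]
    by (intro bexI[of _ "transv (- c) i j"]) (auto simp: fun_eq_iff)
next
  case (scale c)
  then have c: "1 / c \<in> scales" by (auto simp: scales_def)
  then show ?case using scale_inverse[OF scale] scale_inverse[OF c]
    by (intro bexI[of _ "scale (1 / c)"] gens.scale) (auto simp: fun_eq_iff)
qed

lemma acting_inverse: "g \<in> acting \<Longrightarrow> \<exists>h \<in> acting. g \<circ> h = id \<and> h \<circ> g = id"
proof (induction rule: acting.induct)
  case (gen s g)
  then obtain h t where h: "h \<in> acting" "g \<circ> h = id" "h \<circ> g = id" and t: "t \<in> gens" "s \<circ> t = id" "t \<circ> s = id"
    using gens_inverse by blast
  have "(s \<circ> g) \<circ> (h \<circ> t) = id" "(h \<circ> t) \<circ> (s \<circ> g) = id"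
    using h t by (simp_all add: fun_eq_iff)
  then show ?case using h t acting_comp gens_acting by blast
next
  case id
  show ?case by (rule bexI[OF _ acting.id]) simp
qed

definition ambient :: "vect set" where "ambient = {v. \<forall>k \<in> Poly_Mapping.keys v. valid_key k}"

lemma ambient_diff: "v \<in> ambient \<Longrightarrow> w \<in> ambient \<Longrightarrow> v - w \<in> ambient"
  unfolding ambient_def using keys_diff[of v w] by blast

lemma ambient_0: "0 \<in> ambient" by (simp add: ambient_def)

lemma ambient_frag_of [simp]: "frag_of k \<in> ambient \<longleftrightarrow> valid_key k"
  by (simp add: ambient_def)

lemma ambient_add: "v \<in> ambient \<Longrightarrow> w \<in> ambient \<Longrightarrow> v + w \<in> ambient"
  using ambient_diff[of v "0 - w"] ambient_diff[of 0 w] ambient_0 by simp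

lemma ambient_cmul: "v \<in> ambient \<Longrightarrow> frag_cmul c v \<in> ambient"
  using cmul_closed ambient_0 ambient_diff by blast

lemma ambient_induct [consumes 1, case_names zero key diff]:
  assumes "v \<in> ambient" "P 0" "\<And>k. valid_key k \<Longrightarrow> P (frag_of k)"
    "\<And>v w. v \<in> ambient \<Longrightarrow> w \<in> ambient \<Longrightarrow> P v \<Longrightarrow> P w \<Longrightarrow> P (v - w)"
  shows "P v"
proof -
  have "v \<in> ambient \<and> P v"
  proof (rule frag_induction[of v "{k. valid_key k}"])
    show "Poly_Mapping.keys v \<subseteq> {k. valid_key k}" using assms(1) by (auto simp only: ambient_def)
    show "0 \<in> ambient \<and> P 0" using ambient_0 assms(2) by blast
    show "frag_of k \<in> ambient \<and> P (frag_of k)" if "k \<in> {k. valid_key k}" for k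
      using that assms(3) by simp
    show "v - w \<in> ambient \<and> P (v - w)" if "v \<in> ambient \<and> P v" "w \<in> ambient \<and> P w" for v w
      using that assms(4) ambient_diff by blast
  qed
  then show ?thesis by blast
qed

lemma nilp_ambient: "valid_key k \<Longrightarrow> nilp i j k \<in> ambient"
  by (cases k rule: valid_key.cases) (simp_all add: ambient_0 ambient_diff)

lemma valid_scale_key: "c \<in> scales \<Longrightarrow> valid_key k \<Longrightarrow> valid_key (scale_key c k)"
  by (cases k rule: valid_key.cases) (simp_all add: valid_scale)

lemma gens_ambient: assumes s: "s \<in> gens" and v: "v \<in> ambient" shows "s v \<in> ambient"
  using v
proof (induction rule: ambient_induct)
  case zero
  then show ?case using gens_diff[OF s, of 0 0] ambient_0 by simp
next
  case (key k)
  from s show ?case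
  proof cases
    case (transv i j c)
    then show ?thesis using key by (simp add: transv_def ambient_add ambient_cmul nilp_ambient)
  next
    case (scale c)
    then show ?thesis using key by (simp add: scale_def valid_scale_key)
  qed
next
  case (diff v w)
  then show ?case by (simp add: gens_diff[OF s] ambient_diff)
qed

text \<open>Exponents are nonnegative, so multiplication by t never reaches the constant term;
  constant terms therefore transform by the matrix at t = 0, exactly as the integral part
  does.\<close>

lemma lookup_nilp:
  "Poly_Mapping.lookup (frag_extend (nilp i j) v) (l, Some 0) = (if l = i then Poly_Mapping.lookup v (j, Some 0) else 0)" (is "?f v = ?g v")
  "Poly_Mapping.lookup (frag_extend (nilp i j) v) (l, None) = (if l = i then Poly_Mapping.lookup v (j, None) else 0)" (is "?f' v = ?g' v")
proof -
  have e: "0 \<noteq> e + 1" if "valid e" for e using valid_nonneg[OF that] by linarith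
  show "?f v = ?g v"
  proof (rule additive_map_eqI[where f = ?f and g = ?g and S = UNIV])
    show "?f (frag_of k) = ?g (frag_of k)" for k
      using e by (cases k rule: valid_key.cases) (auto simp: lookup_minus)
  qed (simp_all add: frag_extend_diff lookup_minus)
  show "?f' v = ?g' v"
  proof (rule additive_map_eqI[where f = ?f' and g = ?g' and S = UNIV])
    show "?f' (frag_of k) = ?g' (frag_of k)" for k
      by (cases k rule: valid_key.cases) (auto simp: lookup_minus)
  qed (simp_all add: frag_extend_diff lookup_minus)
qed

lemma lookup_scale:
  assumes "c \<in> scales"
  shows "Poly_Mapping.lookup (scale c v) (l, Some 0) = Poly_Mapping.lookup v (l, Some 0)" (is "?f v = ?g v")
    and "Poly_Mapping.lookup (scale c v) (l, None) = Poly_Mapping.lookup v (l, None)" (is "?f' v = ?g' v")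
proof -
  show "?f v = ?g v"
  proof (rule additive_map_eqI[where f = ?f and g = ?g and S = UNIV])
    show "?f (frag_of k) = ?g (frag_of k)" for k
      using scale_nonzero[OF assms] by (cases k rule: valid_key.cases) (auto simp: scale_def)
  qed (simp_all add: scale_diff lookup_minus)
  show "?f' v = ?g' v"
  proof (rule additive_map_eqI[where f = ?f' and g = ?g' and S = UNIV])
    show "?f' (frag_of k) = ?g' (frag_of k)" for k
      by (cases k rule: valid_key.cases) (auto simp: scale_def)
  qed (simp_all add: scale_diff lookup_minus)
qed

lemma lookup_transv:
  "Poly_Mapping.lookup (transv c i j v) (l, Some 0) = Poly_Mapping.lookup v (l, Some 0) + (if l = i then c * Poly_Mapping.lookup v (j, Some 0) else 0)"
  "Poly_Mapping.lookup (transv c i j v) (l, None) = Poly_Mapping.lookup v (l, None) + (if l = i then c * Poly_Mapping.lookup v (j, None) else 0)"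
  by (simp_all add: transv_def lookup_add lookup_nilp)

text \<open>For c = 1 this is the graph of evaluation at t = 0, a copy of A^3; for c = 0 it is I^3 x
  Z^3.\<close>

definition submod :: "int \<Rightarrow> vect set" where
  "submod c = {v \<in> ambient. \<forall>i. Poly_Mapping.lookup v (i, Some 0) = c * Poly_Mapping.lookup v (i, None)}"

text \<open>Constant terms and integral part undergo the same transformation, so a linear relation
  between them persists.\<close>

lemma gens_submod: assumes s: "s \<in> gens" and v: "v \<in> submod c" shows "s v \<in> submod c"
  using s
proof cases
  case (transv i j d)
  then show ?thesis using gens_ambient[OF s] v by (auto simp: submod_def lookup_transv algebra_simps)
next
  case (scale d)
  then show ?thesis using gens_ambient[OF s] v by (auto simp: submod_def lookup_scale)
qed

lemma acting_ambient: "g \<in> acting \<Longrightarrow> v \<in> ambient \<Longrightarrow> g v \<in> ambient"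
  by (induction arbitrary: v rule: acting.induct) (simp_all add: gens_ambient)

lemma acting_submod: "g \<in> acting \<Longrightarrow> v \<in> submod c \<Longrightarrow> g v \<in> submod c"
  by (induction arbitrary: v rule: acting.induct) (simp_all add: gens_submod)

lemma affine_ambient: "affine_action ambient acting"
  by unfold_locales
    (simp_all add: ambient_0 ambient_diff acting.id acting_comp acting_inverse acting_diff acting_ambient)

lemma affine_submod: "affine_action (submod c) acting"
  by unfold_locales
    (simp_all add: acting.id acting_comp acting_inverse acting_diff acting_submod,
     simp_all add: submod_def ambient_0 ambient_diff lookup_minus algebra_simps)

lemma acting_funpow: "g \<in> acting \<Longrightarrow> g ^^ n \<in> acting"
  using affine_action.funpow_closed[OF affine_ambient] by blast

lemma scale_acting: "c \<in> scales \<Longrightarrow> scale c \<in> acting" by (simp add: gens_acting gens.scale)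

lemma scales: "of_nat q \<in> scales" "1 / of_nat q \<in> scales" by (simp_all add: scales_def)

lemma scale_power:
  "c \<in> scales \<Longrightarrow> valid e \<Longrightarrow>
    valid (e * c ^ n) \<and> (scale c ^^ n) (frag_of (l, Some e)) = frag_of (l, Some (e * c ^ n))"
proof (induction n)
  case (Suc n)
  then have "valid (e * c ^ n * c)" using valid_scale by blast
  then show ?case using Suc by (simp add: scale_def mult.assoc mult.commute[of c])
qed simp

text \<open>Conjugating a transvection by a power of the scaling makes the shift of exponents small.\<close>

definition small_transv where
  "small_transv n i j = (scale (1 / of_nat q) ^^ n) \<circ> transv 1 i j \<circ> (scale (of_nat q) ^^ n)"

lemma small_transv_acting: "i \<noteq> j \<Longrightarrow> small_transv n i j \<in> acting"
  unfolding small_transv_def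
  by (intro acting_comp acting_funpow scale_acting scales gens_acting gens.transv) simp_all

lemma valid_small [simp]: "valid (1 / of_nat q ^ n)"
  using scale_power[OF scales(2) valid_1, of n] by (simp add: power_one_over)

lemma small_transv_frag_of:
  assumes ij: "i \<noteq> j" and e: "valid e"
  shows "small_transv n i j (frag_of (j, Some e)) =
    frag_of (j, Some e) + frag_of (i, Some e) - frag_of (i, Some (e + 1 / of_nat q ^ n))"
proof -
  have q0: "(of_nat q :: rat) \<noteq> 0" using q_ge by simp
  have down: "(scale (1 / of_nat q) ^^ n) (frag_of (l, Some f)) = frag_of (l, Some (f / of_nat q ^ n))"
    if "valid f" for l f
    using scale_power[OF scales(2) that, of n] by (simp add: power_one_over)
  have v: "valid (e * of_nat q ^ n)" using scale_power[OF scales(1) e] by blast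
  have "transv 1 i j ((scale (of_nat q) ^^ n) (frag_of (j, Some e))) =
    frag_of (j, Some (e * of_nat q ^ n)) + (frag_of (i, Some (e * of_nat q ^ n)) - frag_of (i, Some (e * of_nat q ^ n + 1)))"
    using scale_power[OF scales(1) e, of n] by (simp add: transv_def)
  then have "small_transv n i j (frag_of (j, Some e)) = (scale (1 / of_nat q) ^^ n)
    (frag_of (j, Some (e * of_nat q ^ n)) + (frag_of (i, Some (e * of_nat q ^ n)) - frag_of (i, Some (e * of_nat q ^ n + 1))))"
    by (simp add: small_transv_def)
  also have "\<dots> = frag_of (j, Some e) + frag_of (i, Some e) - frag_of (i, Some (e + 1 / of_nat q ^ n))"
    using down[of "e * of_nat q ^ n"] down[of "e * of_nat q ^ n + 1"] v q0
      acting_diff[OF acting_funpow[OF scale_acting[OF scales(2)]]] affine_action.map_add[OF affine_ambient acting_funpow[OF scale_acting[OF scales(2)]]]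
    by (simp add: add_divide_distrib)
  finally show ?thesis .
qed

text \<open>A stable subgroup need not be a module over the ring, but a small transvection simulates
  multiplication by t^d with d = 1/q^n: t^d v_i = v_i + v_j - g v_j, where v_i is v placed in
  coordinate i. Having the hypothesis in all coordinates, one moves the exponent in steps of d. The
  case b = 0 shifts single monomials, the case b = 1 congruences between two of them.\<close>

lemma shift_exponent:
  assumes W: "0 \<in> W" "\<And>v w. v \<in> W \<Longrightarrow> w \<in> W \<Longrightarrow> v - w \<in> W" "\<And>g v. g \<in> acting \<Longrightarrow> v \<in> W \<Longrightarrow> g v \<in> W"
    and e: "valid e" "valid e'" and f: "valid f"
    and mem: "\<And>j. frag_of (j, Some e') - frag_cmul b (frag_of (j, Some e)) \<in> W"
  shows "frag_of (i, Some (e' + f)) - frag_cmul b (frag_of (i, Some (e + f))) \<in> W"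
proof -
  have add: "v + w \<in> W" if "v \<in> W" "w \<in> W" for v w
    using W(2)[OF that(1) W(2)[OF W(1) that(2)]] by simp
  obtain n m where f': "f * of_nat q ^ n = of_nat m" using f by (auto simp: valid_def)
  let ?d = "1 / of_nat q ^ n :: rat"
  let ?D = "\<lambda>m i. frag_of (i, Some (e' + of_nat m * ?d)) - frag_cmul b (frag_of (i, Some (e + of_nat m * ?d)))"
  have D: "?D m i \<in> W" for m i
  proof (induction m arbitrary: i)
    case (Suc m)
    obtain j where j: "i \<noteq> j" using third_index[of i i] by metis
    have md: "valid (of_nat m * ?d)"
      unfolding valid_def using q_ge by (intro exI[of _ n] exI[of _ m]) simp
    have v: "valid (e + of_nat m * ?d)" "valid (e' + of_nat m * ?d)" using e md valid_add by blast+
    have cm: "small_transv n i j (frag_cmul b v) = frag_cmul b (small_transv n i j v)" for v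
      using acting_diff[OF small_transv_acting[OF j]] by (rule additive_frag_cmul)
    let ?x = "e + of_nat m * ?d" and ?y = "e' + of_nat m * ?d"
    have "small_transv n i j (?D m j) = (frag_of (j, Some ?y) + frag_of (i, Some ?y) - frag_of (i, Some (?y + ?d)))
        - frag_cmul b (frag_of (j, Some ?x) + frag_of (i, Some ?x) - frag_of (i, Some (?x + ?d)))"
      by (simp only: acting_diff[OF small_transv_acting[OF j]] cm small_transv_frag_of[OF j v(1)] small_transv_frag_of[OF j v(2)])
    moreover have "of_nat (Suc m) * ?d = of_nat m * ?d + ?d" by (simp add: distrib_right add_divide_distrib)
    ultimately have "?D m j + ?D m i - small_transv n i j (?D m j) = ?D (Suc m) i"
      by (simp only: frag_cmul_diff frag_cmul_distrib2 add.assoc[symmetric]) simp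
    moreover have "?D m j + ?D m i \<in> W"
      using add[OF Suc[of j] Suc[of i]] .
    ultimately show ?case using W(2)[OF _ W(3)[OF small_transv_acting[OF j] Suc[of j]]] by metis
  qed (use mem in simp)
  have "f = of_nat m * ?d" using f' q_ge by (simp add: field_simps)
  then show ?thesis using D[of i m] by simp
qed

text \<open>The monomial with e = m / q^n arises from t by scaling to t^(1/q^n), followed by a shift
  by (m - 1)/q^n. With b = 0 the second monomial in \<open>shift_exponent\<close> is only a
  placeholder.\<close>

lemma positive_exponents:
  assumes W: "0 \<in> W" "\<And>v w. v \<in> W \<Longrightarrow> w \<in> W \<Longrightarrow> v - w \<in> W" "\<And>g v. g \<in> acting \<Longrightarrow> v \<in> W \<Longrightarrow> g v \<in> W"
    and mem: "\<And>j. frag_of (j, Some 1) \<in> W" and e: "valid e" "e > 0"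
  shows "frag_of (i, Some e) \<in> W"
proof -
  obtain n m where m: "e * of_nat q ^ n = of_nat m" using e by (auto simp: valid_def)
  then have m0: "m > 0" using e q_ge by (metis bot_nat_0.not_eq_extremum mult_eq_0_iff of_nat_0 of_nat_0_eq_iff
    less_irrefl not_numeral_le_zero power_not_zero)
  let ?d = "1 / of_nat q ^ n :: rat"
  have d: "frag_of (j, Some ?d) \<in> W" for j
    using W(3)[OF acting_funpow[OF scale_acting[OF scales(2)]] mem[of j], of n]
      scale_power[OF scales(2) valid_1, of n j] by (simp add: power_one_over)
  have v: "valid (of_nat (m - 1) * ?d)"
    unfolding valid_def using q_ge by (intro exI[of _ n] exI[of _ "m - 1"]) simp
  have "frag_of (i, Some (?d + of_nat (m - 1) * ?d)) - frag_cmul 0 (frag_of (i, Some (?d + of_nat (m - 1) * ?d))) \<in> W"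
  proof (rule shift_exponent[where W = W])
    show "g v \<in> W" if "g \<in> acting" "v \<in> W" for g v using W(3) that .
  qed (use W(1,2) d v in simp_all)
  moreover have "?d + of_nat (m - 1) * ?d = e"
    using m m0 q_ge by (simp add: field_simps of_nat_diff)
  ultimately show ?thesis by simp
qed

lemma submod_diff: "v \<in> submod c \<Longrightarrow> w \<in> submod c \<Longrightarrow> v - w \<in> submod c"
  using affine_action.diff[OF affine_submod] .

lemma submod_0: "0 \<in> submod c" using affine_action.zero[OF affine_submod] .

definition diag :: "int \<Rightarrow> Enum.finite_3 \<Rightarrow> vect" where
  "diag c i = frag_of (i, None) + frag_cmul c (frag_of (i, Some 0))"

lemma diag_submod: "diag c i \<in> submod c"
  by (simp add: submod_def diag_def ambient_add ambient_cmul lookup_add)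

lemma positive_submod: "valid e \<Longrightarrow> e > 0 \<Longrightarrow> frag_of (i, Some e) \<in> submod c"
  by (simp add: submod_def)

text \<open>Subtracting the combination of the \<open>diag c j\<close> with the same integral part
  leaves a vector without integral part, hence without constant term; only positive exponents
  remain.\<close>

lemma submod_generated:
  assumes W: "0 \<in> W" "\<And>v w. v \<in> W \<Longrightarrow> w \<in> W \<Longrightarrow> v - w \<in> W" "\<And>g v. g \<in> acting \<Longrightarrow> v \<in> W \<Longrightarrow> g v \<in> W"
    and mem: "\<And>j. frag_of (j, Some 1) \<in> W" and diag: "\<And>j. diag c j \<in> W"
  shows "submod c \<subseteq> W"
proof
  fix v assume v: "v \<in> submod c"
  define s where "s = (\<Sum>i\<in>UNIV. frag_cmul (Poly_Mapping.lookup v (i, None)) (diag c i))"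
  have sW: "s \<in> W" unfolding s_def using W diag by (intro diff_closed_sum cmul_closed) auto
  have ss: "s \<in> submod c" unfolding s_def
    by (intro diff_closed_sum cmul_closed) (auto simp: submod_0 submod_diff diag_submod)
  have l: "Poly_Mapping.lookup s (l, None) = Poly_Mapping.lookup v (l, None)" for l
  proof -
    have "Poly_Mapping.lookup s (l, None) = (\<Sum>i\<in>UNIV. if l = i then Poly_Mapping.lookup v (i, None) else 0)"
      unfolding s_def lookup_sum by (intro sum.cong) (auto simp: diag_def lookup_add)
    then show ?thesis by simp
  qed
  have vs: "v - s \<in> submod c" using submod_diff v ss by blast
  have "v - s \<in> W"
  proof (rule frag_induction[of "v - s" "{(i, Some e) | i e. valid e \<and> e > 0}" "\<lambda>v. v \<in> W"])
    show "Poly_Mapping.keys (v - s) \<subseteq> {(i, Some e) | i e. valid e \<and> e > 0}"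
    proof
      fix k assume k: "k \<in> Poly_Mapping.keys (v - s)"
      then have vk: "valid_key k" using vs by (auto simp only: submod_def ambient_def)
      have N: "Poly_Mapping.lookup (v - s) (i, None) = 0" for i using l by (simp add: lookup_minus)
      then have "Poly_Mapping.lookup (v - s) (i, Some 0) = 0" for i using vs by (simp add: submod_def)
      then show "k \<in> {(i, Some e) | i e. valid e \<and> e > 0}"
        using k vk N valid_nonneg
        by (cases k rule: valid_key.cases) (auto simp: in_keys_iff order_less_le)
    qed
    show "frag_of k \<in> W" if k: "k \<in> {(i, Some e) | i e. valid e \<and> e > 0}" for k
    proof -
      obtain i e where k: "k = (i, Some e)" "valid e" "e > 0" using k by blast
      show ?thesis unfolding k(1)
      proof (rule positive_exponents[where W = W])
        show "g v \<in> W" if "g \<in> acting" "v \<in> W" for g v using W(3) that .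
      qed (use W(1,2) mem k in simp_all)
    qed
  qed (use W in auto)
  then have "(v - s) - (0 - s) \<in> W" using W sW by blast
  then show "v \<in> W" by simp
qed

lemma finitely_generated_submod: "finitely_generated (affine_group (submod c) acting)"
proof -
  interpret affine_action "submod c" acting by (rule affine_submod)
  interpret G: group "affine_group (submod c) acting" by (rule group)
  define S where "S = {0} \<times> gens \<union> (\<lambda>j. (diag c j, id)) ` UNIV \<union> (\<lambda>j. (frag_of (j, Some 1), id)) ` UNIV"
  have fin: "finite S" unfolding S_def using finite_gens by simp
  have sub: "S \<subseteq> submod c \<times> acting"
    unfolding S_def using zero gens_acting acting.id diag_submod positive_submod by auto
  have "generate (affine_group (submod c) acting) S = submod c \<times> acting"
  proof (rule generate_affine[OF sub])
    fix H assume H: "subgroup H (affine_group (submod c) acting)" and SH: "S \<subseteq> H"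
    have "(0, g) \<in> H" if "g \<in> acting" for g
      using that
    proof induction
      case id
      show ?case using subgroup.one_closed[OF H] unfolding affine_group_simps .
    next
      case (gen s g)
      have "(0, s) \<in> H" using gen(1) SH by (auto simp: S_def)
      then have "(0, s) \<otimes>\<^bsub>affine_group (submod c) acting\<^esub> (0, g) \<in> H"
        using gen(3) subgroup.m_closed[OF H] by blast
      then show ?case using map_zero[OF gens_acting[OF gen(1)]] by (simp add: comp_def)
    qed
    then show "{0} \<times> acting \<subseteq> H" by blast
  next
    fix W assume "{v. (v, id) \<in> S} \<subseteq> W" and W: "0 \<in> W" "\<And>v w. v \<in> W \<Longrightarrow> w \<in> W \<Longrightarrow> v - w \<in> W"
      "\<And>g v. g \<in> acting \<Longrightarrow> v \<in> W \<Longrightarrow> g v \<in> W"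
    then have "\<And>j. frag_of (j, Some 1) \<in> W" "\<And>j. diag c j \<in> W" by (auto simp: S_def)
    show "submod c \<subseteq> W"
    proof (rule submod_generated)
      show "g v \<in> W" if "g \<in> acting" "v \<in> W" for g v using W(3) that .
    qed (use W(1,2) \<open>\<And>j. frag_of (j, Some 1) \<in> W\<close> \<open>\<And>j. diag c j \<in> W\<close> in simp_all)
  qed
  then show ?thesis using fin sub unfolding finitely_generated_def by (auto intro!: exI[of _ S])
qed

section \<open>Faithfulness of the action\<close>

lemma acting_invalid: "g \<in> acting \<Longrightarrow> \<not> valid_key k \<Longrightarrow> g (frag_of k) = frag_of k"
proof (induction rule: acting.induct)
  case (gen s g)
  have "s (frag_of k) = frag_of k"
    using gen(1)
  proof cases
    case (transv i j c)
    then show ?thesis using gen(4) by (cases k rule: valid_key.cases) (auto simp: transv_def)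
  next
    case (scale c)
    then show ?thesis using gen(4) by (cases k rule: valid_key.cases) (auto simp: scale_def)
  qed
  then show ?case using gen by simp
qed simp

text \<open>The action respects the splitting into monomials and integral part; \<open>b\<close>
  selects the summand.\<close>

lemma acting_key_kind:
  assumes "g \<in> acting" "\<forall>k \<in> Poly_Mapping.keys v. (snd k = None) = b"
  shows "\<forall>k \<in> Poly_Mapping.keys (g v). (snd k = None) = b"
  using assms
proof (induction arbitrary: v rule: acting.induct)
  case (gen s g)
  let ?w = "g v"
  have w: "\<forall>k \<in> Poly_Mapping.keys ?w. (snd k = None) = b" using gen by blast
  have "\<forall>k \<in> Poly_Mapping.keys (s ?w). (snd k = None) = b"
    using gen(1)
  proof cases
    case (transv i j c)
    have n: "(snd k' = None) = (snd k = None)" if "k' \<in> Poly_Mapping.keys (nilp i j k)" for k k'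
    proof (cases k rule: valid_key.cases)
      case (2 l e)
      then show ?thesis
        using that keys_diff[of "frag_of (i, Some e)" "frag_of (i, Some (e + 1))"]
        by (auto split: if_splits)
    qed (use that in \<open>auto split: if_splits\<close>)
    have "Poly_Mapping.keys (s ?w) \<subseteq> Poly_Mapping.keys ?w \<union> (\<Union>k \<in> Poly_Mapping.keys ?w. Poly_Mapping.keys (nilp i j k))"
      unfolding transv(1) transv_def
      using keys_add[of ?w] keys_cmul[of c "frag_extend (nilp i j) ?w"] keys_frag_extend[of "nilp i j" ?w] by blast
    then have "k' \<in> Poly_Mapping.keys ?w \<or> (\<exists>k \<in> Poly_Mapping.keys ?w. k' \<in> Poly_Mapping.keys (nilp i j k))"
      if "k' \<in> Poly_Mapping.keys (s ?w)" for k' using that by blast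
    then show ?thesis using w n by metis
  next
    case (scale c)
    have n: "(snd (scale_key c k) = None) = (snd k = None)" for k
      by (cases k rule: valid_key.cases) auto
    have "Poly_Mapping.keys (s ?w) \<subseteq> scale_key c ` Poly_Mapping.keys ?w"
      unfolding scale(1) scale_def using keys_frag_extend[of "\<lambda>k. frag_of (scale_key c k)" ?w] by auto
    then have "\<exists>k \<in> Poly_Mapping.keys ?w. k' = scale_key c k" if "k' \<in> Poly_Mapping.keys (s ?w)" for k'
      using that by blast
    then show ?thesis using w n by metis
  qed
  then show ?case by simp
qed simp

text \<open>Equality in \<open>acting\<close> is equality of functions on the whole type; because
  invalid keys are fixed, it can be tested on \<open>ambient\<close>.\<close>

lemma acting_eq_idI:
  assumes g: "g \<in> acting" and fix_valid: "\<And>k. valid_key k \<Longrightarrow> g (frag_of k) = frag_of k"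
  shows "g = id"
proof
  fix v show "g v = id v"
  proof (rule additive_map_eqI[where f = g and g = id and S = UNIV])
    show "g (frag_of k) = id (frag_of k)" for k
      using acting_invalid[OF g] fix_valid by (cases "valid_key k") auto
  qed (simp_all add: acting_diff[OF g])
qed

lemma faithful_ambient: assumes "g \<in> acting" "g \<noteq> id" shows "\<exists>v \<in> ambient. g v \<noteq> v"
  using acting_eq_idI[OF assms(1)] assms(2) ambient_frag_of by metis

text \<open>The submodule contains only the sum of a constant and an integral basis vector. If that
  sum is fixed, the changes of the two summands are opposite, yet one is supported on monomials and
  the other on the integral part, so both vanish.\<close>

lemma faithful_submod:
  assumes g: "g \<in> acting" "g \<noteq> id" shows "\<exists>v \<in> submod 1. g v \<noteq> v"
proof (rule ccontr)
  assume "\<not> ?thesis"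
  then have fixed: "\<And>v. v \<in> submod 1 \<Longrightarrow> g v = v" by blast
  have 1: "g (frag_of (i, Some 0)) = frag_of (i, Some 0) \<and> g (frag_of (i, None)) = frag_of (i, None)" for i
  proof -
    let ?x = "g (frag_of (i, Some 0)) - frag_of (i, Some 0)"
    have "g (diag 1 i) = diag 1 i" using fixed diag_submod by blast
    then have "g (frag_of (i, None)) + g (frag_of (i, Some 0)) = frag_of (i, None) + frag_of (i, Some 0)"
      using affine_action.map_add[OF affine_ambient g(1)] by (simp add: diag_def)
    then have x: "?x = frag_of (i, None) - g (frag_of (i, None))" by (simp add: algebra_simps)
    have "\<forall>k \<in> Poly_Mapping.keys ?x. (snd k = None) = False"
      using keys_diff[of "g (frag_of (i, Some 0))" "frag_of (i, Some 0)"]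
        acting_key_kind[OF g(1), of "frag_of (i, Some 0)" False] by auto
    moreover have "\<forall>k \<in> Poly_Mapping.keys ?x. (snd k = None) = True"
      unfolding x using keys_diff[of "frag_of (i, None)" "g (frag_of (i, None))"]
        acting_key_kind[OF g(1), of "frag_of (i, None)" True] by auto
    ultimately have "Poly_Mapping.keys ?x = {}" by blast
    then have "?x = 0" by simp
    then show ?thesis using x by simp
  qed
  have "g (frag_of k) = frag_of k" if "valid_key k" for k
  proof (cases k rule: valid_key.cases)
    case (1 i)
    then show ?thesis using \<open>\<And>i. g (frag_of (i, Some 0)) = frag_of (i, Some 0) \<and> g (frag_of (i, None)) = frag_of (i, None)\<close> by simp
  next
    case (2 i e)
    then have e: "valid e" "e \<ge> 0" using that valid_nonneg by auto
    show ?thesis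
    proof (cases "e = 0")
      case True
      then show ?thesis using 1 2 by simp
    next
      case False
      then show ?thesis using 2 e fixed positive_submod by simp
    qed
  qed
  then have "g = id" by (rule acting_eq_idI[OF g(1)])
  then show False using g by simp
qed

text \<open>Elements acting as elementary matrices on the integral part survive in every term of the
  derived series of a quotient, being commutators of one another; so do the integral basis vectors,
  each a commutator of such an element with another basis vector.\<close>

lemma not_residually_solvable_submod: "\<not> residually_solvable (affine_group (submod 0) acting)"
proof
  let ?G = "affine_group (submod 0) acting"
  let ?b = "\<lambda>i. frag_of (i, None) :: vect"
  interpret affine_action "submod 0" acting by (rule affine_submod)
  interpret G: group ?G by (rule group)
  have b: "?b i \<in> submod 0" for i using diag_submod[of 0 i] by (simp add: diag_def)
  assume "residually_solvable ?G"
  moreover have "(?b finite_3.a\<^sub>1, id) \<in> carrier ?G" "\<one>\<^bsub>?G\<^esub> \<in> carrier ?G" "(?b finite_3.a\<^sub>1, id) \<noteq> \<one>\<^bsub>?G\<^esub>"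
    using b acting.id zero by auto
  ultimately obtain H :: "nat monoid" and h where H: "group H" "solvable H" and h: "h \<in> hom ?G H"
    and neq: "h (?b finite_3.a\<^sub>1, id) \<noteq> h \<one>\<^bsub>?G\<^esub>"
    unfolding residually_solvable_def residually_def by meson
  interpret h: group_hom ?G H h using H h by (simp add: group_hom_def group_hom_axioms_def G.is_group)
  define D where "D n = (derived H ^^ n) (carrier H)" for n
  have DS: "D (Suc n) = derived H (D n)" for n by (simp add: D_def)
  \<comment> \<open>Only the action on the integral part is prescribed: on monomials, iterated
    commutators acquire higher powers of 1 - t.\<close>
  define elem where "elem g i j \<longleftrightarrow> (\<forall>l. g (?b l) = ?b l + (if l = j then ?b i else 0))" for g i j
  have inv_elem: "inv_into UNIV g (?b l) = ?b l - (if l = j then ?b i else 0)"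
    if g: "g \<in> acting" "elem g i j" and ij: "i \<noteq> j" for g i j l
  proof -
    have "g (?b l - (if l = j then ?b i else 0)) = ?b l"
      using g ij acting_diff[OF g(1)] map_zero[OF g(1)] by (simp add: elem_def)
    then show ?thesis using inv_map[OF g(1)] by metis
  qed
  have ex: "\<exists>g \<in> acting. elem g i j \<and> h (0, g) \<in> D n" if "i \<noteq> j" for i j n
    using that
  proof (induction n arbitrary: i j)
    case 0
    have t: "transv 1 i j \<in> acting" using 0 by (simp add: gens_acting gens.transv)
    moreover have "elem (transv 1 i j) i j" by (simp add: elem_def transv_def)
    moreover have "h (0, transv 1 i j) \<in> D 0" using t zero h.hom_closed[of "(0, transv 1 i j)"] by (simp add: D_def)
    ultimately show ?case by blast
  next
    case (Suc n)
    \<comment> \<open>Here size 3 enters: [e_ik, e_kj] = e_ij requires an index different from both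
      i and j.\<close>
    obtain k where k: "k \<noteq> i" "k \<noteq> j" using third_index by blast
    obtain g1 where g1: "g1 \<in> acting" "elem g1 i k" "h (0, g1) \<in> D n" using Suc k by metis
    obtain g2 where g2: "g2 \<in> acting" "elem g2 k j" "h (0, g2) \<in> D n" using Suc k by metis
    let ?g = "g1 \<circ> g2 \<circ> inv_into UNIV g1 \<circ> inv_into UNIV g2"
    have g: "?g \<in> acting" using g1 g2 inv_map by (intro acting_comp) auto
    note dm = acting_diff[OF g1(1)] acting_diff[OF g2(1)] acting_diff[OF conjunct1[OF inv_map[OF g1(1)]]]
    have i1: "inv_into UNIV g1 (?b l) = ?b l - (if l = k then ?b i else 0)" for l
      using inv_elem[OF g1(1,2)] k by auto
    have i2: "inv_into UNIV g2 (?b l) = ?b l - (if l = j then ?b k else 0)" for l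
      using inv_elem[OF g2(1,2)] k by auto
    have e1: "g1 (?b l) = ?b l + (if l = k then ?b i else 0)"
      and e2: "g2 (?b l) = ?b l + (if l = j then ?b k else 0)" for l
      using g1 g2 by (simp_all add: elem_def)
    have z: "g1 0 = 0" "g2 0 = 0" "inv_into UNIV g1 0 = 0"
      using map_zero g1(1) g2(1) inv_map[OF g1(1)] by blast+
    have am: "g1 (v + w) = g1 v + g1 w" "g2 (v + w) = g2 v + g2 w" for v w
      using map_add g1 g2 by blast+
    have "elem ?g i j"
      unfolding elem_def using Suc.prems k by (auto simp: i2 dm i1 e1 e2 am z)
    moreover have "(0, ?g) = (0, g1) \<otimes>\<^bsub>?G\<^esub> (0, g2) \<otimes>\<^bsub>?G\<^esub> inv\<^bsub>?G\<^esub> (0, g1) \<otimes>\<^bsub>?G\<^esub> inv\<^bsub>?G\<^esub> (0, g2)"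
      using g1 g2 zero map_zero[OF conjunct1[OF inv_map[OF g2(1)]]] by (simp add: inv_affine z)
    then have "h (0, ?g) \<in> D (Suc n)"
      using commutator_hom_derived[OF h.group_hom_axioms, of "(0, g1)" "(0, g2)" "D n"] g1 g2 zero by (simp add: DS)
    ultimately show ?case using g by blast
  qed
  have bD: "h (?b i, id) \<in> D n" for i n
  proof (induction n arbitrary: i)
    case 0
    have "(?b i, id) \<in> carrier ?G" using b acting.id unfolding affine_group_simps by blast
    then have "h (?b i, id) \<in> carrier H" by (rule h.hom_closed)
    moreover have "D 0 = carrier H" by (simp add: D_def)
    ultimately show ?case by (simp only:)
  next
    case (Suc n)
    obtain j where j: "i \<noteq> j" using third_index[of i i] by metis
    obtain g where g: "g \<in> acting" "elem g i j" "h (0, g) \<in> D n" using ex[OF j] by blast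
    have eq: "(?b i, id) = (0, g) \<otimes>\<^bsub>?G\<^esub> (?b j, id) \<otimes>\<^bsub>?G\<^esub> inv\<^bsub>?G\<^esub> (0, g) \<otimes>\<^bsub>?G\<^esub> inv\<^bsub>?G\<^esub> (?b j, id)"
      using g by (simp add: commutator_translation[OF b g(1)] elem_def del: affine_group_simps(2))
    have "(0, g) \<in> carrier ?G" "(?b j, id) \<in> carrier ?G"
      using g zero b acting.id unfolding affine_group_simps by blast+
    then show ?case
      unfolding eq DS by (rule commutator_hom_derived[OF h.group_hom_axioms]) (fact g(3) Suc)+
  qed
  obtain n where "D n = {\<one>\<^bsub>H\<^esub>}"
    using group.solvable_iff_trivial_derived_seq[OF H(1)] H(2) unfolding D_def by blast
  then show False using bD[of "finite_3.a\<^sub>1" n] neq h.hom_one by simp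
qed

subsection \<open>Equality of the profinite completions\<close>

lemma valid_power_diff: "k \<le> q ^ n \<Longrightarrow> valid (of_nat q ^ n - of_nat k)"
  by (metis of_nat_diff of_nat_power valid_of_nat)

text \<open>In a finite quotient where \<open>t^(q^n) = t\<close>, the element \<open>t^(q^n - 1)\<close> behaves like the constant \<open>1\<close>.\<close>

definition const_diff :: "nat \<Rightarrow> Enum.finite_3 \<Rightarrow> vect" where
  "const_diff n i = frag_of (i, Some 0) - frag_of (i, Some (of_nat q ^ n - 1))"

definition offset :: "int \<Rightarrow> Enum.finite_3 \<Rightarrow> vect \<Rightarrow> int" where
  "offset c i v = Poly_Mapping.lookup v (i, Some 0) - c * Poly_Mapping.lookup v (i, None)"

text \<open>The excess constant term is moved onto t^(q^n - 1), and the integral part is left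
  alone.\<close>

definition retract :: "int \<Rightarrow> nat \<Rightarrow> vect \<Rightarrow> vect" where
  "retract c n v = v - (\<Sum>i\<in>UNIV. frag_cmul (offset c i v) (const_diff n i))"

lemma q_power: "n > 0 \<Longrightarrow> (of_nat q ^ n :: rat) \<ge> of_nat q" "n > 0 \<Longrightarrow> q ^ n \<ge> q"
proof -
  show 1: "n > 0 \<Longrightarrow> q ^ n \<ge> q" using q_ge by (simp add: self_le_power)
  then show "n > 0 \<Longrightarrow> (of_nat q ^ n :: rat) \<ge> of_nat q" by (metis of_nat_le_iff of_nat_power)
qed

lemma exponent_pos: "n > 0 \<Longrightarrow> (of_nat q ^ n - 1 :: rat) > 0" "n > 0 \<Longrightarrow> valid (of_nat q ^ n - 1)"
proof -
  assume n: "n > 0"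
  have "(of_nat q :: rat) \<ge> 3" using q_ge by (metis of_nat_le_iff of_nat_numeral)
  then show "(of_nat q ^ n - 1 :: rat) > 0" using q_power(1)[OF n] by linarith
  show "valid (of_nat q ^ n - 1)" using valid_power_diff[of 1 n] q_ge by (simp add: Suc_leI)
qed

lemma offset_diff: "offset c i (v - w) = offset c i v - offset c i w"
  by (simp add: offset_def lookup_minus algebra_simps)

lemma offset_const_diff: "n > 0 \<Longrightarrow> offset c i (const_diff n l) = (if i = l then 1 else 0)"
  using exponent_pos(1)[of n] by (auto simp: offset_def const_diff_def lookup_minus)

lemma const_diff_ambient: "n > 0 \<Longrightarrow> const_diff n i \<in> ambient"
  using exponent_pos(2)[of n] by (simp add: const_diff_def ambient_diff)

lemma retract_diff: "retract c n (v - w) = retract c n v - retract c n w"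
  by (simp add: retract_def offset_diff frag_cmul_diff_distrib sum_subtractf)

lemma submod_iff_offset: "v \<in> submod c \<longleftrightarrow> v \<in> ambient \<and> (\<forall>i. offset c i v = 0)"
  by (simp add: submod_def offset_def)

lemma retract_submod: "v \<in> submod c \<Longrightarrow> retract c n v = v"
  by (simp add: retract_def submod_iff_offset)

lemma retract_in_submod:
  assumes n: "n > 0" and v: "v \<in> ambient" shows "retract c n v \<in> submod c"
proof -
  let ?s = "\<Sum>i\<in>UNIV. frag_cmul (offset c i v) (const_diff n i)"
  have "?s \<in> ambient"
    using n by (intro diff_closed_sum cmul_closed) (auto simp: ambient_0 ambient_diff const_diff_ambient)
  moreover have "offset c l ?s = offset c l v" for l
  proof -
    have cm: "offset c l (frag_cmul a w) = a * offset c l w" for a w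
      by (simp add: offset_def algebra_simps)
    have "offset c l ?s = (\<Sum>i\<in>UNIV. offset c l (frag_cmul (offset c i v) (const_diff n i)))"
      by (rule additive_sum) (rule offset_diff)
    also have "\<dots> = (\<Sum>i\<in>UNIV. if l = i then offset c i v else 0)"
      by (intro sum.cong) (simp_all add: cm offset_const_diff[OF n])
    finally show ?thesis by simp
  qed
  ultimately show ?thesis using v by (simp add: submod_iff_offset retract_def offset_diff ambient_diff)
qed

lemma retract_const_diff: "n > 0 \<Longrightarrow> retract c n (const_diff n l) = 0"
proof -
  assume n: "n > 0"
  have "(\<Sum>i\<in>UNIV. frag_cmul (offset c i (const_diff n l)) (const_diff n i)) = (\<Sum>i\<in>UNIV. if i = l then const_diff n i else 0)"
    by (intro sum.cong) (simp_all add: offset_const_diff[OF n])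
  then show ?thesis by (simp add: retract_def)
qed

context
  fixes c :: int and M :: "(vect \<times> (vect \<Rightarrow> vect)) set" and n0 :: nat
  assumes M: "M \<in> finite_index_normals (affine_group (submod c) acting)" and n0: "n0 > 0"
    and period: "\<forall>m. n0 dvd m \<longrightarrow> (0, scale (of_nat q) ^^ m) \<in> M"
begin

interpretation affine_action "submod c" acting by (rule affine_submod)

abbreviation "K \<equiv> translation_part M"

lemma M_normal: "M \<lhd> affine_group (submod c) acting" using M by (simp add: finite_index_normals_def)

lemma K_zero: "0 \<in> K" using translation_part_zero[OF M_normal] .
lemma K_diff: "v \<in> K \<Longrightarrow> w \<in> K \<Longrightarrow> v - w \<in> K" using translation_part_diff[OF M_normal] .
lemma K_stable: "g \<in> acting \<Longrightarrow> v \<in> K \<Longrightarrow> g v \<in> K" using translation_part_stable[OF M_normal] .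
lemma K_uminus: "v \<in> K \<Longrightarrow> - v \<in> K" using K_diff[OF K_zero] by fastforce
lemma K_add: "v \<in> K \<Longrightarrow> w \<in> K \<Longrightarrow> v + w \<in> K" using K_diff[OF _ K_uminus] by fastforce

text \<open>Equality of t^x and t^y in every coordinate modulo the translations in
  \<open>M\<close>.\<close>

definition related where "related x y \<longleftrightarrow> (\<forall>i. frag_of (i, Some x) - frag_of (i, Some y) \<in> K)"

lemma related_trans: "related x y \<Longrightarrow> related y z \<Longrightarrow> related x z"
  unfolding related_def
proof
  fix i assume "\<forall>i. frag_of (i, Some x) - frag_of (i, Some y) \<in> K" "\<forall>i. frag_of (i, Some y) - frag_of (i, Some z) \<in> K"
  then have "(frag_of (i, Some x) - frag_of (i, Some y)) + (frag_of (i, Some y) - frag_of (i, Some z)) \<in> K"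
    using K_add by blast
  then show "frag_of (i, Some x) - frag_of (i, Some z) \<in> K" by simp
qed

text \<open>The commutator of a power of the substitution lying in \<open>M\<close> with the
  translation t^e gives the case f = 0, where e > 0 puts t^e into \<open>submod c\<close>;
  \<open>shift_exponent\<close> with b = 1 adds f.\<close>

lemma related_period:
  assumes n: "n0 dvd n" and e: "valid e" "e > 0" and f: "valid f"
  shows "related (e * of_nat q ^ n + f) (e + f)"
  unfolding related_def
proof
  fix i
  have e': "valid (e * of_nat q ^ n)" using scale_power[OF scales(1) e(1)] by blast
  have 1: "frag_of (j, Some (e * of_nat q ^ n)) - frag_cmul 1 (frag_of (j, Some e)) \<in> K" for j
    using translation_part_commutator[OF M_normal period[rule_format, OF n] positive_submod[OF e], of j]
      scale_power[OF scales(1) e(1), of n j] by simp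
  have "frag_of (i, Some (e * of_nat q ^ n + f)) - frag_cmul 1 (frag_of (i, Some (e + f))) \<in> K"
  proof (rule shift_exponent[where W = K])
    show "g v \<in> K" if "g \<in> acting" "v \<in> K" for g v using K_stable that .
  qed (use K_zero K_diff e e' f 1 in simp_all)
  then show "frag_of (i, Some (e * of_nat q ^ n + f)) - frag_of (i, Some (e + f)) \<in> K" by simp
qed

lemma related_one: "n0 dvd n \<Longrightarrow> related (of_nat q ^ n) 1"
  using related_period[of n 1 0] by simp

text \<open>The substitute for 1 must be fixed by t \<mapsto> t^q, as 1 is. Write (q^n - 1) q = (q -
  1) q^n + (q^n - q) and replace (q - 1) q^n by q - 1.\<close>

lemma related_scale:
  assumes n: "n0 dvd n" "n > 0"
  shows "related ((of_nat q ^ n - 1) * of_nat q) (of_nat q ^ n - 1)"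
proof -
  have "valid (of_nat q ^ n - of_nat q)" using valid_power_diff q_power(2)[OF n(2)] by blast
  moreover have "valid (of_nat q - 1)" "(of_nat q - 1 :: rat) > 0" using exponent_pos[of 1] by simp_all
  ultimately have "related ((of_nat q - 1) * of_nat q ^ n + (of_nat q ^ n - of_nat q)) ((of_nat q - 1) + (of_nat q ^ n - of_nat q))"
    by (intro related_period n)
  then show ?thesis by (simp add: algebra_simps)
qed

text \<open>The substitute for 1 does not depend on n. With m = n - n0, the exponent q^n - 1 = (q^n0
  - 1) q^m + (q^m - 1) is related to (q^n0 - 1) + (q^m - 1) = q^m + (q^n0 - 2), and this to 1 +
  (q^n0 - 2).\<close>

lemma related_const:
  assumes n: "n0 dvd n" "n > 0"
  shows "related (of_nat q ^ n - 1) (of_nat q ^ n0 - 1)"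
proof (cases "n = n0")
  case True
  then show ?thesis using K_zero by (simp add: related_def)
next
  case False
  then have lt: "n0 < n" using n dvd_imp_le[of n0 n] by simp
  define m where "m = n - n0"
  have m: "n0 dvd m" "m > 0" "n = n0 + m" using lt n(1) by (simp_all add: m_def)
  have "related ((of_nat q ^ n0 - 1) * of_nat q ^ m + (of_nat q ^ m - 1)) ((of_nat q ^ n0 - 1) + (of_nat q ^ m - 1))"
    using exponent_pos n0 m by (intro related_period) simp_all
  moreover have "valid (of_nat q ^ n0 - of_nat 2)"
    using valid_power_diff[of 2 n0] q_power(2)[OF n0] q_ge by simp
  then have "related (1 * of_nat q ^ m + (of_nat q ^ n0 - of_nat 2)) (1 + (of_nat q ^ n0 - of_nat 2))"
    using m by (intro related_period) simp_all
  ultimately show ?thesis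
    using related_trans m(3) by (simp add: algebra_simps power_add)
qed

lemma retract_related: "valid x \<Longrightarrow> x > 0 \<Longrightarrow> valid y \<Longrightarrow> y > 0 \<Longrightarrow>
    retract c n (frag_of (i, Some x) - frag_of (i, Some y)) = frag_of (i, Some x) - frag_of (i, Some y)"
  by (intro retract_submod submod_diff positive_submod)

text \<open>\<open>retract\<close> kills \<open>const_diff n0\<close>, and a generator returns it up
  to related monomials: a transvection through (1 - t)(1 - t^(q^n0 - 1)) = (1 - t^(q^n0 - 1)) +
  (t^(q^n0) - t), a scaling because it moves t^(q^n0 - 1) to a related monomial.\<close>

lemma retract_gen_const_diff:
  assumes s: "s \<in> gens"
  shows "retract c n0 (s (const_diff n0 l)) \<in> K"
proof -
  let ?e = "of_nat q ^ n0 - 1 :: rat"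
  note e = exponent_pos[OF n0]
  have q1: "(1::rat) \<le> of_nat q ^ n0" using e by simp
  have rm: "retract c n0 (const_diff n0 j + w) = retract c n0 w" for j w
    using retract_diff[of c n0 w "- const_diff n0 j"] retract_diff[of c n0 0 "const_diff n0 j"]
      retract_const_diff[OF n0] retract_diff[of c n0 0 0] by (simp add: add.commute)
  have rc: "retract c n0 (frag_cmul d w) = frag_cmul d (retract c n0 w)" for d w
    by (rule additive_frag_cmul) (rule retract_diff)
  from s show ?thesis
  proof cases
    case (transv i j d)
    show ?thesis
    proof (cases "l = j")
      case False
      then have "s (const_diff n0 l) = const_diff n0 l + 0"
        by (simp add: transv const_diff_def transv_def frag_extend_diff)
      then show ?thesis using retract_const_diff[OF n0] K_zero by simp
    next
      case True
      have "s (const_diff n0 l) = const_diff n0 j + frag_cmul d (const_diff n0 i + (frag_of (i, Some (of_nat q ^ n0)) - frag_of (i, Some 1)))"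
        using e True
        by (simp add: transv const_diff_def transv_def frag_extend_diff) (simp add: algebra_simps)
      then have "retract c n0 (s (const_diff n0 l)) = frag_cmul d (retract c n0 (frag_of (i, Some (of_nat q ^ n0)) - frag_of (i, Some 1)))"
        by (simp only: rm rc)
      also have "\<dots> = frag_cmul d (frag_of (i, Some (of_nat q ^ n0)) - frag_of (i, Some 1))"
        using valid_power_diff[of 0 n0] q_ge by (subst retract_related) simp_all
      finally show ?thesis
        using related_one[of n0] cmul_closed[OF K_zero K_diff] by (simp add: related_def)
    qed
  next
    case (scale d)
    have 1: "s (const_diff n0 l) = const_diff n0 l + (frag_of (l, Some ?e) - frag_of (l, Some (?e * d)))"
      using e by (simp add: scale const_diff_def scale_def frag_extend_diff)
    have v: "valid (?e * d)" "?e * d > 0" using scale e valid_scale q_ge by (auto simp: scales_def)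
    have "frag_of (l, Some ?e) - frag_of (l, Some (?e * d)) \<in> K"
    proof (cases "d = of_nat q")
      case True
      then show ?thesis using related_scale[of n0] n0 K_uminus[of "frag_of (l, Some (?e * d)) - frag_of (l, Some ?e)"]
        by (simp add: related_def)
    next
      case False
      then have d: "d = 1 / of_nat q" using scale by (simp add: scales_def)
      \<comment> \<open>For the inverse scaling, apply it to the congruence known for scaling by
        q.\<close>
      have "valid (?e * of_nat q)" using e valid_mult_q by blast
      then have "construction.scale q (1 / of_nat q) (frag_of (l, Some (?e * of_nat q)) - frag_of (l, Some ?e))
        = frag_of (l, Some ?e) - frag_of (l, Some (?e * d))"
        using e q_ge by (simp add: scale_def frag_extend_diff d)
      then show ?thesis
        using K_stable[OF scale_acting[OF scales(2)]] related_scale[of n0] n0 by (metis dvd_refl related_def)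
    qed
    then show ?thesis unfolding 1 rm using retract_related e v by simp
  qed
qed

text \<open>A vector differs from its retraction by multiples of \<open>const_diff n0\<close>, which
  settles generators. For a word, the error is that of the first letter plus its image of the error
  of the rest, and \<open>K\<close> is stable.\<close>

lemma retract_equivariant:
  assumes "g \<in> acting" "w \<in> ambient"
  shows "retract c n0 (g w) - g (retract c n0 w) \<in> K"
  using assms
proof (induction arbitrary: w rule: acting.induct)
  case id
  then show ?case using K_zero by simp
next
  case (gen s g)
  note sA = gens_acting[OF gen(1)]
  let ?w = "g w" and ?r = "retract c n0 (g w)"
  have w: "?w \<in> ambient" using gen acting_ambient by blast
  have r: "s ?r \<in> submod c" using retract_in_submod[OF n0 w] stable[OF sA] by blast
  have "s ?w - s ?r = s (\<Sum>i\<in>UNIV. frag_cmul (offset c i ?w) (const_diff n0 i))"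
    by (simp add: retract_def flip: acting_diff[OF sA])
  also have "\<dots> = (\<Sum>i\<in>UNIV. frag_cmul (offset c i ?w) (s (const_diff n0 i)))"
    by (simp add: additive_sum[of s, OF acting_diff[OF sA]] additive_frag_cmul[of s, OF acting_diff[OF sA]])
  finally have "retract c n0 (s ?w - s ?r) = (\<Sum>i\<in>UNIV. frag_cmul (offset c i ?w) (retract c n0 (s (const_diff n0 i))))"
    by (simp add: additive_sum[of "retract c n0", OF retract_diff] additive_frag_cmul[of "retract c n0", OF retract_diff])
  also have "\<dots> \<in> K"
    by (intro diff_closed_sum cmul_closed K_zero K_diff retract_gen_const_diff gen(1))
  finally have 1: "retract c n0 (s ?w) - s ?r \<in> K" by (simp add: retract_diff retract_submod[OF r])
  have "s (?r - g (retract c n0 w)) \<in> K" using K_stable[OF sA gen(3)[OF gen(4)]] .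
  then have "s ?r - s (g (retract c n0 w)) \<in> K" by (simp add: acting_diff[OF sA])
  from K_add[OF 1 this] show ?case by simp
qed

end

text \<open>The quotients in which 1 and t^(q^n - 1) agree. The condition omits, for instance, the
  kernel of the action on constant terms modulo 2, for which \<open>submod 0\<close> is not dense.
  Asking for all multiples of some n0 keeps the family closed under intersection, and c does not
  occur, so one family serves both groups.\<close>

definition model_family where
  "model_family = {N \<in> finite_index_normals (affine_group ambient acting).
     \<exists>n0>0. \<forall>n>0. n0 dvd n \<longrightarrow> (\<forall>i. (const_diff n i, id) \<in> N)}"

lemma submod_ambient: "submod c \<subseteq> ambient" by (auto simp: submod_def)

text \<open>Pull \<open>M\<close> back along the retraction, which is the identity on
  \<open>submod c\<close>. The condition for all multiples n of n0 follows from
  \<open>related_const\<close>, as \<open>const_diff n i\<close> and \<open>const_diff n0 i\<close>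
  differ by related monomials.\<close>

lemma model_family_onto:
  assumes M: "M \<in> finite_index_normals (affine_group (submod c) acting)"
  shows "\<exists>N \<in> model_family. {x \<in> carrier (affine_group (submod c) acting). x \<in> N} = M"
proof -
  interpret affine_action "submod c" acting by (rule affine_submod)
  obtain n0 where n0: "n0 > 0" and period: "\<forall>m. n0 dvd m \<longrightarrow> (0, scale (of_nat q) ^^ m) \<in> M"
    using pow_mem_finite_index[OF M scale_acting[OF scales(1)]] by blast
  define N where "N = {(w, g). w \<in> ambient \<and> g \<in> acting \<and> (retract c n0 w, g) \<in> M}"
  have eq: "(retract c n0 (g w) - g (retract c n0 w), id) \<in> M" if "g \<in> acting" "w \<in> ambient" for g w
    using retract_equivariant[OF M n0 period that] by (simp add: translation_part_def)
  have "N \<in> finite_index_normals (affine_group ambient acting)"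
    unfolding N_def
    by (rule retraction_finite_index[OF affine_submod affine_ambient submod_ambient M])
      (use retract_in_submod[OF n0] retract_diff eq in auto)
  moreover have "(const_diff n i, id) \<in> N" if n: "n > 0" "n0 dvd n" for n i
  proof -
    have "const_diff n i = const_diff n0 i - (frag_of (i, Some (of_nat q ^ n - 1)) - frag_of (i, Some (of_nat q ^ n0 - 1)))"
      by (simp add: const_diff_def)
    moreover have "retract c n0 (frag_of (i, Some (of_nat q ^ n - 1)) - frag_of (i, Some (of_nat q ^ n0 - 1)))
      = frag_of (i, Some (of_nat q ^ n - 1)) - frag_of (i, Some (of_nat q ^ n0 - 1))"
      using retract_related[OF M n0 period] exponent_pos n n0 by blast
    ultimately have "retract c n0 (const_diff n i) = 0 - (frag_of (i, Some (of_nat q ^ n - 1)) - frag_of (i, Some (of_nat q ^ n0 - 1)))"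
      by (simp only: retract_diff retract_const_diff[OF n0])
    also have "\<dots> \<in> translation_part M"
      using related_const[OF M n0 period n(2,1)] K_diff[OF M n0 period K_zero[OF M n0 period]]
      unfolding related_def[OF M n0 period] by blast
    finally show ?thesis using const_diff_ambient[OF n(1)] acting.id by (simp add: N_def translation_part_def)
  qed
  ultimately have "N \<in> model_family" using n0 unfolding model_family_def by blast
  moreover have "M \<subseteq> submod c \<times> acting"
    using subgroup.subset[OF normal_imp_subgroup[OF M_normal[OF M n0 period]]] by simp
  then have "{x \<in> carrier (affine_group (submod c) acting). x \<in> N} = M"
    using submod_ambient by (auto simp: N_def retract_submod subset_iff)
  ultimately show ?thesis by blast
qed

text \<open>A vector and its retraction differ by multiples of \<open>const_diff n i\<close>, which
  are translations in \<open>N\<close>; so each coset meets the smaller group, whatever c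
  is.\<close>

lemma model_family_dense:
  assumes N: "N \<in> model_family" and b: "b \<in> carrier (affine_group ambient acting)"
  shows "\<exists>x \<in> carrier (affine_group (submod c) acting).
    N #>\<^bsub>affine_group ambient acting\<^esub> x = N #>\<^bsub>affine_group ambient acting\<^esub> b"
proof -
  interpret affine_action ambient acting by (rule affine_ambient)
  interpret B: group "affine_group ambient acting" by (rule group)
  interpret N: normal N "affine_group ambient acting" using N by (simp add: model_family_def finite_index_normals_def)
  obtain n where n: "n > 0" "\<And>i. (const_diff n i, id) \<in> N" using N unfolding model_family_def by auto
  obtain w g where b': "b = (w, g)" "w \<in> ambient" "g \<in> acting" using b by auto
  have t: "const_diff n i \<in> translation_part N" for i using n const_diff_ambient by (simp add: translation_part_def)
  let ?r = "retract c n w"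
  have "w - ?r = (\<Sum>i\<in>UNIV. frag_cmul (offset c i w) (const_diff n i))" by (simp add: retract_def)
  also have "\<dots> \<in> translation_part N"
    using translation_part_zero[OF N.normal_axioms] translation_part_diff[OF N.normal_axioms] t
    by (intro diff_closed_sum cmul_closed)
  finally have "(w - ?r, id) \<in> N" by (simp add: translation_part_def)
  then have "(w - ?r, id) \<otimes>\<^bsub>affine_group ambient acting\<^esub> (?r, g) \<in> N #>\<^bsub>affine_group ambient acting\<^esub> (?r, g)"
    unfolding r_coset_def by blast
  then have "b \<in> N #>\<^bsub>affine_group ambient acting\<^esub> (?r, g)" using b' by simp
  moreover have r: "?r \<in> submod c" using retract_in_submod n b' by blast
  ultimately have "N #>\<^bsub>affine_group ambient acting\<^esub> (?r, g) = N #>\<^bsub>affine_group ambient acting\<^esub> b"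
    using b' submod_ambient by (intro B.repr_independence[OF _ _ N.subgroup_axioms]) auto
  then show ?thesis using r b' by (intro bexI[of _ "(?r, g)"]) simp_all
qed

lemma model_family_Int:
  assumes "N \<in> model_family" "N' \<in> model_family" shows "N \<inter> N' \<in> model_family"
proof -
  obtain n where n: "n > 0" "\<forall>m>0. n dvd m \<longrightarrow> (\<forall>i. (const_diff m i, id) \<in> N)"
    using assms(1) unfolding model_family_def by blast
  obtain n' where n': "n' > 0" "\<forall>m>0. n' dvd m \<longrightarrow> (\<forall>i. (const_diff m i, id) \<in> N')"
    using assms(2) unfolding model_family_def by blast
  have "n * n' > 0" "\<forall>m>0. n * n' dvd m \<longrightarrow> (\<forall>i. (const_diff m i, id) \<in> N \<inter> N')"
    using n n' dvd_mult_left dvd_mult_right by (simp, metis IntI)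
  moreover have "N \<inter> N' \<in> finite_index_normals (affine_group ambient acting)"
    using assms finite_index_normals_Int[OF affine_action.group[OF affine_ambient]] by (simp add: model_family_def)
  ultimately show ?thesis unfolding model_family_def by blast
qed

lemma dense_homs_submod:
  "dense_homs (affine_group (submod c) acting) (affine_group (submod d) acting)
     (affine_group ambient acting) (\<lambda>x. x) (\<lambda>x. x) model_family"
proof (rule dense_homs.intro)
  show "(\<lambda>x. x) \<in> hom (affine_group (submod e) acting) (affine_group ambient acting)" for e
    using submod_ambient by (auto simp: hom_def)
  then show "(\<lambda>x. x) \<in> hom (affine_group (submod d) acting) (affine_group ambient acting)" .
  show "model_family \<subseteq> finite_index_normals (affine_group ambient acting)" by (auto simp: model_family_def)
qed (fact affine_action.group[OF affine_submod] affine_action.group[OF affine_ambient] model_family_Int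
  model_family_dense model_family_onto)+

subsection \<open>Residual properties\<close>

lemma additive_dvd:
  fixes D :: "vect \<Rightarrow> int"
  assumes "v \<in> ambient" "\<And>v w. D (v - w) = D v - D w" "\<And>k. valid_key k \<Longrightarrow> P dvd D (frag_of k)"
  shows "P dvd D v"
  using assms(1)
proof (induction rule: ambient_induct)
  case zero
  then show ?case using assms(2)[of 0 0] by simp
qed (simp_all add: assms)

lemma q_cong: "[int q = 1] (mod int p)" by (simp add: q cong_iff_dvd_diff)

lemma coprime_q: "coprime (q ^ n) (p ^ m)"
proof -
  have "coprime q p" by (simp add: q)
  then show ?thesis by simp
qed

lemma q_pow_cong: "[q ^ (p ^ m) = 1] (mod p ^ m)"
  using cong_one_pow_prime_power[OF q_cong, of m] by (simp flip: cong_int_iff)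

definition residue :: "nat \<Rightarrow> rat \<Rightarrow> nat" where
  "residue m e = (SOME n. \<forall>b n'. e * of_nat q ^ b = of_nat n' \<longrightarrow> [n * q ^ b = n'] (mod p ^ m))"

text \<open>As q^(p^m) = 1 modulo p^m, the factor q^(b (p^m - 1)) inverts q^b, so n q^(b (p^m - 1))
  is a residue for e = n / q^b. Cross-multiplication shows that it fits every other fraction for
  e.\<close>

lemma residue:
  assumes "e * of_nat q ^ b = of_nat n"
  shows "[residue m e * q ^ b = n] (mod p ^ m)"
proof -
  have "\<exists>r. \<forall>b' n'. e * of_nat q ^ b' = of_nat n' \<longrightarrow> [r * q ^ b' = n'] (mod p ^ m)"
  proof (intro exI allI impI)
    fix b' n' assume n': "e * of_nat q ^ b' = of_nat n'"
    have "of_nat (n' * q ^ b) = (of_nat (n * q ^ b') :: rat)"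
      using assms n' by (simp flip: assms n')
    then have eq: "n' * q ^ b = n * q ^ b'" by (simp only: of_nat_eq_iff)
    have pm: "p ^ m = Suc (p ^ m - 1)" using prime_gt_0_nat[OF p] by simp
    have "(n * q ^ (b * (p ^ m - 1))) * q ^ b' = n' * (q ^ b * q ^ (b * (p ^ m - 1)))"
      using eq by (simp add: mult_ac)
    also have "q ^ b * q ^ (b * (p ^ m - 1)) = (q ^ (p ^ m)) ^ b"
      by (subst (2) pm) (simp add: power_add power_mult power_mult_distrib mult.commute[of b])
    also have "[n' * (q ^ (p ^ m)) ^ b = n' * 1 ^ b] (mod p ^ m)"
      by (intro cong_mult cong_pow q_pow_cong cong_refl)
    finally show "[(n * q ^ (b * (p ^ m - 1))) * q ^ b' = n'] (mod p ^ m)" by simp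
  qed
  then have "\<forall>b' n'. e * of_nat q ^ b' = of_nat n' \<longrightarrow> [residue m e * q ^ b' = n'] (mod p ^ m)"
    unfolding residue_def by (rule someI_ex)
  then show ?thesis using assms by blast
qed

lemma cong_cancel_q: "[a * q ^ b = c * q ^ b] (mod p ^ m) \<Longrightarrow> [a = c] (mod p ^ m)"
  using cong_mult_rcancel_nat[OF coprime_q] by blast

lemma residue_add:
  assumes "valid e" "valid f"
  shows "[residue m (e + f) = residue m e + residue m f] (mod p ^ m)"
proof -
  obtain b k n where b: "e * of_nat q ^ b = of_nat k" "f * of_nat q ^ b = of_nat n"
    using valid_common[OF assms] .
  then have "(e + f) * of_nat q ^ b = of_nat (k + n)" by (simp add: distrib_right)
  then have "[residue m (e + f) * q ^ b = k + n] (mod p ^ m)" by (rule residue)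
  also have "[k + n = (residue m e + residue m f) * q ^ b] (mod p ^ m)"
    using cong_add[OF residue[OF b(1), of m] residue[OF b(2), of m]] by (simp add: distrib_right cong_sym)
  finally show ?thesis by (rule cong_cancel_q)
qed

lemma residue_1: "[residue m 1 = 1] (mod p ^ m)"
  using residue[of 1 0 1 m] by simp

lemma residue_scale_q:
  assumes "valid e" shows "[residue m (e * of_nat q) = q * residue m e] (mod p ^ m)"
proof -
  obtain b n where b: "e * of_nat q ^ b = of_nat n" using assms by (auto simp: valid_def)
  then have "e * of_nat q * of_nat q ^ b = of_nat (q * n)" by (simp add: mult_ac flip: b)
  then have "[residue m (e * of_nat q) * q ^ b = q * n] (mod p ^ m)" by (rule residue)
  also have "[q * n = q * residue m e * q ^ b] (mod p ^ m)"
    using cong_mult[OF cong_refl[of q] residue[OF b, of m]] by (simp add: mult.assoc cong_sym)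
  finally show ?thesis by (rule cong_cancel_q)
qed

text \<open>Division by q acts on residues as q^(p^m - 1), so both scalings act through natural
  powers of q and evaluation points are only raised to natural powers.\<close>

lemma residue_scale:
  assumes "c \<in> scales"
  obtains a where "\<And>e. valid e \<Longrightarrow> [residue m (e * c) = q ^ a * residue m e] (mod p ^ m)"
proof (cases "c = of_nat q")
  case True
  then show ?thesis using that[of 1] residue_scale_q by simp
next
  case False
  then have c: "c = 1 / of_nat q" using assms by (simp add: scales_def)
  have pm: "p ^ m = Suc (p ^ m - 1)" using prime_gt_0_nat[OF p] by simp
  have "[residue m (e * c) = q ^ (p ^ m - 1) * residue m e] (mod p ^ m)" if e: "valid e" for e
  proof -
    have ec: "valid (e * c)" "e * c * of_nat q = e" using e valid_div_q c q_ge by auto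
    have "[q ^ (p ^ m - 1) * residue m e = q ^ (p ^ m - 1) * (q * residue m (e * c))] (mod p ^ m)"
      using residue_scale_q[OF ec(1), of m] ec(2) by (intro cong_mult cong_refl) simp
    also have "q ^ (p ^ m - 1) * (q * residue m (e * c)) = q ^ (p ^ m) * residue m (e * c)"
      by (subst (2) pm) (simp add: mult_ac)
    also have "[\<dots> = 1 * residue m (e * c)] (mod p ^ m)"
      by (intro cong_mult q_pow_cong cong_refl)
    finally show ?thesis by (simp add: cong_sym)
  qed
  then show ?thesis using that by blast
qed

definition points :: "int set" where "points = {s. [s = 1] (mod int p)}"

lemma points_power: "s \<in> points \<Longrightarrow> s ^ n \<in> points"
  unfolding points_def using cong_pow by fastforce

text \<open>Points satisfy s^(p^m) = 1 modulo p^m, so exponents matter only modulo p^m.\<close>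

lemma point_power_cong:
  assumes s: "s \<in> points" and ab: "[a = b] (mod p ^ m)"
  shows "[s ^ a = s ^ b] (mod int p ^ m)"
proof -
  have 1: "[s ^ (a + k * p ^ m) = s ^ a] (mod int p ^ m)" for a k
  proof -
    have "[s ^ a * (s ^ (p ^ m)) ^ k = s ^ a * 1 ^ k] (mod int p ^ m)"
      using s by (intro cong_mult cong_pow cong_refl cong_one_pow_prime_power) (simp add: points_def)
    then show ?thesis by (simp add: power_add power_mult mult.commute[of k])
  qed
  obtain k l where "b + k * p ^ m = a + l * p ^ m" using ab cong_iff_lin_nat by metis
  then show ?thesis using 1[of a l] 1[of b k] by (metis cong_sym cong_trans)
qed

text \<open>\<open>value_at m s i v\<close> is the value modulo \<open>p ^ m\<close> of the \<open>i\<close>-th coordinate of \<open>v\<close> at \<open>t = s\<close>. The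
  fractional powers of \<open>s \<equiv> 1\<close> modulo \<open>p\<close> make sense because \<open>q\<close> is prime to \<open>p\<close>.\<close>

fun weight :: "nat \<Rightarrow> int \<Rightarrow> Enum.finite_3 \<Rightarrow> key \<Rightarrow> int" where
  "weight m s i (l, None) = 0"
| "weight m s i (l, Some e) = (if l = i \<and> valid e then s ^ residue m e else 0)"

definition value_at where "value_at m s i v = lin (weight m s i) v"

lemma value_at_diff: "value_at m s i (u - v) = value_at m s i u - value_at m s i v"
  by (simp add: value_at_def lin_diff)

lemma value_at_cong:
  assumes v: "v \<in> ambient" and ss: "\<And>n. [s ^ n = s' ^ n] (mod int p ^ m)"
  shows "int p ^ m dvd value_at m s i v - value_at m s' i v"
proof (rule additive_dvd[OF v])
  fix k show "int p ^ m dvd value_at m s i (frag_of k) - value_at m s' i (frag_of k)"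
    using ss by (cases k rule: valid_key.cases) (auto simp: value_at_def cong_iff_dvd_diff)
qed (simp add: value_at_diff)

text \<open>Modulo p^m, multiplication by t multiplies the value at s by s, so 1 - t becomes 1 -
  s.\<close>

lemma value_at_transv:
  assumes s: "s \<in> points" and v: "v \<in> ambient"
  shows "int p ^ m dvd value_at m s l (transv c i j v) - (value_at m s l v + (if l = i then c * (1 - s) * value_at m s j v else 0))"
proof (rule additive_dvd[OF v])
  fix k assume k: "valid_key k"
  show "int p ^ m dvd value_at m s l (transv c i j (frag_of k)) - (value_at m s l (frag_of k) + (if l = i then c * (1 - s) * value_at m s j (frag_of k) else 0))"
  proof (cases k rule: valid_key.cases)
    case (2 l' e)
    then have e: "valid e" using k by simp
    have "[s ^ residue m (e + 1) = s ^ (residue m e + 1)] (mod int p ^ m)"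
      using residue_add[OF e valid_1, of m] cong_add[OF cong_refl[of "residue m e"] residue_1[of m]]
      by (intro point_power_cong[OF s]) (rule cong_trans)
    then have "int p ^ m dvd s ^ residue m e * s - s ^ residue m (e + 1)"
      by (simp add: cong_iff_dvd_diff dvd_diff_commute mult.commute)
    then have "int p ^ m dvd c * (s ^ residue m e * s - s ^ residue m (e + 1))" by (rule dvd_mult)
    then show ?thesis using 2 e
      by (auto simp: value_at_def transv_def lin_add lin_frag_cmul lin_diff algebra_simps)
  qed (auto simp: value_at_def transv_def lin_add lin_frag_cmul)
qed (simp add: value_at_diff transv_diff algebra_simps)

lemma value_at_scale:
  assumes s: "s \<in> points" and v: "v \<in> ambient"
    and a: "\<And>e. valid e \<Longrightarrow> [residue m (e * c) = q ^ a * residue m e] (mod p ^ m)" and c: "c \<in> scales"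
  shows "int p ^ m dvd value_at m s l (scale c v) - value_at m (s ^ q ^ a) l v"
proof (rule additive_dvd[OF v])
  fix k assume k: "valid_key k"
  show "int p ^ m dvd value_at m s l (scale c (frag_of k)) - value_at m (s ^ q ^ a) l (frag_of k)"
  proof (cases k rule: valid_key.cases)
    case (2 l' e)
    then have e: "valid e" using k by simp
    then show ?thesis
      using point_power_cong[OF s a[OF e]] 2 valid_scale[OF c e]
      by (auto simp: value_at_def scale_def cong_iff_dvd_diff power_mult)
  qed (simp add: value_at_def scale_def)
qed (simp add: value_at_diff scale_diff)

text \<open>A tame map moves the evaluation points by \<open>s \<mapsto> s ^ C\<close> and is otherwise unipotent for the \<open>p\<close>-adic
  filtration of the values.\<close>

definition tame where
  "tame m C f \<longleftrightarrow> (\<forall>u \<in> ambient. f u \<in> ambient) \<and>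
     (\<forall>s \<in> points. \<forall>k<m. \<forall>u \<in> ambient. \<forall>v \<in> ambient.
       (\<forall>i. int p ^ k dvd value_at m (s ^ C) i (u - v)) \<longrightarrow>
       (\<forall>i. int p ^ Suc k dvd value_at m s i (f u - f v) - value_at m (s ^ C) i (u - v)))"

lemma tameD:
  assumes "tame m C f" "s \<in> points" "k < m" "u \<in> ambient" "v \<in> ambient"
    "\<And>i. int p ^ k dvd value_at m (s ^ C) i (u - v)"
  shows "int p ^ Suc k dvd value_at m s i (f u - f v) - value_at m (s ^ C) i (u - v)"
  using assms unfolding tame_def by blast

text \<open>The inner map alters values only by multiples of p^(k+1), so divisibility by p^k at s^(C
  D) passes to its image at s^C, where the outer map needs it.\<close>

lemma tame_comp:
  assumes f: "tame m C f" and g: "tame m D g" shows "tame m (C * D) (f \<circ> g)"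
  unfolding tame_def
proof (intro conjI ballI allI impI)
  show "(f \<circ> g) u \<in> ambient" if "u \<in> ambient" for u using that f g by (simp add: tame_def)
  fix s k u v i
  assume s: "s \<in> points" and k: "k < m" and u: "u \<in> ambient" and v: "v \<in> ambient"
    and dvd: "\<forall>i. int p ^ k dvd value_at m (s ^ (C * D)) i (u - v)"
  have sC: "s ^ C \<in> points" using points_power s by blast
  have gu: "g u \<in> ambient" "g v \<in> ambient" using u v g by (auto simp: tame_def)
  have 1: "int p ^ Suc k dvd value_at m (s ^ C) i (g u - g v) - value_at m (s ^ (C * D)) i (u - v)" for i
    using tameD[OF g sC k u v, of i] dvd by (simp add: power_mult)
  have 2: "int p ^ k dvd value_at m (s ^ C) i (g u - g v)" for i
  proof -
    have "int p ^ k dvd value_at m (s ^ C) i (g u - g v) - value_at m (s ^ (C * D)) i (u - v)"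
      using 1[of i] by (metis dvd_mult_right power_Suc)
    from dvd_add[OF this dvd[rule_format, of i]] show ?thesis by simp
  qed
  show "int p ^ Suc k dvd value_at m s i ((f \<circ> g) u - (f \<circ> g) v) - value_at m (s ^ (C * D)) i (u - v)"
    using dvd_add[OF tameD[OF f s k gu 2, of i] 1[of i]] by simp
qed

lemma tame_id: "tame m 1 id" by (simp add: tame_def)

lemma tame_funpow: "tame m C f \<Longrightarrow> tame m (C ^ n) (f ^^ n)"
proof (induction n)
  case 0
  then show ?case unfolding power_0 using tame_id by (simp only: funpow.simps(1))
next
  case (Suc n)
  then show ?case unfolding power_Suc funpow.simps(2) using tame_comp by blast
qed

text \<open>A transvection adds c (1 - s) times another value, and p divides 1 - s; a scaling only
  replaces s by s^(q^a).\<close>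

lemma tame_gens:
  assumes s: "s \<in> gens" shows "\<exists>a. tame m (q ^ a) s"
  using s
proof cases
  case (transv i j c)
  have "tame m (q ^ 0) s"
    unfolding tame_def
  proof (intro conjI ballI allI impI)
    show "s u \<in> ambient" if "u \<in> ambient" for u using gens_ambient[OF s that] .
    fix x k u v l
    assume x: "x \<in> points" and k: "k < m" and u: "u \<in> ambient" and v: "v \<in> ambient"
      and dvd: "\<forall>i. int p ^ k dvd value_at m (x ^ q ^ 0) i (u - v)"
    have "int p ^ Suc k dvd int p ^ m" using k by (intro le_imp_power_dvd) simp
    then have 1: "int p ^ Suc k dvd value_at m x l (transv c i j (u - v))
        - (value_at m x l (u - v) + (if l = i then c * (1 - x) * value_at m x j (u - v) else 0))"
      using value_at_transv[OF x ambient_diff[OF u v], of m l c i j] dvd_trans by blast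
    have "int p dvd 1 - x" using x by (simp add: points_def cong_iff_dvd_diff dvd_diff_commute)
    then have "int p * int p ^ k dvd (1 - x) * value_at m x j (u - v)"
      using dvd by (intro mult_dvd_mono) simp_all
    then have "int p ^ Suc k dvd c * ((1 - x) * value_at m x j (u - v))" by simp
    then have 2: "int p ^ Suc k dvd (if l = i then c * (1 - x) * value_at m x j (u - v) else 0)" by (simp add: mult.assoc)
    show "int p ^ Suc k dvd value_at m x l (s u - s v) - value_at m (x ^ q ^ 0) l (u - v)"
      using dvd_add[OF 1 2] by (simp add: transv transv_diff)
  qed
  then show ?thesis by blast
next
  case (scale c)
  obtain a where a: "\<And>e. valid e \<Longrightarrow> [residue m (e * c) = q ^ a * residue m e] (mod p ^ m)"
    using residue_scale[OF scale(2)] by metis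
  have "tame m (q ^ a) s"
    unfolding tame_def
  proof (intro conjI ballI allI impI)
    show "s u \<in> ambient" if "u \<in> ambient" for u using gens_ambient[OF s that] .
    fix x k u v l
    assume x: "x \<in> points" and k: "k < m" and u: "u \<in> ambient" and v: "v \<in> ambient"
    have "int p ^ Suc k dvd int p ^ m" using k by (intro le_imp_power_dvd) simp
    then have "int p ^ Suc k dvd value_at m x l (construction.scale q c (u - v)) - value_at m (x ^ q ^ a) l (u - v)"
      using value_at_scale[OF x ambient_diff[OF u v] a scale(2), of l] dvd_trans by blast
    then show "int p ^ Suc k dvd value_at m x l (s u - s v) - value_at m (x ^ q ^ a) l (u - v)"
      by (simp add: scale scale_diff)
  qed
  then show ?thesis by blast
qed

lemma tame_acting: "g \<in> acting \<Longrightarrow> \<exists>a. tame m (q ^ a) g"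
proof (induction rule: acting.induct)
  case id
  show ?case using tame_id[of m] power_0[of q] by metis
next
  case (gen s g)
  then obtain a b where "tame m (q ^ a) s" "tame m (q ^ b) g" using tame_gens by blast
  then have "tame m (q ^ (a + b)) (s \<circ> g)" by (simp add: power_add tame_comp)
  then show ?case by blast
qed

text \<open>\<open>tame\<close> constrains only differences, in which a translation cancels; so it
  applies to affine maps.\<close>

lemma tame_act:
  assumes "tame m C g" "v \<in> ambient" shows "tame m C (\<lambda>u. v + g u)"
  using assms by (auto simp: tame_def ambient_add)

text \<open>With h = F^(p^k), the values of h^r u - u agree with r times those of h u - u modulo
  p^(k+1). The latter are divisible by p^k by induction, and r = p supplies one more factor.\<close>

lemma tame_unipotent:
  assumes F: "tame m C F" and C: "[C = 1] (mod p ^ m)"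
  shows "k \<le> m \<Longrightarrow> u \<in> ambient \<Longrightarrow> s \<in> points \<Longrightarrow> int p ^ k dvd value_at m s i ((F ^^ (p ^ k)) u - u)"
proof (induction k arbitrary: u s i)
  case (Suc k)
  let ?h = "F ^^ (p ^ k)"
  let ?C = "C ^ (p ^ k)"
  have h: "tame m ?C ?h" using tame_funpow[OF F] .
  have hC: "[?C = 1] (mod p ^ m)" using cong_pow[OF C, of "p ^ k"] by simp
  have k: "k < m" using Suc by simp
  have hu: "(?h ^^ r) u \<in> ambient" if "u \<in> ambient" for r u
    using that h by (induction r) (auto simp: tame_def)
  \<comment> \<open>Because the exponent is 1 modulo p^m, evaluation at the moved point is
    evaluation at s.\<close>
  have eq: "int p ^ Suc k dvd value_at m (s ^ ?C) i w - value_at m s i w" if "s \<in> points" "w \<in> ambient" for s i w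
  proof -
    have "[(s ^ ?C) ^ n = s ^ n] (mod int p ^ m)" for n
      using point_power_cong[OF that(1) cong_mult[OF hC cong_refl[of n]]] by (simp add: power_mult)
    then have "int p ^ m dvd value_at m (s ^ ?C) i w - value_at m s i w" by (rule value_at_cong[OF that(2)])
    moreover have "int p ^ Suc k dvd int p ^ m" using k by (intro le_imp_power_dvd) simp
    ultimately show ?thesis using dvd_trans by blast
  qed
  have d: "int p ^ k dvd value_at m s i (?h u - u)" if "s \<in> points" for s i
    using Suc.IH[OF _ Suc.prems(2) that] k by simp
  have r: "int p ^ Suc k dvd value_at m s i ((?h ^^ r) u - u) - int r * value_at m s i (?h u - u)" if s: "s \<in> points" for r s i
    using s
  proof (induction r arbitrary: s i)
    case 0
    then show ?case by (simp add: value_at_def)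
  next
    case (Suc r)
    let ?w = "(?h ^^ r) u"
    have w: "?w \<in> ambient" using hu \<open>u \<in> ambient\<close> .
    have pw: "int p ^ k dvd value_at m s i (?w - u)" if "s \<in> points" for s i
    proof -
      have "int p ^ k dvd value_at m s i (?w - u) - int r * value_at m s i (?h u - u)"
        using Suc.IH[OF that, of i] unfolding power_Suc by (rule dvd_mult_right)
      moreover have "int p ^ k dvd int r * value_at m s i (?h u - u)" using d[OF that] by (rule dvd_mult)
      ultimately have "int p ^ k dvd (value_at m s i (?w - u) - int r * value_at m s i (?h u - u)) + int r * value_at m s i (?h u - u)"
        by (rule dvd_add)
      then show ?thesis by simp
    qed
    have 1: "int p ^ Suc k dvd value_at m s i (?h ?w - ?h u) - value_at m (s ^ ?C) i (?w - u)"
      by (rule tameD[OF h Suc.prems k w \<open>u \<in> ambient\<close>]) (rule pw[OF points_power[OF Suc.prems]])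
    have 2: "int p ^ Suc k dvd value_at m (s ^ ?C) i (?w - u) - value_at m s i (?w - u)"
      using eq[OF Suc.prems ambient_diff[OF w \<open>u \<in> ambient\<close>]] .
    have "int p ^ Suc k dvd (value_at m s i (?h ?w - ?h u) - value_at m (s ^ ?C) i (?w - u))
        + (value_at m (s ^ ?C) i (?w - u) - value_at m s i (?w - u))
        + (value_at m s i (?w - u) - int r * value_at m s i (?h u - u))"
      by (intro dvd_add 1 2 Suc.IH Suc.prems)
    then show ?case by (simp add: value_at_diff algebra_simps)
  qed
  have "int p ^ Suc k dvd int p * value_at m s i (?h u - u)"
    using d[OF Suc.prems(3)] by (simp add: mult_dvd_mono)
  from dvd_add[OF r[OF Suc.prems(3), of i p] this]
  have "int p ^ Suc k dvd value_at m s i ((?h ^^ p) u - u)" by simp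
  then show ?case by (simp add: funpow_mult mult.commute)
qed simp

section \<open>Vectors whose values vanish modulo p^m\<close>

definition zero_values where
  "zero_values m = {v \<in> ambient. \<forall>s \<in> points. \<forall>i. int p ^ m dvd value_at m s i v}"

text \<open>Restricting to representatives of the points modulo p^m leaves finitely many possible
  tables, so this can serve as the colouring in \<open>congruence_kernel\<close>.\<close>

definition value_table where
  "value_table m v = {(s, i, value_at m s i v mod int p ^ m) | s i. s \<in> {0..<int p ^ m} \<inter> points}"

lemma finite_values: "finite (value_table m ` V)"
proof -
  have "p > 0" using prime_gt_0_nat[OF p] .
  then have "value_table m ` V \<subseteq> Pow ({0..<int p ^ m} \<times> UNIV \<times> {0..<int p ^ m})"
    by (auto simp: value_table_def)
  then show ?thesis by (rule finite_subset) simp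
qed

lemma values_eq_imp:
  assumes v: "v \<in> ambient" "w \<in> ambient" and eq: "value_table m v = value_table m w"
  shows "v - w \<in> zero_values m"
proof -
  have "int p ^ m dvd value_at m s i (v - w)" if s: "s \<in> points" for s i
  \<comment> \<open>For m = 0, reduction modulo 1 forgets that s is 1 modulo p and leads out of
    \<open>points\<close>; the claim is trivial then.\<close>
  proof (cases "m = 0")
    case False
    let ?s = "s mod int p ^ m"
    have "[?s = s] (mod int p ^ m)" by simp
    then have "[?s = s] (mod int p)" by (rule cong_dvd_modulus) (use False in simp)
    then have sp: "?s \<in> points" using s unfolding points_def by (metis cong_trans mem_Collect_eq)
    have "?s \<in> {0..<int p ^ m}" using prime_gt_0_nat[OF p] by simp
    then have "(?s, i, value_at m ?s i v mod int p ^ m) \<in> value_table m v"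
      unfolding value_table_def mem_Collect_eq using sp
      by (intro exI[of _ ?s] exI[of _ i]) simp
    then have "value_at m ?s i v mod int p ^ m = value_at m ?s i w mod int p ^ m"
      unfolding eq unfolding value_table_def mem_Collect_eq by (elim exE conjE Pair_inject) (simp only:)
    then have 1: "int p ^ m dvd value_at m ?s i (v - w)" by (simp add: value_at_diff mod_eq_dvd_iff)
    have "int p ^ m dvd value_at m s i (v - w) - value_at m ?s i (v - w)"
      by (intro value_at_cong ambient_diff v cong_pow) (simp add: cong_sym)
    from dvd_add[OF this 1] show ?thesis by simp
  qed simp
  then show ?thesis using v ambient_diff by (simp add: zero_values_def)
qed

lemma zero_values_0: "0 \<in> zero_values m"
  by (simp add: zero_values_def ambient_0 value_at_def)

lemma zero_values_diff: "v \<in> zero_values m \<Longrightarrow> w \<in> zero_values m \<Longrightarrow> v - w \<in> zero_values m"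
  by (simp add: zero_values_def ambient_diff value_at_diff)

lemma zero_values_gens:
  assumes s: "s \<in> gens" and v: "v \<in> zero_values m" shows "s v \<in> zero_values m"
proof -
  have va: "v \<in> ambient" and dvd: "\<And>x i. x \<in> points \<Longrightarrow> int p ^ m dvd value_at m x i v"
    using v by (auto simp: zero_values_def)
  from s have "int p ^ m dvd value_at m x l (s v)" if x: "x \<in> points" for x l
  proof cases
    case (transv i j c)
    have "int p ^ m dvd value_at m x l v + (if l = i then c * (1 - x) * value_at m x j v else 0)"
      using dvd[OF x] by simp
    from dvd_add[OF value_at_transv[OF x va, of m l c i j] this] show ?thesis by (simp add: transv)
  next
    case (scale c)
    obtain a where a: "\<And>e. valid e \<Longrightarrow> [residue m (e * c) = q ^ a * residue m e] (mod p ^ m)"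
      using residue_scale[OF scale(2)] by metis
    have "int p ^ m dvd value_at m (x ^ q ^ a) l v" using dvd[OF points_power[OF x]] .
    from dvd_add[OF value_at_scale[OF x va a scale(2), of l] this] show ?thesis by (simp add: scale)
  qed
  then show ?thesis using gens_ambient[OF s va] by (simp add: zero_values_def)
qed

lemma zero_values_acting: "g \<in> acting \<Longrightarrow> v \<in> zero_values m \<Longrightarrow> g v \<in> zero_values m"
  by (induction arbitrary: v rule: acting.induct) (simp_all add: zero_values_gens)

lemma infinite_points: "infinite points"
proof -
  have "(\<lambda>n. 1 + int p * int n) ` UNIV \<subseteq> points" by (auto simp: points_def cong_iff_dvd_diff)
  moreover have "inj (\<lambda>n. 1 + int p * int n)" using prime_gt_0_nat[OF p] by (simp add: inj_def)
  then have "infinite ((\<lambda>n. 1 + int p * int n) ` UNIV)" by (simp add: finite_image_iff)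
  ultimately show ?thesis using finite_subset by blast
qed

text \<open>After clearing denominators, coordinate i is a nonzero integer polynomial, which has a
  nonroot among the infinitely many points; a nonzero integer is not divisible by a high power of
  p.\<close>

lemma zero_values_separate:
  assumes v: "v \<in> ambient" and nz: "Poly_Mapping.lookup v (i, Some e0) \<noteq> 0"
  shows "\<exists>m. v \<notin> zero_values m"
proof -
  define E where "E = {e. (i, Some e) \<in> Poly_Mapping.keys v}"
  have "E = (\<lambda>k. the (snd k)) ` {k \<in> Poly_Mapping.keys v. fst k = i \<and> snd k \<noteq> None}"
    by (force simp: E_def image_iff)
  then have finE: "finite E" by simp
  have valE: "valid e" if "e \<in> E" for e using that v by (force simp: E_def ambient_def)
  have "\<exists>b. \<forall>e \<in> E. \<exists>n. e * of_nat q ^ b = of_nat n"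
    using finE valE
  proof (induction E rule: finite_induct)
    case (insert e E)
    then obtain b where b: "\<forall>e \<in> E. \<exists>n. e * of_nat q ^ b = of_nat n" by blast
    obtain c n where c: "e * of_nat q ^ c = of_nat n" using insert.prems[of e] by (auto simp: valid_def)
    have "e * of_nat q ^ (b + c) = of_nat (n * q ^ b)" using c by (simp add: power_add mult_ac)
    moreover have "\<exists>n. e' * of_nat q ^ (b + c) = of_nat n" if e': "e' \<in> E" for e'
    proof -
      obtain k where "e' * of_nat q ^ b = of_nat k" using b e' by blast
      then have "e' * of_nat q ^ (b + c) = of_nat (k * q ^ c)" by (simp add: power_add flip: mult.assoc)
      then show ?thesis by blast
    qed
    ultimately have "\<forall>e' \<in> insert e E. \<exists>n. e' * of_nat q ^ (b + c) = of_nat n" by blast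
    then show ?case by blast
  qed simp
  then obtain b nn where nn: "\<And>e. e \<in> E \<Longrightarrow> e * of_nat q ^ b = of_nat (nn e)" by metis
  have inj: "nn e = nn e' \<Longrightarrow> e = e'" if "e \<in> E" "e' \<in> E" for e e'
  proof -
    assume "nn e = nn e'"
    then have "e * of_nat q ^ b = e' * of_nat q ^ b" using nn[OF that(1)] nn[OF that(2)] by simp
    then show "e = e'" using q_ge by simp
  qed
  define P where "P = (\<Sum>e\<in>E. monom (Poly_Mapping.lookup v (i, Some e)) (nn e))"
  have e0: "e0 \<in> E" using nz by (simp add: E_def in_keys_iff)
  have "coeff P (nn e0) = (\<Sum>e\<in>E. if e = e0 then Poly_Mapping.lookup v (i, Some e) else 0)"
    unfolding P_def coeff_sum using inj e0 by (intro sum.cong) auto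
  then have "coeff P (nn e0) \<noteq> 0" using nz e0 finE by simp
  then have "P \<noteq> 0" by auto
  then have "finite {x. poly P x = 0}" by (rule poly_roots_finite)
  then obtain r where r: "r \<in> points" "poly P r \<noteq> 0"
    using infinite_points by (metis (mono_tags, lifting) finite_subset mem_Collect_eq subsetI)
  \<comment> \<open>At t = r^(q^b) the monomial t^e takes the value r^(e q^b), an integral
    power.\<close>
  let ?s = "r ^ q ^ b"
  have cong: "[value_at m ?s i v = poly P r] (mod int p ^ m)" for m
  proof -
    have "value_at m ?s i v = (\<Sum>k\<in>Pair i ` Some ` E. Poly_Mapping.lookup v k * weight m ?s i k)"
      unfolding value_at_def lin_def
    proof (rule sum.mono_neutral_right)
      show "\<forall>k\<in>Poly_Mapping.keys v - Pair i ` Some ` E. Poly_Mapping.lookup v k * weight m ?s i k = 0"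
      proof
        fix k assume "k \<in> Poly_Mapping.keys v - Pair i ` Some ` E"
        then show "Poly_Mapping.lookup v k * weight m ?s i k = 0"
          by (cases k rule: valid_key.cases) (auto simp: E_def)
      qed
    qed (auto simp: E_def)
    also have "\<dots> = (\<Sum>e\<in>E. Poly_Mapping.lookup v (i, Some e) * ?s ^ residue m e)"
      by (subst sum.reindex, simp add: inj_on_def, subst sum.reindex, simp add: inj_on_def)
        (intro sum.cong, simp_all add: valE)
    also have "[\<dots> = (\<Sum>e\<in>E. Poly_Mapping.lookup v (i, Some e) * r ^ nn e)] (mod int p ^ m)"
    proof (intro cong_sum cong_mult cong_refl)
      fix e assume "e \<in> E"
      have "[r ^ (residue m e * q ^ b) = r ^ nn e] (mod int p ^ m)"
        by (rule point_power_cong[OF r(1) residue[OF nn[OF \<open>e \<in> E\<close>]]])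
      then show "[?s ^ residue m e = r ^ nn e] (mod int p ^ m)"
        by (simp add: mult.commute flip: power_mult)
    qed
    also have "(\<Sum>e\<in>E. Poly_Mapping.lookup v (i, Some e) * r ^ nn e) = poly P r"
      by (simp add: P_def poly_sum poly_monom)
    finally show ?thesis .
  qed
  \<comment> \<open>Any m with p^m larger than the absolute value of P(r) works, and m <
    p^m.\<close>
  define m where "m = nat \<bar>poly P r\<bar>"
  have "v \<notin> zero_values m"
  proof
    assume "v \<in> zero_values m"
    then have "int p ^ m dvd value_at m ?s i v" using points_power[OF r(1)] by (simp add: zero_values_def)
    then have "int p ^ m dvd poly P r" using cong cong_dvd_iff by blast
    then have "int p ^ m \<le> \<bar>poly P r\<bar>" using r(2) dvd_imp_le_int[of "poly P r" "int p ^ m"] by simp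
    moreover have "m < p ^ m" using prime_gt_1_nat[OF p] by (simp add: power_gt_expt)
    then have "\<bar>poly P r\<bar> < int p ^ m" unfolding m_def by (metis nat_less_iff abs_ge_zero of_nat_power)
    ultimately show False by simp
  qed
  then show ?thesis ..
qed

text \<open>Values ignore the integral part, but in \<open>submod 1\<close> it repeats the constant
  terms, so a nonzero vector has a nonzero monomial coefficient. In \<open>submod 0\<close> this
  breaks down.\<close>

lemma residually_p_submod: "residually_p p (affine_group (submod 1) acting)"
proof -
  interpret affine_action "submod 1" acting by (rule affine_submod)
  interpret G: group "affine_group (submod 1) acting" by (rule group)
  show ?thesis
  proof (rule residually_pI[OF p group])
    fix x assume "x \<in> carrier (affine_group (submod 1) acting)" "x \<noteq> \<one>\<^bsub>affine_group (submod 1) acting\<^esub>"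
    then have x: "x \<in> submod 1 \<times> acting" "x \<noteq> (0, id)" by simp_all
    obtain u where u: "u \<in> submod 1" "u \<noteq> 0" "\<And>J. x \<in> congruence_kernel J \<Longrightarrow> u \<in> J"
      using separated[OF x faithful_submod] by blast
    have "\<exists>i e. Poly_Mapping.lookup u (i, Some e) \<noteq> 0"
    proof (rule ccontr)
      assume none: "\<not> ?thesis"
      have "Poly_Mapping.lookup u k = 0" for k
        using none u(1) by (cases k rule: valid_key.cases) (auto simp: submod_def)
      then show False using u(2) by (metis poly_mapping_eqI lookup_zero)
    qed
    then obtain m where m: "u \<notin> zero_values m"
      using zero_values_separate u(1) submod_ambient by blast
    let ?N = "congruence_kernel (zero_values m)"
    have "?N \<in> finite_index_normals (affine_group (submod 1) acting)"
    proof (rule congruence_kernel[where c = "value_table m"])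
      show "v - w \<in> zero_values m" if "v \<in> submod 1" "w \<in> submod 1" "value_table m v = value_table m w" for v w
        using values_eq_imp that submod_ambient by blast
      show "g v \<in> zero_values m" if "g \<in> acting" "v \<in> zero_values m" for g v
        using zero_values_acting that .
    qed (fact zero_values_0 zero_values_diff finite_values)+
    moreover have "x \<notin> ?N" using u(3) m by blast
    moreover have "\<exists>k. y [^]\<^bsub>affine_group (submod 1) acting\<^esub> (p ^ k :: nat) \<in> ?N"
      if yc: "y \<in> carrier (affine_group (submod 1) acting)" for y
    proof -
      obtain v g where y: "y = (v, g)" "v \<in> submod 1" "g \<in> acting" using yc by auto
      obtain a where "tame m (q ^ a) g" using tame_acting[OF y(3)] by blast
      then have "tame m (q ^ a) (act y)"
        using tame_act[of m "q ^ a" g v] y submod_ambient by (auto simp: act_def[abs_def])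
      then have F: "tame m ((q ^ a) ^ (p ^ m)) (act y ^^ (p ^ m))" by (rule tame_funpow)
      have C: "[(q ^ a) ^ (p ^ m) = 1] (mod p ^ m)"
        using cong_pow[OF q_pow_cong, of m a] by (simp add: mult.commute flip: power_mult)
      \<comment> \<open>One p^m-th power makes the exponent of the substitution 1 modulo p^m;
        another one then acts trivially modulo \<open>zero_values m\<close> by
        \<open>tame_unipotent\<close>.\<close>
      have "y [^]\<^bsub>affine_group (submod 1) acting\<^esub> (p ^ (m + m)) \<in> ?N"
      proof (rule congruence_kernelI[OF _ zero_values_diff])
        show "y [^]\<^bsub>affine_group (submod 1) acting\<^esub> (p ^ (m + m)) \<in> submod 1 \<times> acting"
          using G.nat_pow_closed[OF yc] by simp
        fix u assume "u \<in> submod 1"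
        then have ua: "u \<in> ambient" using submod_ambient by blast
        have "act (y [^]\<^bsub>affine_group (submod 1) acting\<^esub> (p ^ (m + m))) u = ((act y ^^ (p ^ m)) ^^ (p ^ m)) u"
          using act_pow[of y] y by (simp add: power_add funpow_mult)
        moreover have "((act y ^^ (p ^ m)) ^^ (p ^ m)) u \<in> ambient"
          using tame_funpow[OF F, of "p ^ m"] ua by (simp add: tame_def)
        ultimately show "act (y [^]\<^bsub>affine_group (submod 1) acting\<^esub> (p ^ (m + m))) u - u \<in> zero_values m"
          using tame_unipotent[OF F C order_refl ua] ua by (simp add: zero_values_def ambient_diff)
      qed
      then show ?thesis by blast
    qed
    ultimately show "\<exists>N \<in> finite_index_normals (affine_group (submod 1) acting). x \<notin> N \<and>
        (\<forall>y \<in> carrier (affine_group (submod 1) acting). \<exists>k. y [^]\<^bsub>affine_group (submod 1) acting\<^esub> (p ^ k :: nat) \<in> N)"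
      by blast
  qed
qed

text \<open>To detect the integral part, its coefficients modulo p^m are added to the congruence.
  The quotients stay finite but need not be p-groups, since the matrices act there as e_ij(1) and
  e_ij(-1).\<close>

lemma residually_finite_ambient: "residually_finite (affine_group ambient acting)"
proof -
  interpret affine_action ambient acting by (rule affine_ambient)
  define J where "J m = {v \<in> zero_values m. \<forall>i. int p ^ m dvd Poly_Mapping.lookup v (i, None)}" for m
  have gensJ: "s v \<in> J m" if s: "s \<in> gens" and v: "v \<in> J m" for s v m
  proof -
    have "int p ^ m dvd Poly_Mapping.lookup (s v) (i, None)" for i
      using s
    proof cases
      case (transv k j c)
      then show ?thesis using v by (simp add: lookup_transv J_def)
    next
      case (scale c)
      then show ?thesis using v lookup_scale(2)[OF scale(2)] by (simp add: J_def)
    qed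
    then show ?thesis using zero_values_gens[OF s] v by (simp add: J_def)
  qed
  have JA: "g v \<in> J m" if "g \<in> acting" "v \<in> J m" for g v m
    using that by (induction arbitrary: v rule: acting.induct) (simp_all add: gensJ)
  have J0: "0 \<in> J m" and Jd: "v \<in> J m \<Longrightarrow> w \<in> J m \<Longrightarrow> v - w \<in> J m" for m v w
    by (simp_all add: J_def zero_values_0 zero_values_diff lookup_minus)
  define c where "c m v = (value_table m v, {(i, Poly_Mapping.lookup v (i, None) mod int p ^ m) | i. True})" for m v
  have finc: "finite (c m ` ambient)" for m
  proof -
    have "c m ` ambient \<subseteq> value_table m ` ambient \<times> Pow (UNIV \<times> {0..<int p ^ m})"
      using prime_gt_0_nat[OF p] by (auto simp: c_def)
    then show ?thesis by (rule finite_subset) (simp add: finite_values)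
  qed
  have cJ: "v - w \<in> J m" if "v \<in> ambient" "w \<in> ambient" "c m v = c m w" for v w m
  proof -
    have mem: "(i, Poly_Mapping.lookup v (i, None) mod int p ^ m) \<in> {(i, Poly_Mapping.lookup w (i, None) mod int p ^ m) | i. True}" for i
      using that(3) unfolding c_def by blast
    have "Poly_Mapping.lookup v (i, None) mod int p ^ m = Poly_Mapping.lookup w (i, None) mod int p ^ m" for i
      using mem[of i] unfolding mem_Collect_eq by (elim exE conjE Pair_inject) (simp only:)
    then show ?thesis using that values_eq_imp by (simp add: J_def c_def lookup_minus mod_eq_dvd_iff)
  qed
  show ?thesis
    unfolding residually_finite_def
  proof (rule residuallyI[OF group])
    fix x assume "x \<in> carrier (affine_group ambient acting)" "x \<noteq> \<one>\<^bsub>affine_group ambient acting\<^esub>"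
    then have x: "x \<in> ambient \<times> acting" "x \<noteq> (0, id)" by simp_all
    obtain u where u: "u \<in> ambient" "u \<noteq> 0" "\<And>J. x \<in> congruence_kernel J \<Longrightarrow> u \<in> J"
      using separated[OF x faithful_ambient] by blast
    obtain k where k: "Poly_Mapping.lookup u k \<noteq> 0" using u(2) by (metis poly_mapping_eqI lookup_zero)
    have "\<exists>m. u \<notin> J m"
    proof (cases k rule: valid_key.cases)
      case (1 i)
      define m where "m = nat \<bar>Poly_Mapping.lookup u k\<bar>"
      have "m < p ^ m" using prime_gt_1_nat[OF p] by (simp add: power_gt_expt)
      then have "\<bar>Poly_Mapping.lookup u k\<bar> < int p ^ m" unfolding m_def by (metis nat_less_iff abs_ge_zero of_nat_power)
      then have "\<not> int p ^ m dvd Poly_Mapping.lookup u k" using k dvd_imp_le_int[of "Poly_Mapping.lookup u k" "int p ^ m"] by fastforce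
      then show ?thesis using 1 by (auto simp: J_def)
    next
      case (2 i e)
      then obtain m where "u \<notin> zero_values m" using zero_values_separate[OF u(1)] k by blast
      then show ?thesis by (auto simp: J_def)
    qed
    then obtain m where m: "u \<notin> J m" by blast
    have "congruence_kernel (J m) \<in> finite_index_normals (affine_group ambient acting)"
    proof (rule congruence_kernel[where c = "c m"])
      show "g v \<in> J m" if "g \<in> acting" "v \<in> J m" for g v using JA that .
      show "v - w \<in> J m" if "v \<in> ambient" "w \<in> ambient" "c m v = c m w" for v w using cJ that .
    qed (fact J0 Jd finc)+
    then show "\<exists>N \<in> finite_index_normals (affine_group ambient acting). x \<notin> N \<and>
        (\<forall>H. group H \<longrightarrow> affine_group ambient acting Mod N \<cong> H \<longrightarrow> True)"
      using u(3) m by blast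
  qed
qed

lemma residually_finite_submod: "residually_finite (affine_group (submod c) acting)"
  unfolding residually_finite_def
proof (rule residually_inj_hom[OF residually_finite_ambient[unfolded residually_finite_def]])
  show "(\<lambda>x. x) \<in> hom (affine_group (submod c) acting) (affine_group ambient acting)"
    using submod_ambient by (auto simp: hom_def)
qed simp

text \<open>One pair of groups refutes every property lying between being a p-group and being
  solvable.\<close>

lemma not_profinite_property_between:
  assumes p_imp: "\<And>H. group H \<Longrightarrow> \<exists>n. Coset.order H = p ^ n \<Longrightarrow> C H"
    and imp_solvable: "\<And>H. group H \<Longrightarrow> C H \<Longrightarrow> solvable H"
  shows "\<not> profinite_property (residually C)"
proof (rule not_profinite_property_residually)
  show "dense_homs (affine_group (submod 1) acting) (affine_group (submod 0) acting)
     (affine_group ambient acting) (\<lambda>x. x) (\<lambda>x. x) model_family" by (rule dense_homs_submod)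
  show "residually C (affine_group (submod 1) acting)"
    using residually_p_submod p_imp unfolding residually_p_def by (rule residually_mono)
  show "\<not> residually C (affine_group (submod 0) acting)"
    using not_residually_solvable_submod residually_mono[of C] imp_solvable
    unfolding residually_solvable_def by blast
qed (rule finitely_generated_submod residually_finite_submod)+

end

theorem proposition1p4:
  shows "\<not> profinite_property residually_solvable
    \<and> \<not> profinite_property residually_nilpotent
    \<and> (\<forall>p::nat. Factorial_Ring.prime p \<longrightarrow> \<not> profinite_property (residually_p p))"
proof -
  have between: "\<not> profinite_property (residually C)"
    if "Factorial_Ring.prime p" "\<And>H. group H \<Longrightarrow> \<exists>n. Coset.order H = p ^ n \<Longrightarrow> C H" "\<And>H. group H \<Longrightarrow> C H \<Longrightarrow> solvable H" for p C
    using construction.not_profinite_property_between[OF construction.intro[OF that(1) refl] that(2,3)] .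
  have p_solvable: "solvable H" if "Factorial_Ring.prime p" "group H" "\<exists>n. Coset.order H = p ^ n" for H :: "nat monoid" and p
    using that p_group_nilpotent nilpotent_imp_solvable by blast
  \<comment> \<open>For solvability and nilpotency any prime would do; 2 is chosen.\<close>
  have "\<not> profinite_property (residually (solvable :: nat monoid \<Rightarrow> bool))"
    using p_solvable[OF two_is_prime_nat] by (intro between[OF two_is_prime_nat]) auto
  moreover have "\<not> profinite_property (residually nilpotent)"
    using p_group_nilpotent[OF _ two_is_prime_nat] nilpotent_imp_solvable by (intro between[OF two_is_prime_nat]) blast+
  moreover have "\<not> profinite_property (residually (\<lambda>H. \<exists>n. Coset.order H = p ^ n))" if "Factorial_Ring.prime p" for p
    using p_solvable[OF that] by (intro between[OF that]) auto
  ultimately show ?thesis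
    unfolding residually_solvable_def residually_nilpotent_def residually_p_def by blast
qed

end
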